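(* Let $X\subset\mathbb P^{n+1}$ be a smooth complex projective hypersurface (so $\dim X=n$). Then $$H^0(X,E_{k,m}T^*_X)=0$$ for all integers $m\ge 1$ and all integers $k$ with $1\le k\le n-1$.
   Context: All varieties are over $\mathbb C$. For a complex manifold $X$, $J_kT_X\to X$ denotes the bundle of $k$-jets of germs of holomorphic curves $f\colon(\mathbb C,0)\to X$, with projection $f\mapsto f(0)$; in local coordinates a $k$-jet is given by $f(0)$ and the derivatives $(f',f'',\dots,f^{(k)})$ at $0$. $E^{GG}_{k,m}T^*_X\to X$ is the holomorphic vector bundle whose fibres are the complex-valued polynomials $Q(f',f'',\dots,f^{(k)})$ on the fibres of $J_kT_X$ of weighted degree $m$, i.e. $Q(\lambda f',\lambda^2f'',\dots,\lambda^kf^{(k)})=\lambda^mQ(f',f'',\dots,f^{(k)})$ for all $\lambda\in\mathbb C^*$. The bundle of invariant jet differentials of order $k$ and degree $m$ is the subbundle $E_{k,m}T^*_X\subset E^{GG}_{k,m}T^*_X$ of those $Q$ such that $$Q((f\circ\varphi)',(f\circ\varphi)'',\dots,(f\circ\varphi)^{(k)})=\varphi'(0)^m\,Q(f',f'',\dots,f^{(k)})$$ for every $k$-jet $\varphi$ of biholomorphism of $(\mathbb C,0)$. *)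

theory Defs
  imports "HOL-Analysis.Analysis"
begin

unbundle no fps_syntax

section \<open>Holomorphic functions of several variables\<close>

text \<open>Complex Frechet differentiability; only used on open sets.\<close>

definition holomorphic_several_on ::
    "(complex^'n \<Rightarrow> complex) \<Rightarrow> (complex^'n) set \<Rightarrow> bool" where
  "holomorphic_several_on f S \<longleftrightarrow>
     (\<forall>z\<in>S. \<exists>D. (f has_derivative D) (at z) \<and> (\<forall>c u. D (c *s u) = c * D u))"


section \<open>Projective space and smooth hypersurfaces\<close>

text \<open>Points of projective space are the lines through the origin of \<open>complex^'N\<close>,
  so its dimension is \<open>CARD('N) - 1\<close>.\<close>

definition proj_point :: "complex^'N \<Rightarrow> (complex^'N) set" where
  "proj_point v = vec.span {v}"

definition proj_space :: "(complex^'N) set set" where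
  "proj_space = proj_point ` (- {0})"

text \<open>The quotient topology.\<close>

definition proj_topology :: "(complex^'N) set topology" where
  "proj_topology = topology (\<lambda>U. U \<subseteq> proj_space \<and> open {v. v \<noteq> 0 \<and> proj_point v \<in> U})"

lemma openin_proj_topology:
  fixes U :: "(complex^'N) set set"
  shows "openin proj_topology U \<longleftrightarrow> U \<subseteq> proj_space \<and> open {v. v \<noteq> 0 \<and> proj_point v \<in> U}"
proof -
  let ?P = "\<lambda>U. U \<subseteq> proj_space \<and> open {v::complex^'N. v \<noteq> 0 \<and> proj_point v \<in> U}"
  have top: "istopology ?P"
    unfolding istopology_def
  proof (intro conjI allI impI)
    fix S T :: "(complex^'N) set set"
    assume S: "?P S" and T: "?P T"
    have "{v. v \<noteq> 0 \<and> proj_point v \<in> S \<inter> T} =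
          {v. v \<noteq> 0 \<and> proj_point v \<in> S} \<inter> {v. v \<noteq> 0 \<and> proj_point v \<in> T}" by blast
    with open_Int[OF conjunct2[OF S] conjunct2[OF T]]
    show "open {v. v \<noteq> 0 \<and> proj_point v \<in> S \<inter> T}" by (simp only:)
    from S show "S \<inter> T \<subseteq> proj_space" by blast
  next
    fix K :: "(complex^'N) set set set"
    assume K: "\<forall>S\<in>K. ?P S"
    have "{v. v \<noteq> 0 \<and> proj_point v \<in> \<Union>K} = (\<Union>S\<in>K. {v. v \<noteq> 0 \<and> proj_point v \<in> S})" by blast
    moreover have "open (\<Union>S\<in>K. {v. v \<noteq> 0 \<and> proj_point v \<in> S})"
      by (rule open_UN) (use K in blast)
    ultimately show "open {v. v \<noteq> 0 \<and> proj_point v \<in> \<Union>K}" by (simp only:)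
    from K show "\<Union>K \<subseteq> proj_space" by blast
  qed
  show ?thesis
    unfolding proj_topology_def topology_inverse'[OF top] ..
qed

lemma topspace_proj_topology:
  "topspace proj_topology = (proj_space :: (complex^'N) set set)"
proof
  have "{v::complex^'N. v \<noteq> 0 \<and> proj_point v \<in> proj_space} = - {0}"
    by (auto simp: proj_space_def)
  then have "openin proj_topology (proj_space :: (complex^'N) set set)"
    unfolding openin_proj_topology by (metis open_Compl closed_singleton subset_refl)
  then show "(proj_space :: (complex^'N) set set) \<subseteq> topspace proj_topology"
    by (rule openin_subset)
  show "topspace proj_topology \<subseteq> (proj_space :: (complex^'N) set set)"
    using openin_topspace[of proj_topology] unfolding openin_proj_topology by blast
qed

text \<open>The index set of the sum is finite, since every exponent is at most \<open>d\<close>.\<close>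

definition homogeneous_form :: "nat \<Rightarrow> (complex^'N \<Rightarrow> complex) \<Rightarrow> bool" where
  "homogeneous_form d F \<longleftrightarrow>
     (\<exists>c. F = (\<lambda>v. \<Sum>\<alpha> | (\<Sum>i\<in>UNIV. \<alpha> i) = d. c \<alpha> * (\<Prod>i\<in>UNIV. (v $ i) ^ \<alpha> i)))"

lemma finite_homogeneous_exponents:
  "finite {\<alpha> :: 'N::finite \<Rightarrow> nat. (\<Sum>i\<in>UNIV. \<alpha> i) = d}"
proof (rule finite_subset)
  show "{\<alpha> :: 'N \<Rightarrow> nat. (\<Sum>i\<in>UNIV. \<alpha> i) = d} \<subseteq> UNIV \<rightarrow>\<^sub>E {..d}"
  proof
    fix \<alpha> :: "'N \<Rightarrow> nat"
    assume "\<alpha> \<in> {\<alpha>. (\<Sum>i\<in>UNIV. \<alpha> i) = d}"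
    then have "\<alpha> i \<le> d" for i
      using member_le_sum[of i UNIV \<alpha>] by simp
    then show "\<alpha> \<in> UNIV \<rightarrow>\<^sub>E {..d}" by (simp add: PiE_iff)
  qed
  show "finite ((UNIV :: 'N set) \<rightarrow>\<^sub>E {..d})"
    by (rule finite_PiE) simp_all
qed

definition partial_deriv :: "'N \<Rightarrow> (complex^'N \<Rightarrow> complex) \<Rightarrow> complex^'N \<Rightarrow> complex" where
  "partial_deriv i F v = deriv (\<lambda>t. F (v + axis i t)) 0"

definition smooth_hypersurface :: "(complex^'N) set set \<Rightarrow> bool" where
  "smooth_hypersurface X \<longleftrightarrow>
     (\<exists>d F. d \<ge> 1 \<and> homogeneous_form d F
        \<and> X = proj_point ` {v. v \<noteq> 0 \<and> F v = 0}
        \<and> (\<forall>v. v \<noteq> 0 \<and> F v = 0 \<longrightarrow> (\<exists>i. partial_deriv i F v \<noteq> 0)))"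


section \<open>Holomorphic coordinate charts\<close>

text \<open>A chart is a pair of a domain and a coordinate map on it; a complex manifold modelled on
  \<open>complex^'n\<close> is given by its set of points together with its maximal holomorphic atlas.\<close>

type_synonym ('p, 'n) chart = "'p set \<times> ('p \<Rightarrow> complex^'n)"

text \<open>\<open>h\<close> is near \<open>z\<close> a holomorphic map to projective space, i.e. it has a holomorphic lift \<open>\<Psi>\<close>
  to nonzero vectors, and its differential at \<open>z\<close> is injective. The tangent space of projective
  space at the line through \<open>\<Psi> z\<close> is (up to a twist) the quotient of \<open>complex^'N\<close> by that line.\<close>

definition proj_immersion_at ::
    "(complex^'n \<Rightarrow> (complex^'N) set) \<Rightarrow> complex^'n \<Rightarrow> bool" where
  "proj_immersion_at h z \<longleftrightarrow>
     (\<exists>W \<Psi> D. open W \<and> z \<in> W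
        \<and> (\<forall>i. holomorphic_several_on (\<lambda>w. \<Psi> w $ i) W)
        \<and> (\<forall>w\<in>W. \<Psi> w \<noteq> 0 \<and> h w = proj_point (\<Psi> w))
        \<and> (\<Psi> has_derivative D) (at z)
        \<and> (\<forall>u. D u \<in> proj_point (\<Psi> z) \<longrightarrow> u = 0))"

text \<open>All holomorphic charts of a complex submanifold \<open>X\<close> of projective space.\<close>

definition submanifold_charts ::
    "(complex^'N) set set \<Rightarrow> ((complex^'N) set, 'n::finite) chart set" where
  "submanifold_charts X =
     {(U, \<phi>). openin (subtopology proj_topology X) U \<and> open (\<phi> ` U)
        \<and> homeomorphic_map (subtopology proj_topology U) (top_of_set (\<phi> ` U)) \<phi>
        \<and> (\<forall>z\<in>\<phi> ` U. proj_immersion_at (inv_into U \<phi>) z)}"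


section \<open>Jets of holomorphic curves\<close>

text \<open>Below, \<open>A\<close> is the maximal holomorphic atlas of the manifold. Germs at 0 of holomorphic curves
  are represented by total functions, whose values away from 0 are irrelevant.\<close>

definition curves_at :: "('p, 'n::finite) chart set \<Rightarrow> 'p \<Rightarrow> (complex \<Rightarrow> 'p) set" where
  "curves_at A x =
     {f. f 0 = x \<and> (\<exists>(U, \<phi>)\<in>A. \<exists>r>0. f ` ball 0 r \<subseteq> U
                       \<and> (\<forall>i. (\<lambda>t. \<phi> (f t) $ i) holomorphic_on ball 0 r))}"

text \<open>The \<open>j\<close>-th derivative at 0 of a curve in the coordinates \<open>\<phi>\<close>.\<close>

definition coord_deriv ::
    "('p \<Rightarrow> complex^'n) \<Rightarrow> (complex \<Rightarrow> 'p) \<Rightarrow> nat \<Rightarrow> complex^'n" where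
  "coord_deriv \<phi> f j = (\<chi> i. (deriv ^^ j) (\<lambda>t. \<phi> (f t) $ i) 0)"

definition jet :: "('p, 'n::finite) chart set \<Rightarrow> nat \<Rightarrow> (complex \<Rightarrow> 'p) \<Rightarrow> (complex \<Rightarrow> 'p) set" where
  "jet A k f =
     {g \<in> curves_at A (f 0).
        \<forall>(U, \<phi>)\<in>A. f 0 \<in> U \<longrightarrow> (\<forall>j\<in>{1..k}. coord_deriv \<phi> g j = coord_deriv \<phi> f j)}"

definition jet_fibre :: "('p, 'n::finite) chart set \<Rightarrow> nat \<Rightarrow> 'p \<Rightarrow> (complex \<Rightarrow> 'p) set set" where
  "jet_fibre A k x = jet A k ` curves_at A x"


section \<open>Jet differentials\<close>

text \<open>\<open>\<xi> j\<close> stands for the \<open>j\<close>-th derivative, and \<open>\<alpha> j i\<close> is the exponent of its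
  \<open>i\<close>-th component.\<close>

definition jet_monomial ::
    "nat \<Rightarrow> (nat \<Rightarrow> 'n \<Rightarrow> nat) \<Rightarrow> (nat \<Rightarrow> complex^'n) \<Rightarrow> complex" where
  "jet_monomial k \<alpha> \<xi> = (\<Prod>j=1..k. \<Prod>i\<in>UNIV. (\<xi> j $ i) ^ \<alpha> j i)"

definition weighted_polynomial ::
    "nat \<Rightarrow> nat \<Rightarrow> ((nat \<Rightarrow> complex^'n) \<Rightarrow> complex) \<Rightarrow> bool" where
  "weighted_polynomial k m P \<longleftrightarrow>
     (\<exists>S c. finite S \<and> P = (\<lambda>\<xi>. \<Sum>\<alpha>\<in>S. c \<alpha> * jet_monomial k \<alpha> \<xi>))
     \<and> (\<forall>l \<xi>. l \<noteq> 0 \<longrightarrow> P (\<lambda>j. l ^ j *s \<xi> j) = l ^ m * P \<xi>)"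

text \<open>Functions on a fibre of the jet bundle are extended by 0 outside that fibre.\<close>

definition GG_fibre ::
    "('p, 'n::finite) chart set \<Rightarrow> nat \<Rightarrow> nat \<Rightarrow> 'p \<Rightarrow> ((complex \<Rightarrow> 'p) set \<Rightarrow> complex) set" where
  "GG_fibre A k m x =
     {Q. (\<forall>J. J \<notin> jet_fibre A k x \<longrightarrow> Q J = 0)
       \<and> (\<forall>(U, \<phi>)\<in>A. x \<in> U \<longrightarrow>
            (\<exists>P. weighted_polynomial k m P
               \<and> (\<forall>f\<in>curves_at A x. Q (jet A k f) = P (coord_deriv \<phi> f))))}"

definition biholomorphism_germ :: "(complex \<Rightarrow> complex) \<Rightarrow> bool" where
  "biholomorphism_germ \<rho> \<longleftrightarrow> \<rho> 0 = 0 \<and>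
     (\<exists>U V \<rho>'. open U \<and> open V \<and> 0 \<in> U \<and> homeomorphism U V \<rho> \<rho>'
        \<and> \<rho> holomorphic_on U \<and> \<rho>' holomorphic_on V)"

definition invariant_fibre ::
    "('p, 'n::finite) chart set \<Rightarrow> nat \<Rightarrow> nat \<Rightarrow> 'p \<Rightarrow> ((complex \<Rightarrow> 'p) set \<Rightarrow> complex) set" where
  "invariant_fibre A k m x =
     {Q \<in> GG_fibre A k m x.
        \<forall>f\<in>curves_at A x. \<forall>\<rho>. biholomorphism_germ \<rho> \<longrightarrow>
          Q (jet A k (f \<circ> \<rho>)) = deriv \<rho> 0 ^ m * Q (jet A k f)}"

text \<open>A section is holomorphic if in every chart its coefficients with respect to the monomials in
  the derivatives are holomorphic functions of the coordinates.\<close>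

definition holomorphic_jet_section ::
    "('p, 'n::finite) chart set \<Rightarrow> nat \<Rightarrow> ('p \<Rightarrow> (complex \<Rightarrow> 'p) set \<Rightarrow> complex) \<Rightarrow> bool" where
  "holomorphic_jet_section A k \<sigma> \<longleftrightarrow>
     (\<forall>(U, \<phi>)\<in>A. \<exists>S a. finite S
        \<and> (\<forall>\<alpha>\<in>S. holomorphic_several_on (a \<alpha>) (\<phi> ` U))
        \<and> (\<forall>x\<in>U. \<forall>f\<in>curves_at A x.
             \<sigma> x (jet A k f) = (\<Sum>\<alpha>\<in>S. a \<alpha> (\<phi> x) * jet_monomial k \<alpha> (coord_deriv \<phi> f))))"

text \<open>The space of global holomorphic sections of the bundle of invariant jet differentials of
  order \<open>k\<close> and degree \<open>m\<close>; sections are extended by 0 outside the manifold \<open>X\<close>.\<close>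

definition invariant_jet_differentials ::
    "'p set \<Rightarrow> ('p, 'n::finite) chart set \<Rightarrow> nat \<Rightarrow> nat
       \<Rightarrow> ('p \<Rightarrow> (complex \<Rightarrow> 'p) set \<Rightarrow> complex) set" where
  "invariant_jet_differentials X A k m =
     {\<sigma>. (\<forall>x. x \<notin> X \<longrightarrow> \<sigma> x = (\<lambda>J. 0))
       \<and> (\<forall>x\<in>X. \<sigma> x \<in> invariant_fibre A k m x)
       \<and> holomorphic_jet_section A k \<sigma>}"

end

theory Submission
  imports Defs "HOL-Complex_Analysis.Complex_Analysis"
begin

text \<open>
Let \<open>X\<close> be given by the form \<open>F\<close> in \<open>N = n + 2\<close> variables. A holomorphic curve in \<open>X\<close> lifts locally
to a curve \<open>v\<close> in the cone \<open>F = 0\<close> without its vertex, with derivatives \<open>v 0, v\<^sub>1, \<dots>, v\<^sub>k\<close> at \<open>0\<close>. A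
global invariant jet differential gives a function \<open>q\<close> of such lifts (\<open>cone_fun\<close>). It depends
continuously on the \<open>k\<close>-jet of \<open>v\<close>, is holomorphic along holomorphic families of curves, does not
change when \<open>v\<close> is multiplied by a constant, and is multiplied by \<open>l ^ m\<close> when \<open>t\<close> is replaced by
\<open>l * t\<close> (\<open>curve_functional_cone_fun\<close>). The theorem follows from the fact that such a \<open>q\<close> vanishes when
\<open>k + 2 < N\<close> (\<open>vanishing\<close>). This is a maximum principle argument, which replaces the cohomology
vanishing theorems that are usually applied to symmetric powers of the cotangent bundle.

Suppose that \<open>q\<close> is not zero. Compare a power of \<open>|q v|\<close> with the sum of suitable powers of
\<open>|v\<^sub>j $ i| / |v 0|\<close> over \<open>1 \<le> j \<le> k\<close> and all coordinates \<open>i\<close>, the \<open>jet_size\<close> of \<open>v\<close>; the powers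
are chosen such that the quotient of the two is invariant under both kinds of scaling. Up to scaling,
the jets of curves in the cone form a compact set, because the cone is smooth outside its vertex
(\<open>jet_correction\<close>). So there is a curve \<open>v\<close> at which the quotient is maximal (\<open>extremal_curve\<close>).

Now move the base point \<open>v 0\<close> of this curve in a direction \<open>h\<close> orthogonal to \<open>v 0\<close>, keeping the curve
in the cone and the higher derivatives fixed to first order (\<open>tangent_disc\<close>). This requires that
\<open>h\<close> is orthogonal to \<open>v 0\<close> and tangent to the cone along \<open>v\<close> up to order \<open>k\<close>, which are
\<open>k + 2 \<le> n + 1 < N\<close> linear equations, and so there is a solution \<open>h \<noteq> 0\<close>. The norm of the base
point grows to second order, which makes \<open>jet_size\<close> drop; the numerators are squared moduli of
holomorphic functions without linear term, which do not compensate for this. Maximality would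
now make a power of \<open>|q|\<close>, the modulus of a holomorphic function of the parameter, touch from below
a function that is strictly superharmonic there. This contradicts the maximum principle
(\<open>sum_squares_touching_imp_zero\<close>).

The rest links the two languages. The hypersurface is covered by explicit charts
(\<open>standard_chart\<close>), in which a section is a polynomial in the derivatives of ratios of coordinates of
\<open>v\<close>.
\<close>

unbundle no Formal_Power_Series.fps_syntax

section \<open>Jets of germs of holomorphic functions\<close>

definition vjet :: "(complex \<Rightarrow> complex^'N) \<Rightarrow> nat \<Rightarrow> complex^'N" where
  "vjet v j = (\<chi> i. (deriv ^^ j) (\<lambda>t. v t $ i) 0)"

text \<open>Convergence of the \<open>k\<close>-jets at 0 of a sequence of germs. The germs need not share a disc
  of definition, so this is weaker than locally uniform convergence.\<close>

definition jets_tendsto :: "nat \<Rightarrow> (nat \<Rightarrow> complex \<Rightarrow> complex) \<Rightarrow> (complex \<Rightarrow> complex) \<Rightarrow> bool" where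
  "jets_tendsto k a b \<longleftrightarrow> (\<forall>\<^sub>F n in sequentially. a n analytic_on {0}) \<and> b analytic_on {0}
     \<and> (\<forall>j\<le>k. (\<lambda>n. (deriv ^^ j) (a n) 0) \<longlonglongrightarrow> (deriv ^^ j) b 0)"

lemma jets_tendsto_const: "jets_tendsto k (\<lambda>n t. c) (\<lambda>t. c)"
  by (auto simp: jets_tendsto_def)

lemma jets_tendsto_add:
  assumes "jets_tendsto k a a'" "jets_tendsto k b b'"
  shows "jets_tendsto k (\<lambda>n t. a n t + b n t) (\<lambda>t. a' t + b' t)"
proof -
  have ev: "\<forall>\<^sub>F n in sequentially. a n analytic_on {0} \<and> b n analytic_on {0}"
    using assms by (auto simp: jets_tendsto_def eventually_conj)
  have "(\<lambda>n. (deriv ^^ j) (\<lambda>t. a n t + b n t) 0) \<longlonglongrightarrow> (deriv ^^ j) (\<lambda>t. a' t + b' t) 0" if "j \<le> k" for j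
  proof -
    have "(\<lambda>n. (deriv ^^ j) (a n) 0 + (deriv ^^ j) (b n) 0) \<longlonglongrightarrow> (deriv ^^ j) a' 0 + (deriv ^^ j) b' 0"
      using assms that by (auto simp: jets_tendsto_def intro!: tendsto_add)
    moreover have "\<forall>\<^sub>F n in sequentially. (deriv ^^ j) (a n) 0 + (deriv ^^ j) (b n) 0 = (deriv ^^ j) (\<lambda>t. a n t + b n t) 0"
      using ev by eventually_elim (simp add: higher_deriv_add_at)
    ultimately show ?thesis
      using assms by (simp add: jets_tendsto_def higher_deriv_add_at tendsto_cong)
  qed
  then show ?thesis
    using assms ev by (auto simp: jets_tendsto_def intro!: analytic_intros elim!: eventually_mono)
qed

lemma jets_tendsto_mult:
  assumes "jets_tendsto k a a'" "jets_tendsto k b b'"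
  shows "jets_tendsto k (\<lambda>n t. a n t * b n t) (\<lambda>t. a' t * b' t)"
proof -
  have ev: "\<forall>\<^sub>F n in sequentially. a n analytic_on {0} \<and> b n analytic_on {0}"
    using assms by (auto simp: jets_tendsto_def eventually_conj)
  have "(\<lambda>n. (deriv ^^ j) (\<lambda>t. a n t * b n t) 0) \<longlonglongrightarrow> (deriv ^^ j) (\<lambda>t. a' t * b' t) 0" if "j \<le> k" for j
  proof -
    have "(\<lambda>n. \<Sum>i = 0..j. of_nat (j choose i) * (deriv ^^ i) (a n) 0 * (deriv ^^ (j - i)) (b n) 0)
       \<longlonglongrightarrow> (\<Sum>i = 0..j. of_nat (j choose i) * (deriv ^^ i) a' 0 * (deriv ^^ (j - i)) b' 0)"
      using assms that by (auto simp: jets_tendsto_def intro!: tendsto_intros)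
    moreover have "\<forall>\<^sub>F n in sequentially. (\<Sum>i = 0..j. of_nat (j choose i) * (deriv ^^ i) (a n) 0 * (deriv ^^ (j - i)) (b n) 0) = (deriv ^^ j) (\<lambda>t. a n t * b n t) 0"
      using ev by eventually_elim (simp add: higher_deriv_mult_at)
    ultimately show ?thesis
      using assms by (simp add: jets_tendsto_def higher_deriv_mult_at tendsto_cong)
  qed
  then show ?thesis
    using assms ev by (auto simp: jets_tendsto_def intro!: analytic_intros elim!: eventually_mono)
qed

lemma eventually_nonzero_analytic:
  fixes f :: "complex \<Rightarrow> complex"
  assumes "f analytic_on {z}" "f z \<noteq> 0"
  shows "\<forall>\<^sub>F t in nhds z. f t \<noteq> 0"
  using analytic_at_imp_isCont[OF assms(1)] assms(2)
  by (metis (mono_tags) continuous_at tendsto_imp_eventually_ne eventually_nhds_conv_at isCont_def)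

text \<open>The jet of a quotient satisfies a recursion in which only the value of the denominator
  is inverted, so it depends continuously on the jets of numerator and denominator.\<close>

lemma jets_tendsto_divide:
  assumes "jets_tendsto k a a'" "jets_tendsto k b b'" "b' 0 \<noteq> 0"
  shows "jets_tendsto k (\<lambda>n t. a n t / b n t) (\<lambda>t. a' t / b' t)"
proof -
  define c where "c = (\<lambda>n t. a n t / b n t)"
  define c' where "c' = (\<lambda>t. a' t / b' t)"
  have an': "a' analytic_on {0}" "b' analytic_on {0}" "c' analytic_on {0}"
    using assms by (auto simp: jets_tendsto_def c'_def intro!: analytic_intros)
  have "(\<lambda>n. b n 0) \<longlonglongrightarrow> b' 0"
    using assms(2) by (force simp: jets_tendsto_def dest: spec[of _ 0])
  then have "\<forall>\<^sub>F n in sequentially. b n 0 \<noteq> 0"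
    using assms(3) tendsto_imp_eventually_ne by blast
  then have ev: "\<forall>\<^sub>F n in sequentially. a n analytic_on {0} \<and> b n analytic_on {0} \<and> b n 0 \<noteq> 0"
    using assms by (auto simp: jets_tendsto_def eventually_conj)
  have rec: "(deriv ^^ j) (\<lambda>t. f t / g t) 0 =
     ((deriv ^^ j) f 0 - (\<Sum>i = 1..j. of_nat (j choose i) * (deriv ^^ i) g 0 * (deriv ^^ (j - i)) (\<lambda>t. f t / g t) 0)) / g 0"
    if "f analytic_on {0}" "g analytic_on {0}" "g 0 \<noteq> 0" for f g :: "complex \<Rightarrow> complex" and j
  proof -
    have "\<forall>\<^sub>F t in nhds 0. f t = g t * (f t / g t)"
      using eventually_nonzero_analytic[OF that(2,3)] by eventually_elim auto
    then have "(deriv ^^ j) f 0 = (deriv ^^ j) (\<lambda>t. g t * (f t / g t)) 0"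
      by (rule higher_deriv_cong_ev) simp
    also have "\<dots> = (\<Sum>i = 0..j. of_nat (j choose i) * (deriv ^^ i) g 0 * (deriv ^^ (j - i)) (\<lambda>t. f t / g t) 0)"
      using that by (intro higher_deriv_mult_at analytic_intros) auto
    also have "\<dots> = g 0 * (deriv ^^ j) (\<lambda>t. f t / g t) 0 + (\<Sum>i = 1..j. of_nat (j choose i) * (deriv ^^ i) g 0 * (deriv ^^ (j - i)) (\<lambda>t. f t / g t) 0)"
      by (subst sum.atLeast_Suc_atMost) auto
    finally show ?thesis using that(3) by (simp add: field_simps)
  qed
  have "(\<lambda>n. (deriv ^^ j) (c n) 0) \<longlonglongrightarrow> (deriv ^^ j) c' 0" if "j \<le> k" for j
    using that
  proof (induction j rule: less_induct)
    case (less j)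
    have "(\<lambda>n. ((deriv ^^ j) (a n) 0 - (\<Sum>i = 1..j. of_nat (j choose i) * (deriv ^^ i) (b n) 0 * (deriv ^^ (j - i)) (c n) 0)) / b n 0)
      \<longlonglongrightarrow> ((deriv ^^ j) a' 0 - (\<Sum>i = 1..j. of_nat (j choose i) * (deriv ^^ i) b' 0 * (deriv ^^ (j - i)) c' 0)) / b' 0"
    proof (intro tendsto_intros)
      show "(\<lambda>n. (deriv ^^ (j - i)) (c n) 0) \<longlonglongrightarrow> (deriv ^^ (j - i)) c' 0" if "i \<in> {1..j}" for i
        using less that by auto
    qed (use assms less.prems \<open>(\<lambda>n. b n 0) \<longlonglongrightarrow> b' 0\<close> in \<open>auto simp: jets_tendsto_def\<close>)
    also have "((deriv ^^ j) a' 0 - (\<Sum>i = 1..j. of_nat (j choose i) * (deriv ^^ i) b' 0 * (deriv ^^ (j - i)) c' 0)) / b' 0 = (deriv ^^ j) c' 0"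
      unfolding c'_def by (rule rec[OF an'(1,2) assms(3), symmetric])
    finally show ?case
    proof (rule Lim_transform_eventually)
      show "\<forall>\<^sub>F n in sequentially. ((deriv ^^ j) (a n) 0 - (\<Sum>i = 1..j. of_nat (j choose i) * (deriv ^^ i) (b n) 0 * (deriv ^^ (j - i)) (c n) 0)) / b n 0 = (deriv ^^ j) (c n) 0"
        using ev by eventually_elim (unfold c_def, rule rec[symmetric], auto)
    qed
  qed
  moreover have "\<forall>\<^sub>F n in sequentially. c n analytic_on {0}"
    using ev by eventually_elim (auto simp: c_def intro!: analytic_intros)
  ultimately show ?thesis
    using an' by (simp add: jets_tendsto_def c_def c'_def)
qed

lemma higher_deriv_mult_eq_0:
  assumes "f analytic_on {0}" "g analytic_on {0}" "\<And>j. j \<le> k \<Longrightarrow> (deriv ^^ j) f 0 = 0" "j \<le> k"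
  shows "(deriv ^^ j) (\<lambda>t. f t * g t) 0 = (0::complex)"
  using assms by (auto simp: higher_deriv_mult_at intro!: sum.neutral)

lemma higher_deriv_scale:
  assumes "f analytic_on {0}"
  shows "(deriv ^^ j) (\<lambda>t. f (l * t)) 0 = l ^ j * (deriv ^^ j) f (0::complex)"
proof (cases "l = 0")
  case True
  then show ?thesis by (cases j) auto
next
  case False
  obtain r where r: "r > 0" "f holomorphic_on ball 0 r"
    using assms by (auto simp: analytic_on_def)
  have "(deriv ^^ j) (\<lambda>w. f (l * w)) 0 = l ^ j * (deriv ^^ j) f (l * 0)"
    by (rule higher_deriv_compose_linear[OF r(2), of "ball 0 (r / norm l)"])
      (use r False in \<open>auto simp: norm_mult field_simps\<close>)
  then show ?thesis by simp
qed

text \<open>Any sequence of numbers is the jet of a germ: take its Taylor polynomial.\<close>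

lemma exists_polynomial_with_jet:
  fixes c :: "nat \<Rightarrow> complex"
  obtains f where "f analytic_on {0}" "\<And>j. j \<le> k \<Longrightarrow> (deriv ^^ j) f 0 = c j"
proof
  define f where "f = (\<lambda>n t. \<Sum>l\<le>n. c l / fact l * t ^ l)"
  show an: "f k analytic_on {0}" unfolding f_def by (intro analytic_intros)
  have "(deriv ^^ j) (f n) 0 = (if j \<le> n then c j else 0)" for j n
  proof (induction n)
    case 0
    then show ?case by (simp add: f_def)
  next
    case (Suc n)
    have "(deriv ^^ j) (\<lambda>t::complex. t ^ l) 0 = (if j = l then fact j else 0)" for l
    proof (cases j l rule: linorder_cases)
      case equal
      then show ?thesis using higher_deriv_power[of j 0 l 0] by (simp add: pochhammer_fact)
    next
      case less
      then show ?thesis using higher_deriv_power[of j 0 l 0] by (auto simp: power_0_left)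
    next
      case greater
      then show ?thesis using higher_deriv_power[of j 0 l 0] by (simp add: pochhammer_0_left)
    qed
    then have "(deriv ^^ j) (\<lambda>t. c (Suc n) / fact (Suc n) * t ^ Suc n) 0 = (if j = Suc n then c j else 0)"
      by (subst higher_deriv_cmult') (auto simp del: power_Suc fact_Suc intro!: analytic_intros)
    moreover have "f (Suc n) = (\<lambda>t. f n t + c (Suc n) / fact (Suc n) * t ^ Suc n)"
      by (auto simp: f_def)
    ultimately show ?case
      using Suc by (simp add: f_def higher_deriv_add_at analytic_intros del: power_Suc fact_Suc sum.atMost_Suc)
  qed
  then show "(deriv ^^ j) (f k) 0 = c j" if "j \<le> k" for j using that by simp
qed

section \<open>Holomorphic families of germs\<close>

text \<open>\<open>f s\<close> is a germ of a holomorphic function depending holomorphically on the parameter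
  \<open>s\<close> near 0, and \<open>f'\<close> is the derivative in the parameter. Both are required to be jointly
  continuous, so that one can differentiate under Cauchy's integral.\<close>

definition holo_family :: "(complex \<Rightarrow> complex \<Rightarrow> complex) \<Rightarrow> (complex \<Rightarrow> complex \<Rightarrow> complex) \<Rightarrow> bool" where
  "holo_family f f' \<longleftrightarrow> (\<exists>r>0. (\<forall>s\<in>ball 0 r. f s holomorphic_on ball 0 r)
     \<and> (\<forall>s\<in>ball 0 r. \<forall>t\<in>ball 0 r. ((\<lambda>s. f s t) has_field_derivative f' s t) (at s))
     \<and> continuous_on (ball 0 r \<times> ball 0 r) (\<lambda>(s, t). f s t)
     \<and> continuous_on (ball 0 r \<times> ball 0 r) (\<lambda>(s, t). f' s t))"

lemma holo_family_divide:
  assumes f: "holo_family f f'" and g: "holo_family g g'" and nz: "g 0 0 \<noteq> 0"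
  shows "holo_family (\<lambda>s t. f s t / g s t) (\<lambda>s t. (f' s t * g s t - f s t * g' s t) / (g s t * g s t))"
proof -
  obtain r1 where r1: "r1 > 0" "\<forall>s\<in>ball 0 r1. f s holomorphic_on ball 0 r1"
     "\<forall>s\<in>ball 0 r1. \<forall>t\<in>ball 0 r1. ((\<lambda>s. f s t) has_field_derivative f' s t) (at s)"
     "continuous_on (ball 0 r1 \<times> ball 0 r1) (\<lambda>(s, t). f s t)"
     "continuous_on (ball 0 r1 \<times> ball 0 r1) (\<lambda>(s, t). f' s t)"
    using f by (auto simp: holo_family_def)
  obtain r2 where r2: "r2 > 0" "\<forall>s\<in>ball 0 r2. g s holomorphic_on ball 0 r2"
     "\<forall>s\<in>ball 0 r2. \<forall>t\<in>ball 0 r2. ((\<lambda>s. g s t) has_field_derivative g' s t) (at s)"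
     "continuous_on (ball 0 r2 \<times> ball 0 r2) (\<lambda>(s, t). g s t)"
     "continuous_on (ball 0 r2 \<times> ball 0 r2) (\<lambda>(s, t). g' s t)"
    using g by (auto simp: holo_family_def)
  have "isCont (\<lambda>(s, t). g s t) (0, 0)"
    using r2(1,4) continuous_on_eq_continuous_at[OF open_Times[OF open_ball open_ball]] by force
  then have "((\<lambda>(s, t). g s t) \<longlongrightarrow> g 0 0) (nhds (0, 0))"
    by (simp add: isCont_def tendsto_nhds_iff)
  then have "\<forall>\<^sub>F p in nhds (0, 0). (\<lambda>(s, t). g s t) p \<noteq> 0"
    using nz by (rule tendsto_imp_eventually_ne)
  then obtain e where e: "e > 0" "\<And>s t. dist (s, t) (0, 0) < e \<Longrightarrow> g s t \<noteq> 0"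
    unfolding eventually_nhds_metric by auto
  define r where "r = min (min r1 r2) (e / 2)"
  have r: "r > 0" "r \<le> r1" "r \<le> r2" "r \<le> e / 2" using r1 r2 e by (auto simp: r_def)
  have nz': "g s t \<noteq> 0" if "s \<in> ball 0 r" "t \<in> ball 0 r" for s t
  proof (rule e(2))
    have "dist (s, t) (0, 0) \<le> dist s 0 + dist t 0"
      unfolding dist_Pair_Pair by (rule sqrt_sum_squares_le_sum) auto
    then show "dist (s, t) (0, 0) < e" using that r by simp
  qed
  have sub: "ball 0 r \<subseteq> ball (0::complex) r1" "ball 0 r \<subseteq> ball (0::complex) r2" using r by auto
  have c: "continuous_on (ball 0 r \<times> ball 0 r) (\<lambda>p. f (fst p) (snd p))"
      "continuous_on (ball 0 r \<times> ball 0 r) (\<lambda>p. f' (fst p) (snd p))"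
      "continuous_on (ball 0 r \<times> ball 0 r) (\<lambda>p. g (fst p) (snd p))"
      "continuous_on (ball 0 r \<times> ball 0 r) (\<lambda>p. g' (fst p) (snd p))"
    using r1(4,5) r2(4,5) sub unfolding case_prod_unfold
    by (auto elim!: continuous_on_subset)
  have "(\<lambda>t. f s t / g s t) holomorphic_on ball 0 r" if "s \<in> ball 0 r" for s
  proof -
    have "f s holomorphic_on ball 0 r" "g s holomorphic_on ball 0 r"
      using r1(2) r2(2) sub that by (meson holomorphic_on_subset subsetD)+
    then show ?thesis using nz'[OF that] by (intro holomorphic_intros) auto
  qed
  moreover have "((\<lambda>s. f s t / g s t) has_field_derivative (f' s t * g s t - f s t * g' s t) / (g s t * g s t)) (at s)"
    if "s \<in> ball 0 r" "t \<in> ball 0 r" for s t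
  proof -
    have "((\<lambda>s. f s t) has_field_derivative f' s t) (at s)" "((\<lambda>s. g s t) has_field_derivative g' s t) (at s)"
      using r1(3) r2(3) sub that by blast+
    then show ?thesis using nz'[OF that] by (rule DERIV_divide)
  qed
  moreover have "continuous_on (ball 0 r \<times> ball 0 r) (\<lambda>(s, t). f s t / g s t)"
    unfolding case_prod_unfold using nz' by (intro continuous_intros c) auto
  moreover have "continuous_on (ball 0 r \<times> ball 0 r) (\<lambda>(s, t). (f' s t * g s t - f s t * g' s t) / (g s t * g s t))"
    unfolding case_prod_unfold using nz' by (intro continuous_intros c) auto
  ultimately show ?thesis using r(1) unfolding holo_family_def by blast
qed

text \<open>Cauchy's formula writes the derivative in \<open>t\<close> as an integral over a fixed circle, and
  the parameter derivative passes under the integral sign. Hence jets of a holomorphic family are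
  holomorphic in the parameter, and the two differentiations commute.\<close>

lemma holo_family_jet:
  assumes "holo_family f f'"
  shows holo_family_jet_analytic: "(\<lambda>s. (deriv ^^ j) (f s) 0) analytic_on {0}"
    and holo_family_jet_deriv: "f' 0 analytic_on {0} \<Longrightarrow>
      ((\<lambda>s. (deriv ^^ j) (f s) 0) has_field_derivative (deriv ^^ j) (f' 0) 0) (at 0)"
proof -
  obtain r where r: "r > 0" "\<forall>s\<in>ball 0 r. f s holomorphic_on ball 0 r"
     "\<forall>s\<in>ball 0 r. \<forall>t\<in>ball 0 r. ((\<lambda>s. f s t) has_field_derivative f' s t) (at s)"
     "continuous_on (ball 0 r \<times> ball 0 r) (\<lambda>(s, t). f' s t)"
    using assms by (auto simp: holo_family_def)
  define C where "C = fact j / (2 * complex_of_real pi * \<i>)"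
  define I where "I = (\<lambda>\<rho> h. integral (cbox 0 1) (\<lambda>x. h (circlepath 0 \<rho> x) / circlepath 0 \<rho> x ^ Suc j * vector_derivative (circlepath 0 \<rho>) (at x)))"
  have cauchy: "(deriv ^^ j) h 0 = C * I \<rho> h" "(\<lambda>x. h (circlepath 0 \<rho> x) / circlepath 0 \<rho> x ^ Suc j * vector_derivative (circlepath 0 \<rho>) (at x)) integrable_on cbox 0 1"
    if "h holomorphic_on ball 0 R" "0 < \<rho>" "\<rho> < R" for h \<rho> R
  proof -
    have sub: "cball 0 \<rho> \<subseteq> ball (0::complex) R" "ball 0 \<rho> \<subseteq> ball (0::complex) R"
      using that by auto
    have "continuous_on (cball 0 \<rho>) h" "h holomorphic_on ball 0 \<rho>"
      using that(1) sub by (auto intro: holomorphic_on_subset holomorphic_on_imp_continuous_on)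
    from Cauchy_has_contour_integral_higher_derivative_circlepath[OF this, of 0 j] that(2)
    have "((\<lambda>u. h u / (u - 0) ^ Suc j) has_contour_integral 2 * of_real pi * \<i> / fact j * (deriv ^^ j) h 0) (circlepath 0 \<rho>)"
      by simp
    then have *: "((\<lambda>x. h (circlepath 0 \<rho> x) / circlepath 0 \<rho> x ^ Suc j * vector_derivative (circlepath 0 \<rho>) (at x))
        has_integral (2 * of_real pi * \<i> / fact j * (deriv ^^ j) h 0)) (cbox 0 1)"
      by (simp add: has_contour_integral)
    show "(\<lambda>x. h (circlepath 0 \<rho> x) / circlepath 0 \<rho> x ^ Suc j * vector_derivative (circlepath 0 \<rho>) (at x)) integrable_on cbox 0 1"
      using * by blast
    show "(deriv ^^ j) h 0 = C * I \<rho> h"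
      using integral_unique[OF *] by (simp add: C_def I_def)
  qed
  have der: "((\<lambda>s. (deriv ^^ j) (f s) 0) has_field_derivative C * I \<rho> (f' s)) (at s)"
    if s: "s \<in> ball 0 r" and \<rho>: "0 < \<rho>" "\<rho> < r" for s \<rho>
  proof -
    have circ: "circlepath 0 \<rho> x \<in> ball 0 r" "circlepath 0 \<rho> x \<noteq> 0" for x :: real
      using \<rho> by (auto simp: circlepath norm_mult)
    have "((\<lambda>s. I \<rho> (f s)) has_field_derivative I \<rho> (f' s)) (at s within ball 0 r)"
      unfolding I_def
    proof (rule leibniz_rule_field_derivative)
      show "((\<lambda>s. f s (circlepath 0 \<rho> x) / circlepath 0 \<rho> x ^ Suc j * vector_derivative (circlepath 0 \<rho>) (at x))
        has_field_derivative f' s (circlepath 0 \<rho> x) / circlepath 0 \<rho> x ^ Suc j * vector_derivative (circlepath 0 \<rho>) (at x)) (at s within ball 0 r)"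
        if "s \<in> ball 0 r" for s and x :: real
        using r(3) circ[of x] that
        by (intro DERIV_cmult_right DERIV_cdivide) (auto intro: has_field_derivative_at_within)
      show "(\<lambda>x. f s (circlepath 0 \<rho> x) / circlepath 0 \<rho> x ^ Suc j * vector_derivative (circlepath 0 \<rho>) (at x)) integrable_on cbox 0 1"
        if "s \<in> ball 0 r" for s
        using r(2) that \<rho> by (intro cauchy(2)) auto
      have "continuous_on (ball 0 r \<times> cbox 0 1) (\<lambda>p. (\<lambda>(s, t). f' s t) (fst p, circlepath 0 \<rho> (snd p)))"
        using circ(1) by (intro continuous_on_compose2[OF r(4)] continuous_intros)
          (auto simp: circlepath intro!: continuous_intros)
      then show "continuous_on (ball 0 r \<times> cbox 0 1)
         (\<lambda>(s, x). f' s (circlepath 0 \<rho> x) / circlepath 0 \<rho> x ^ Suc j * vector_derivative (circlepath 0 \<rho>) (at x))"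
        using circ unfolding case_prod_unfold vector_derivative_circlepath
        by (intro continuous_intros) (auto simp: circlepath intro!: continuous_intros)
    qed (use s in auto)
    then have "((\<lambda>s. C * I \<rho> (f s)) has_field_derivative C * I \<rho> (f' s)) (at s)"
      using s by (intro DERIV_cmult) (simp add: at_within_open[of _ "ball 0 r"])
    then show ?thesis
    proof (rule has_field_derivative_transform_within_open[where S = "ball 0 r"])
      show "C * I \<rho> (f s) = (deriv ^^ j) (f s) 0" if "s \<in> ball 0 r" for s
        using r(2) that \<rho> by (intro cauchy(1)[symmetric]) auto
    qed (use s in auto)
  qed
  have "(\<lambda>s. (deriv ^^ j) (f s) 0) holomorphic_on ball 0 r"
    unfolding holomorphic_on_open[OF open_ball]
  proof
    fix s :: complex
    assume "s \<in> ball 0 r"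
    from der[OF this, of "r / 2"] r(1)
    show "\<exists>D. ((\<lambda>s. (deriv ^^ j) (f s) 0) has_field_derivative D) (at s)" by auto
  qed
  then show "(\<lambda>s. (deriv ^^ j) (f s) 0) analytic_on {0}"
    using r(1) by (auto simp: analytic_on_def)
  assume "f' 0 analytic_on {0}"
  then obtain R where R: "R > 0" "f' 0 holomorphic_on ball 0 R"
    by (auto simp: analytic_on_def)
  define \<rho> where "\<rho> = min r R / 2"
  have \<rho>: "0 < \<rho>" "\<rho> < r" "\<rho> < R" using r(1) R(1) by (auto simp: \<rho>_def)
  show "((\<lambda>s. (deriv ^^ j) (f s) 0) has_field_derivative (deriv ^^ j) (f' 0) 0) (at 0)"
    using der[of 0 \<rho>] cauchy(1)[OF R(2), of \<rho>] \<rho> r(1) by simp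
qed

section \<open>A maximum principle\<close>

text \<open>If \<open>G 0 \<noteq> 0\<close>, the Laplacian at 0 of the smaller side would be positive, and that of the larger
  side is zero, although both sides agree at 0. To turn this into an application of the maximum principle, replace
  \<open>|b i s|\<^sup>2\<close> by its linearisation \<open>2 Re (cnj (b i 0) * b i s) - |b i 0|\<^sup>2\<close>, which is the real part of a
  holomorphic function; the error \<open>|b i s - b i 0|\<^sup>2\<close> is \<open>o(|s|\<^sup>2)\<close> because the derivative of \<open>b i\<close>
  vanishes at 0. If \<open>G 0\<close> were nonzero, the term \<open>c * |s|\<^sup>2 * |G s|\<close> would dominate this error.\<close>

lemma sum_squares_touching_imp_zero:
  fixes G :: "complex \<Rightarrow> complex" and b :: "'i \<Rightarrow> complex \<Rightarrow> complex"
  assumes fin: "finite I" and G: "G analytic_on {0}" and b: "\<And>i. i \<in> I \<Longrightarrow> b i analytic_on {0}"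
    and b': "\<And>i. i \<in> I \<Longrightarrow> (b i has_field_derivative 0) (at 0)" and c: "c > 0"
    and le: "\<forall>\<^sub>F s in nhds 0. norm (G s) * (1 + c * (norm s)\<^sup>2) \<le> (\<Sum>i\<in>I. (norm (b i s))\<^sup>2)"
    and eq: "norm (G 0) = (\<Sum>i\<in>I. (norm (b i 0))\<^sup>2)"
  shows "G 0 = 0"
proof (rule ccontr)
  assume nz: "G 0 \<noteq> 0"
  define g where "g = norm (G 0)"
  have g: "g > 0" using nz by (simp add: g_def)
  \<comment> \<open>\<open>\<omega>\<close> rotates \<open>G 0\<close> to the positive axis. \<open>H\<close> is the holomorphic part of the linearisation, and the
  constant in \<open>E\<close> makes \<open>E 0 = 0\<close>.\<close>
  define \<omega> where "\<omega> = cnj (G 0) / of_real g"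
  have om: "\<omega> * G 0 = of_real g" "norm \<omega> = 1"
    using g by (auto simp: \<omega>_def g_def norm_divide complex_norm_square[symmetric] mult.commute[of "cnj _"]
        power2_eq_square field_simps)
  define H where "H = (\<lambda>s. \<Sum>i\<in>I. cnj (b i 0) * b i s)"
  define E where "E = (\<lambda>s. \<omega> * G s - 2 * H s + of_real g)"
  have H: "H analytic_on {0}" unfolding H_def by (intro analytic_intros b)
  have E: "E analytic_on {0}" unfolding E_def by (intro analytic_intros H G)
  have "H 0 = of_real g"
    unfolding H_def g_def eq of_real_sum
    by (intro sum.cong refl) (metis complex_norm_square mult.commute)
  then have E0: "E 0 = 0" by (simp add: E_def om)
  have expand: "(\<Sum>i\<in>I. (norm (b i s))\<^sup>2) = 2 * Re (H s) - g + (\<Sum>i\<in>I. (norm (b i s - b i 0))\<^sup>2)" for s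
  proof -
    have "(norm z)\<^sup>2 = 2 * Re (cnj w * z) - (norm w)\<^sup>2 + (norm (z - w))\<^sup>2" for z w :: complex
      unfolding cmod_power2 by (simp add: algebra_simps power2_eq_square)
    then have "(\<Sum>i\<in>I. (norm (b i s))\<^sup>2) = (\<Sum>i\<in>I. 2 * Re (cnj (b i 0) * b i s) - (norm (b i 0))\<^sup>2 + (norm (b i s - b i 0))\<^sup>2)"
      by (intro sum.cong) auto
    then show ?thesis
      by (simp add: H_def g_def eq sum.distrib sum_subtractf sum_distrib_left)
  qed
  have small: "\<forall>\<^sub>F s in at 0. (\<Sum>i\<in>I. (norm (b i s - b i 0))\<^sup>2) \<le> c * g / 4 * (norm s)\<^sup>2"
  proof -
    have "((\<lambda>s. \<Sum>i\<in>I. (norm ((b i s - b i 0) / (s - 0)))\<^sup>2) \<longlongrightarrow> (\<Sum>i\<in>I. (norm (0::complex))\<^sup>2)) (at 0)"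
      using b' by (intro tendsto_intros) (auto simp: has_field_derivative_iff)
    then have "\<forall>\<^sub>F s in at 0. (\<Sum>i\<in>I. (norm ((b i s - b i 0) / (s - 0)))\<^sup>2) < c * g / 4"
      using c g by (intro order_tendstoD) (auto simp: power2_eq_square)
    moreover have "\<forall>\<^sub>F s in at (0::complex). s \<noteq> 0" by (rule eventually_neq_at_within)
    ultimately show ?thesis
    proof eventually_elim
      case (elim s)
      have "(\<Sum>i\<in>I. (norm ((b i s - b i 0) / (s - 0)))\<^sup>2) = (\<Sum>i\<in>I. (norm (b i s - b i 0))\<^sup>2) / (norm s)\<^sup>2"
        by (simp add: norm_divide power_divide sum_divide_distrib)
      with elim(1) have "(\<Sum>i\<in>I. (norm (b i s - b i 0))\<^sup>2) / (norm s)\<^sup>2 < c * g / 4"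
        by (simp only:)
      then show ?case using elim(2) by (simp add: pos_divide_less_eq)
    qed
  qed
  have "isCont G 0" using G by (rule analytic_at_imp_isCont)
  then have "((\<lambda>s. norm (G s)) \<longlongrightarrow> g) (at 0)"
    unfolding g_def isCont_def by (intro tendsto_intros)
  then have big: "\<forall>\<^sub>F s in at 0. norm (G s) > g / 2"
    using g by (intro order_tendstoD) auto
  have le': "\<forall>\<^sub>F s in at 0. norm (G s) * (1 + c * (norm s)\<^sup>2) \<le> (\<Sum>i\<in>I. (norm (b i s))\<^sup>2)"
    using le by (simp add: eventually_nhds_conv_at)
  have "\<forall>\<^sub>F s in at 0. Re (E s) < 0"
    using small big le' eventually_neq_at_within[of 0 0 UNIV]
  proof eventually_elim
    case (elim s)
    have "Re (\<omega> * G s) \<le> norm (G s)"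
      using complex_Re_le_cmod[of "\<omega> * G s"] om by (simp add: norm_mult)
    then have "Re (E s) \<le> norm (G s) - 2 * Re (H s) + g" by (simp add: E_def)
    also have "\<dots> \<le> (\<Sum>i\<in>I. (norm (b i s - b i 0))\<^sup>2) - c * (norm s)\<^sup>2 * norm (G s)"
      using elim(3) expand[of s] by (simp add: algebra_simps)
    also have "\<dots> \<le> c * g / 4 * (norm s)\<^sup>2 - c * (norm s)\<^sup>2 * (g / 2)"
      using elim c by (intro diff_mono mult_left_mono) auto
    also have "\<dots> < 0" using c g elim by (simp add: algebra_simps)
    finally show ?case .
  qed
  then obtain d where d: "d > 0" "\<And>s. s \<noteq> 0 \<Longrightarrow> dist s 0 < d \<Longrightarrow> Re (E s) < 0"
    unfolding eventually_at by blast
  obtain e where e: "e > 0" "E holomorphic_on ball 0 e"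
    using E by (auto simp: analytic_on_def)
  let ?B = "ball (0::complex) (min d e)"
  \<comment> \<open>The real part of \<open>E\<close> has a strict maximum at 0, and \<open>|exp E| = exp (Re E)\<close>.\<close>
  have "(\<lambda>s. exp (E s)) constant_on ?B"
  proof (rule maximum_modulus_principle[where U = ?B and \<xi> = 0])
    show "(\<lambda>s. exp (E s)) holomorphic_on ?B"
      using e(2) by (intro holomorphic_intros) (auto elim: holomorphic_on_subset)
    show "norm (exp (E s)) \<le> norm (exp (E 0))" if "s \<in> ?B" for s
      using d(2)[of s] that E0 by (cases "s = 0") auto
  qed (use d e in auto)
  moreover obtain s :: complex where s: "s \<in> ?B" "s \<noteq> 0"
    using d e by (intro that[of "of_real (min d e / 2)"]) auto
  ultimately have "exp (E s) = exp (E 0)"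
    using d e unfolding constant_on_def by (metis centre_in_ball min_less_iff_conj)
  then have "norm (exp (E s)) = 1" by (simp add: E0)
  then show False using d(2)[of s] s by simp
qed

section \<open>Polynomial functions and linear algebra\<close>

lemma has_derivative_vecI:
  fixes f :: "'a::real_normed_vector \<Rightarrow> complex^'N"
  assumes "\<And>i. ((\<lambda>x. f x $ i) has_derivative (\<lambda>h. D h $ i)) (at x within S)"
  shows "(f has_derivative D) (at x within S)"
proof (subst has_derivative_componentwise_within, intro ballI)
  fix b :: "complex^'N" assume "b \<in> Basis"
  then obtain i c where b: "b = axis i c" by (auto simp: Basis_vec_def)
  show "((\<lambda>x. f x \<bullet> b) has_derivative (\<lambda>h. D h \<bullet> b)) (at x within S)"
    unfolding b inner_axis using assms by (intro has_derivative_inner_left)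
qed

text \<open>The chain rule along a holomorphic curve, for a function whose real Frechet derivative is
  complex linear.\<close>

lemma has_field_derivative_compose_vec:
  fixes v :: "complex \<Rightarrow> complex^'N" and f :: "complex^'N \<Rightarrow> complex"
  assumes f: "(f has_derivative D) (at (v s))" and D: "\<And>c u. D (c *s u) = c * D u"
    and v: "\<And>i. ((\<lambda>s. v s $ i) has_field_derivative v' $ i) (at s)"
  shows "((\<lambda>s. f (v s)) has_field_derivative D v') (at s)"
proof -
  have "(v has_derivative (\<lambda>h. h *s v')) (at s)"
    by (rule has_derivative_vecI) (use v in \<open>simp add: has_field_derivative_def mult.commute[of _ "v' $ _"]\<close>)
  from has_derivative_compose[OF this f] show ?thesis
    by (simp add: D has_field_derivative_def mult_commute_abs)
qed

text \<open>Polynomial functions. Each of the properties needed of the equation of a hypersurface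
  is stable under sums and products.\<close>

inductive poly_fun :: "(complex^'N \<Rightarrow> complex) \<Rightarrow> bool" where
  const: "poly_fun (\<lambda>v. c)"
| coord: "poly_fun (\<lambda>v. v $ i)"
| add: "poly_fun P \<Longrightarrow> poly_fun Q \<Longrightarrow> poly_fun (\<lambda>v. P v + Q v)"
| mult: "poly_fun P \<Longrightarrow> poly_fun Q \<Longrightarrow> poly_fun (\<lambda>v. P v * Q v)"

lemma poly_fun_power: "poly_fun P \<Longrightarrow> poly_fun (\<lambda>v. P v ^ n)"
  by (induction n) (auto intro: poly_fun.intros)

lemma poly_fun_sum: "finite A \<Longrightarrow> (\<And>x. x \<in> A \<Longrightarrow> poly_fun (P x)) \<Longrightarrow> poly_fun (\<lambda>v. \<Sum>x\<in>A. P x v)"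
  by (induction A rule: finite_induct) (auto intro: poly_fun.intros)

lemma poly_fun_prod: "finite A \<Longrightarrow> (\<And>x. x \<in> A \<Longrightarrow> poly_fun (P x)) \<Longrightarrow> poly_fun (\<lambda>v. \<Prod>x\<in>A. P x v)"
  by (induction A rule: finite_induct) (auto intro: poly_fun.intros)

lemma homogeneous_form_poly_fun: "homogeneous_form d F \<Longrightarrow> poly_fun F"
  by (auto simp: homogeneous_form_def finite_homogeneous_exponents
      intro!: poly_fun_sum poly_fun_prod poly_fun_power poly_fun.intros)

lemma homogeneous_form_scale:
  assumes "homogeneous_form d F"
  shows "F (c *s v) = c ^ d * F v"
proof -
  obtain a where F: "F = (\<lambda>v. \<Sum>\<alpha> | (\<Sum>i\<in>UNIV. \<alpha> i) = d. a \<alpha> * (\<Prod>i\<in>UNIV. (v $ i) ^ \<alpha> i))"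
    using assms by (auto simp: homogeneous_form_def)
  have "(\<Prod>i\<in>UNIV. ((c *s v) $ i) ^ \<alpha> i) = c ^ d * (\<Prod>i\<in>UNIV. (v $ i) ^ \<alpha> i)" if "(\<Sum>i\<in>UNIV. \<alpha> i) = d" for \<alpha>
    using that by (simp add: power_mult_distrib prod.distrib power_sum[symmetric])
  then show ?thesis
    unfolding F sum_distrib_left by (intro sum.cong) (auto simp: mult_ac)
qed

lemma poly_fun_derivative:
  assumes "poly_fun P"
  shows poly_fun_partial_deriv: "poly_fun (partial_deriv i P)"
    and poly_fun_has_derivative: "(P has_derivative (\<lambda>u. \<Sum>i\<in>UNIV. partial_deriv i P v * u $ i)) (at v)"
proof -
  have "\<exists>D. (\<forall>i. poly_fun (D i)) \<and> (\<forall>v. (P has_derivative (\<lambda>u. \<Sum>i\<in>UNIV. D i v * u $ i)) (at v))"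
    using assms
  proof induction
    case (const c)
    show ?case by (rule exI[of _ "\<lambda>i v. 0"]) (auto intro: poly_fun.intros)
  next
    case (coord l)
    have "(\<Sum>i\<in>UNIV. (if i = l then 1 else 0) * u $ i) = u $ l" for u :: "complex^'a"
      by (simp add: if_distrib if_distribR cong: if_cong)
    then show ?case
      by (intro exI[of _ "\<lambda>i v. if i = l then 1 else 0"])
        (auto intro: poly_fun.intros bounded_linear_imp_has_derivative bounded_linear_vec_nth)
  next
    case (add P Q)
    then obtain D E where "\<forall>i. poly_fun (D i)" "\<forall>v. (P has_derivative (\<lambda>u. \<Sum>i\<in>UNIV. D i v * u $ i)) (at v)"
      "\<forall>i. poly_fun (E i)" "\<forall>v. (Q has_derivative (\<lambda>u. \<Sum>i\<in>UNIV. E i v * u $ i)) (at v)" by blast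
    then show ?case
      by (intro exI[of _ "\<lambda>i v. D i v + E i v"])
        (auto intro!: poly_fun.intros derivative_eq_intros simp: sum.distrib ring_distribs)
  next
    case (mult P Q)
    then obtain D E where "\<forall>i. poly_fun (D i)" "\<forall>v. (P has_derivative (\<lambda>u. \<Sum>i\<in>UNIV. D i v * u $ i)) (at v)"
      "\<forall>i. poly_fun (E i)" "\<forall>v. (Q has_derivative (\<lambda>u. \<Sum>i\<in>UNIV. E i v * u $ i)) (at v)" by blast
    with mult.hyps show ?case
      by (intro exI[of _ "\<lambda>i v. P v * E i v + D i v * Q v"])
        (auto intro!: poly_fun.intros derivative_eq_intros simp: sum.distrib ring_distribs sum_distrib_left sum_distrib_right mult_ac)
  qed
  then obtain D where D: "\<And>i. poly_fun (D i)" "\<And>v. (P has_derivative (\<lambda>u. \<Sum>i\<in>UNIV. D i v * u $ i)) (at v)" by blast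
  have "partial_deriv i P v = D i v" for i v
  proof -
    have "((\<lambda>t. P (v + axis i t)) has_field_derivative (\<Sum>l\<in>UNIV. D l v * axis i 1 $ l)) (at 0)"
    proof (rule has_field_derivative_compose_vec)
      show "(P has_derivative (\<lambda>u. \<Sum>l\<in>UNIV. D l v * u $ l)) (at (v + axis i 0))" 
        using D(2)[of v] by (simp add: axis_def zero_vec_def[symmetric])
      show "((\<lambda>t. (v + axis i t) $ l) has_field_derivative axis i 1 $ l) (at 0)" for l
        by (cases "l = i") (auto simp: axis_def intro!: derivative_eq_intros)
    qed (simp add: sum_distrib_left mult_ac)
    moreover have "(\<Sum>l\<in>UNIV. D l v * axis i 1 $ l) = D i v"
      by (simp add: axis_def if_distrib cong: if_cong)
    ultimately show ?thesis
      unfolding partial_deriv_def by (simp add: DERIV_imp_deriv)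
  qed
  then have "partial_deriv i P = D i" for i by blast
  with D show "poly_fun (partial_deriv i P)" "(P has_derivative (\<lambda>u. \<Sum>i\<in>UNIV. partial_deriv i P v * u $ i)) (at v)"
    by simp_all
qed

lemma poly_fun_continuous_on: "poly_fun P \<Longrightarrow> continuous_on S P"
  by (meson poly_fun_has_derivative has_derivative_continuous continuous_at_imp_continuous_on)

lemma poly_fun_field_derivative:
  assumes "poly_fun P" "\<And>i. ((\<lambda>s. v s $ i) has_field_derivative v' $ i) (at s)"
  shows "((\<lambda>s. P (v s)) has_field_derivative (\<Sum>i\<in>UNIV. partial_deriv i P (v s) * v' $ i)) (at s)"
  by (rule has_field_derivative_compose_vec[OF poly_fun_has_derivative[OF assms(1)] _ assms(2)])
    (simp add: sum_distrib_left mult_ac)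

lemma poly_fun_partial_field_derivative:
  assumes "poly_fun P"
  shows "((\<lambda>t. P (v + axis i t)) has_field_derivative partial_deriv i P v) (at 0)"
proof -
  have "((\<lambda>t. P (v + axis i t)) has_field_derivative (\<Sum>l\<in>UNIV. partial_deriv l P (v + axis i 0) * axis i 1 $ l)) (at 0)"
  proof (rule poly_fun_field_derivative[OF assms])
    show "((\<lambda>t. (v + axis i t) $ l) has_field_derivative axis i 1 $ l) (at 0)" for l
      by (cases "l = i") (auto simp: axis_def intro!: derivative_eq_intros)
  qed
  moreover have "(\<Sum>l\<in>UNIV. partial_deriv l P (v + axis i 0) * axis i 1 $ l) = partial_deriv i P v"
    by (simp add: axis_def if_distrib zero_vec_def[symmetric] cong: if_cong)
  ultimately show ?thesis by simp
qed

lemma poly_fun_analytic: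
  assumes "poly_fun P" "\<And>i. (\<lambda>t. v t $ i) analytic_on S"
  shows "(\<lambda>t. P (v t)) analytic_on S"
  using assms(1) by induction (auto intro!: analytic_intros assms(2))

lemma poly_fun_jets_tendsto:
  assumes "poly_fun P" "\<And>i. jets_tendsto k (\<lambda>n t. v n t $ i) (\<lambda>t. w t $ i)"
  shows "jets_tendsto k (\<lambda>n t. P (v n t)) (\<lambda>t. P (w t))"
  using assms(1) by induction (auto intro!: jets_tendsto_const jets_tendsto_add jets_tendsto_mult assms(2))

text \<open>The difference of the values at two points on a line parallel to a coordinate axis is
  divisible by the difference of that coordinate, and at coinciding points the quotient is the partial
  derivative.\<close>

lemma poly_fun_difference:
  assumes "poly_fun P" "\<And>i. (\<lambda>t. p t $ i) analytic_on {0}" "\<delta> analytic_on {0}" "\<delta> 0 = 0"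
  obtains Q where "Q analytic_on {0}" "Q 0 = partial_deriv l P (p 0)"
    "\<And>t. P (p t + axis l (\<delta> t)) = P (p t) + Q t * \<delta> t"
proof -
  have "\<exists>Q. Q analytic_on {0} \<and> Q 0 = partial_deriv l P (p 0) \<and> (\<forall>t. P (p t + axis l (\<delta> t)) = P (p t) + Q t * \<delta> t)"
    using assms(1)
  proof induction
    case (const c)
    show ?case by (rule exI[of _ "\<lambda>t. 0"]) (auto simp: partial_deriv_def)
  next
    case (coord i)
    have "((\<lambda>t. (p 0 + axis l t) $ i) has_field_derivative (if l = i then 1 else 0)) (at 0)"
      by (auto simp: axis_def intro!: derivative_eq_intros)
    then show ?case
      by (intro exI[of _ "\<lambda>t. if l = i then 1 else 0"]) (auto simp: partial_deriv_def DERIV_imp_deriv axis_def)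
  next
    case (add P1 P2)
    then obtain Q1 Q2 where "Q1 analytic_on {0}" "Q1 0 = partial_deriv l P1 (p 0)" "\<And>t. P1 (p t + axis l (\<delta> t)) = P1 (p t) + Q1 t * \<delta> t"
      "Q2 analytic_on {0}" "Q2 0 = partial_deriv l P2 (p 0)" "\<And>t. P2 (p t + axis l (\<delta> t)) = P2 (p t) + Q2 t * \<delta> t" by blast
    moreover have "partial_deriv l (\<lambda>v. P1 v + P2 v) (p 0) = partial_deriv l P1 (p 0) + partial_deriv l P2 (p 0)"
      unfolding partial_deriv_def[of l "\<lambda>v. P1 v + P2 v"]
      by (intro DERIV_imp_deriv DERIV_add poly_fun_partial_field_derivative add.hyps)
    ultimately show ?case
      by (intro exI[of _ "\<lambda>t. Q1 t + Q2 t"]) (auto intro!: analytic_intros simp: ring_distribs)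
  next
    case (mult P1 P2)
    then obtain Q1 Q2 where "Q1 analytic_on {0}" "Q1 0 = partial_deriv l P1 (p 0)" "\<And>t. P1 (p t + axis l (\<delta> t)) = P1 (p t) + Q1 t * \<delta> t"
      "Q2 analytic_on {0}" "Q2 0 = partial_deriv l P2 (p 0)" "\<And>t. P2 (p t + axis l (\<delta> t)) = P2 (p t) + Q2 t * \<delta> t" by blast
    moreover have "partial_deriv l (\<lambda>v. P1 v * P2 v) (p 0) = partial_deriv l P1 (p 0) * P2 (p 0) + P1 (p 0) * partial_deriv l P2 (p 0)"
      unfolding partial_deriv_def[of l "\<lambda>v. P1 v * P2 v"]
      using DERIV_mult[OF poly_fun_partial_field_derivative[OF mult.hyps(1), of "p 0" l]
          poly_fun_partial_field_derivative[OF mult.hyps(2), of "p 0" l]]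
      by (intro DERIV_imp_deriv) (simp add: axis_def zero_vec_def[symmetric] mult_ac)
    moreover have "(\<lambda>t. P1 (p t)) analytic_on {0}" "(\<lambda>t. P2 (p t)) analytic_on {0}"
      using mult.hyps assms(2) by (auto intro: poly_fun_analytic)
    ultimately show ?case using assms(3,4)
      by (intro exI[of _ "\<lambda>t. Q1 t * P2 (p t) + P1 (p t) * Q2 t + Q1 t * Q2 t * \<delta> t"]) (auto intro!: analytic_intros simp: algebra_simps)
  qed
  then show ?thesis using that by blast
qed

text \<open>Padding the coefficient matrix with zero rows makes it square and not surjective,
  hence not injective.\<close>

lemma underdetermined_linear_system:
  fixes a :: "nat \<Rightarrow> complex^'N"
  assumes "m < CARD('N)"
  obtains h where "h \<noteq> 0" "\<And>j. j < m \<Longrightarrow> (\<Sum>i\<in>UNIV. a j $ i * h $ i) = 0"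
proof -
  obtain e :: "'N \<Rightarrow> nat" where e: "bij_betw e UNIV {0..<CARD('N)}"
    using ex_bij_betw_finite_nat[OF finite_class.finite_UNIV] by blast
  define M :: "complex^'N^'N" where "M = (\<chi> r. if e r < m then a (e r) else 0)"
  have im: "e ` UNIV = {0..<CARD('N)}" using e by (simp add: bij_betw_def)
  then obtain r where r: "e r = m" using assms by (metis atLeastLessThan_iff imageE zero_le)
  have "(M *v x) $ r = 0" for x by (simp add: M_def matrix_vector_mult_def r)
  then have "\<not> surj (\<lambda>x. M *v x)"
    unfolding surj_def by (metis axis_nth zero_neq_one)
  then have "\<not> (\<exists>B. B ** M = mat 1)"
    by (metis matrix_left_right_inverse matrix_right_invertible_surjective)
  then obtain h where h: "M *v h = 0" "h \<noteq> 0" by (auto simp: matrix_left_invertible_ker)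
  show ?thesis
  proof
    show "h \<noteq> 0" by fact
    fix j assume "j < m"
    then obtain s where s: "e s = j" using im assms by (metis atLeastLessThan_iff imageE less_trans zero_le)
    have "(M *v h) $ s = 0" by (simp add: h)
    then show "(\<Sum>i\<in>UNIV. a j $ i * h $ i) = 0" using s \<open>j < m\<close> by (simp add: M_def matrix_vector_mult_def)
  qed
qed

text \<open>By Euler's relation \<open>\<Sum>i. x $ i * partial_deriv i F x = 0\<close>, the gradient cannot be
  concentrated in a coordinate \<open>i\<close> with \<open>x $ i \<noteq> 0\<close>. So one coordinate can serve as the
  denominator of an affine chart while another one is solved for.\<close>

lemma nonradial_partial_deriv:
  assumes F: "homogeneous_form d F" and d: "d \<ge> 1" and "F x = 0" "x \<noteq> 0" and sm: "\<exists>i. partial_deriv i F x \<noteq> 0"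
  obtains i l where "i \<noteq> l" "x $ i \<noteq> 0" "partial_deriv l F x \<noteq> 0"
proof -
  have pF: "poly_fun F" using F by (rule homogeneous_form_poly_fun)
  have "((\<lambda>c. F (c *s x)) has_field_derivative (\<Sum>i\<in>UNIV. partial_deriv i F (1 *s x) * x $ i)) (at 1)"
    by (rule poly_fun_field_derivative[OF pF]) (auto intro!: derivative_eq_intros)
  moreover have "(\<lambda>c. F (c *s x)) = (\<lambda>c. 0)"
    using homogeneous_form_scale[OF F] assms(3) by simp
  ultimately have euler: "(\<Sum>i\<in>UNIV. partial_deriv i F x * x $ i) = 0"
    by (metis DERIV_const DERIV_unique vector_smult_lid)
  obtain i where i: "x $ i \<noteq> 0" using assms(4) by (auto simp: vec_eq_iff)
  show ?thesis
  proof (cases "\<exists>l. l \<noteq> i \<and> partial_deriv l F x \<noteq> 0")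
    case True
    then show ?thesis using i that by metis
  next
    case False
    then have "(\<Sum>l\<in>UNIV. partial_deriv l F x * x $ l) = partial_deriv i F x * x $ i"
      by (subst sum.remove[of _ i]) (auto intro!: sum.neutral)
    then have "partial_deriv i F x = 0" using euler i by simp
    then show ?thesis using False sm by metis
  qed
qed

section \<open>Solving an equation for one coordinate\<close>

definition set_coord :: "'N \<Rightarrow> complex \<Rightarrow> complex^'N \<Rightarrow> complex^'N" where
  "set_coord l w x = (\<chi> i. if i = l then w else x $ i)"

lemma set_coord_nth [simp]: "set_coord l w x $ i = (if i = l then w else x $ i)"
  by (simp add: set_coord_def)

lemma set_coord_set_coord [simp]: "set_coord l a (set_coord l b x) = set_coord l a x"
  by (simp add: vec_eq_iff)

lemma set_coord_same [simp]: "set_coord l (x $ l) x = x"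
  by (simp add: vec_eq_iff)

lemma continuous_on_set_coord:
  assumes "continuous_on S w" "continuous_on S x"
  shows "continuous_on S (\<lambda>z. set_coord l (w z) (x z))"
  unfolding set_coord_def
proof (rule continuous_on_vec_lambda)
  show "continuous_on S (\<lambda>z. if i = l then w z else x z $ i)" for i
    using assms by (cases "i = l") (auto intro: continuous_on_component)
qed

text \<open>The implicit function theorem for the coordinate \<open>l\<close>: the map that replaces
  \<open>x $ l\<close> by \<open>P x\<close> is a local diffeomorphism, and \<open>W x\<close> is the coordinate \<open>l\<close> of the preimage of the
  point with coordinate \<open>l\<close> equal to 0. Its derivative is the one of implicit differentiation, hence
  complex linear in \<open>u\<close>.\<close>

lemma implicit_coordinate:
  fixes P :: "complex^'N \<Rightarrow> complex"
  assumes P: "poly_fun P" and "P x0 = 0" and l: "partial_deriv l P x0 \<noteq> 0"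
  obtains S W where "open S" "x0 \<in> S"
    "\<And>x. x \<in> S \<Longrightarrow> P (set_coord l (W x) x) = 0"
    "\<And>x. x \<in> S \<Longrightarrow> partial_deriv l P (set_coord l (W x) x) \<noteq> 0"
    "\<And>x. x \<in> S \<Longrightarrow> (W has_derivative
        (\<lambda>u. - (\<Sum>i\<in>UNIV - {l}. partial_deriv i P (set_coord l (W x) x) * u $ i) / partial_deriv l P (set_coord l (W x) x))) (at x)"
    "\<And>x. x \<in> S \<Longrightarrow> P x = 0 \<Longrightarrow> W x = x $ l"
    "\<And>x a. W (set_coord l a x) = W x"
proof -
  define U where "U = {x. partial_deriv l P x \<noteq> 0}"
  define \<Phi> where "\<Phi> = (\<lambda>x. set_coord l (P x) x)"
  define D where "D = (\<lambda>x u. \<Sum>i\<in>UNIV. partial_deriv i P x * u $ i)"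
  define \<Phi>' where "\<Phi>' = (\<lambda>x. Blinfun (\<lambda>u. set_coord l (D x u) u))"
  define \<Psi>' where "\<Psi>' = Blinfun (\<lambda>u. set_coord l ((u $ l - (\<Sum>i\<in>UNIV - {l}. partial_deriv i P x0 * u $ i)) / partial_deriv l P x0) u)"
  have bl_vec: "bounded_linear f" if "linear f" for f :: "complex^'N \<Rightarrow> complex^'N"
    using that by (simp add: linear_conv_bounded_linear)
  have D_split: "D x u = partial_deriv l P x * u $ l + (\<Sum>i\<in>UNIV - {l}. partial_deriv i P x * u $ i)" for x u
    unfolding D_def by (subst sum.remove[of _ l]) auto
  have "linear (\<lambda>u. set_coord l (D x u) u)" for x
    by (rule linearI) (auto simp: vec_eq_iff D_def sum.distrib ring_distribs scaleR_sum_right)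
  then have \<Phi>': "blinfun_apply (\<Phi>' x) = (\<lambda>u. set_coord l (D x u) u)" for x
    unfolding \<Phi>'_def by (intro bounded_linear_Blinfun_apply bl_vec)
  define T where "T = (\<lambda>u::complex^'N. \<Sum>i\<in>UNIV - {l}. partial_deriv i P x0 * u $ i)"
  have T: "T (u + w) = T u + T w" "T (r *\<^sub>R u) = of_real r * T u" for u w r
    by (simp_all add: T_def sum.distrib ring_distribs scaleR_sum_right flip: scaleR_conv_of_real)
  have scale: "(r *\<^sub>R z - of_real r * z') / p = r *\<^sub>R ((z - z') / p)" for r and z z' p :: complex
    by (simp add: scaleR_conv_of_real algebra_simps diff_divide_distrib)
  have "linear (\<lambda>u. set_coord l ((u $ l - T u) / partial_deriv l P x0) u)"
  proof (rule linearI)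
    show "set_coord l (((r *\<^sub>R u) $ l - T (r *\<^sub>R u)) / partial_deriv l P x0) (r *\<^sub>R u)
        = r *\<^sub>R set_coord l ((u $ l - T u) / partial_deriv l P x0) u" for r u
      by (auto simp: vec_eq_iff T scale)
  qed (auto simp: vec_eq_iff T diff_divide_distrib add_divide_distrib)
  then have "linear (\<lambda>u. set_coord l ((u $ l - (\<Sum>i\<in>UNIV - {l}. partial_deriv i P x0 * u $ i)) / partial_deriv l P x0) u)"
    by (simp only: T_def)
  then have \<Psi>': "blinfun_apply \<Psi>' = (\<lambda>u. set_coord l ((u $ l - (\<Sum>i\<in>UNIV - {l}. partial_deriv i P x0 * u $ i)) / partial_deriv l P x0) u)"
    unfolding \<Psi>'_def by (intro bounded_linear_Blinfun_apply bl_vec)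
  have pc: "continuous_on A (partial_deriv i P)" for A i
    using P by (intro poly_fun_continuous_on poly_fun_partial_deriv)
  have "open U"
    unfolding U_def using pc[of UNIV l] by (intro open_Collect_neq) auto
  have der: "(\<Phi> has_derivative blinfun_apply (\<Phi>' x)) (at x)" for x
    unfolding \<Phi>_def \<Phi>'
  proof (rule has_derivative_vecI)
    show "((\<lambda>x. set_coord l (P x) x $ i) has_derivative (\<lambda>h. set_coord l (D x h) h $ i)) (at x)" for i
      using poly_fun_has_derivative[OF P, of x]
      by (cases "i = l") (auto simp: D_def intro: bounded_linear_imp_has_derivative bounded_linear_vec_nth)
  qed
  have cont: "continuous_on U \<Phi>'"
  proof (rule continuous_on_blinfun_componentwise)
    show "continuous_on U (\<lambda>x. blinfun_apply (\<Phi>' x) i)" for i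
      unfolding \<Phi>' D_def by (intro continuous_on_set_coord continuous_intros pc)
  qed
  have "\<Psi>' o\<^sub>L \<Phi>' x0 = id_blinfun"
  proof (rule blinfun_eqI)
    fix u
    have "(\<Sum>i\<in>UNIV - {l}. partial_deriv i P x0 * set_coord l (D x0 u) u $ i) = (\<Sum>i\<in>UNIV - {l}. partial_deriv i P x0 * u $ i)"
      by (intro sum.cong) auto
    then show "blinfun_apply (\<Psi>' o\<^sub>L \<Phi>' x0) u = blinfun_apply id_blinfun u"
      using l by (simp add: \<Phi>' \<Psi>' D_split vec_eq_iff)
  qed
  from inverse_function_theorem[OF \<open>open U\<close> der cont _ this] l
  obtain U' V g g' where UV: "open U'" "U' \<subseteq> U" "x0 \<in> U'" "open V" "\<Phi> x0 \<in> V" "homeomorphism U' V \<Phi> g"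
    and g: "\<And>y. y \<in> V \<Longrightarrow> (g has_derivative (g' y)) (at y)"
      "\<And>y. y \<in> V \<Longrightarrow> g' y = inv (blinfun_apply (\<Phi>' (g y)))"
      "\<And>y. y \<in> V \<Longrightarrow> bij (blinfun_apply (\<Phi>' (g y)))"
    unfolding U_def by blast
  define W where "W = (\<lambda>x. g (set_coord l 0 x) $ l)"
  define S where "S = U' \<inter> {x. set_coord l 0 x \<in> V}"
  have g_eq: "g (set_coord l 0 x) = set_coord l (W x) x" "P (set_coord l (W x) x) = 0" "set_coord l (W x) x \<in> U" if "x \<in> S" for x
  proof -
    let ?y = "set_coord l 0 x"
    have "?y \<in> V" using that by (simp add: S_def)
    then have *: "\<Phi> (g ?y) = ?y" "g ?y \<in> U'" using UV(6) by (auto simp: homeomorphism_def)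
    have "g ?y $ i = x $ i" if "i \<noteq> l" for i
      using arg_cong[OF *(1), of "\<lambda>z. z $ i"] that by (simp add: \<Phi>_def)
    then show eq: "g ?y = set_coord l (W x) x" by (simp add: W_def vec_eq_iff)
    show "P (set_coord l (W x) x) = 0"
      using arg_cong[OF *(1), of "\<lambda>z. z $ l"] by (simp add: \<Phi>_def eq)
    show "set_coord l (W x) x \<in> U" using * UV(2) eq by auto
  qed
  show ?thesis
  proof
    have "continuous_on UNIV (set_coord l 0)" by (intro continuous_on_set_coord continuous_intros)
    then have "open (set_coord l 0 -` V)" using UV(4) by (rule open_vimage[rotated])
    then show "open S" unfolding S_def using UV(1) by (auto simp: vimage_def)
    show "x0 \<in> S" using UV(3,5) assms(2) by (simp add: S_def \<Phi>_def)
    show "W (set_coord l a x) = W x" for a x by (simp add: W_def)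
    fix x assume x: "x \<in> S"
    show "P (set_coord l (W x) x) = 0" using g_eq[OF x] by simp
    show nz: "partial_deriv l P (set_coord l (W x) x) \<noteq> 0" using g_eq[OF x] by (simp add: U_def)
    show "W x = x $ l" if "P x = 0"
    proof -
      have "\<Phi> x = set_coord l 0 x" using that by (simp add: \<Phi>_def)
      then have "g (set_coord l 0 x) = x" using x UV(6) unfolding S_def homeomorphism_def by (metis IntE)
      then show ?thesis by (simp add: W_def)
    qed
    let ?p = "set_coord l (W x) x" and ?y = "set_coord l 0 x"
    define E where "E = (\<lambda>u::complex^'N. - (\<Sum>i\<in>UNIV - {l}. partial_deriv i P ?p * u $ i) / partial_deriv l P ?p)"
    have y: "?y \<in> V" using x by (simp add: S_def)
    have "(set_coord l 0 has_derivative set_coord l 0) (at x)"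
    proof (rule has_derivative_vecI)
      show "((\<lambda>x. set_coord l 0 x $ i) has_derivative (\<lambda>h. set_coord l 0 h $ i)) (at x)" for i
        by (cases "i = l") (auto intro: bounded_linear_imp_has_derivative bounded_linear_vec_nth)
    qed
    from has_derivative_compose[OF this g(1)[OF y]]
    have "((\<lambda>x. g (set_coord l 0 x)) has_derivative (\<lambda>u. g' ?y (set_coord l 0 u))) (at x)" .
    moreover have "g' ?y (set_coord l 0 u) = set_coord l (E u) u" for u
    proof -
      have "(\<Sum>i\<in>UNIV - {l}. partial_deriv i P ?p * set_coord l (E u) u $ i) = (\<Sum>i\<in>UNIV - {l}. partial_deriv i P ?p * u $ i)"
        by (intro sum.cong) auto
      then have "D ?p (set_coord l (E u) u) = 0"
        unfolding D_split using nz by (simp add: E_def)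
      then have "blinfun_apply (\<Phi>' (g ?y)) (set_coord l (E u) u) = set_coord l 0 u"
        by (simp add: \<Phi>' g_eq(1)[OF x])
      then show ?thesis
        using g(2,3)[OF y] by (metis bij_is_inj inv_f_f)
    qed
    ultimately have "((\<lambda>x. g (set_coord l 0 x)) has_derivative (\<lambda>u. set_coord l (E u) u)) (at x)" by simp
    from bounded_linear.has_derivative[OF bounded_linear_vec_nth this, of l]
    show "(W has_derivative E) (at x)" by (simp add: W_def)
  qed
qed

section \<open>Curves in the cone over a smooth hypersurface\<close>

lemma analytic_at_iff_eventually_differentiable:
  "f analytic_on {z} \<longleftrightarrow> (\<forall>\<^sub>F t in nhds z. f field_differentiable (at t))"
proof
  assume "f analytic_on {z}"
  then obtain S where "open S" "z \<in> S" "f holomorphic_on S" by (auto simp: analytic_at)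
  then show "\<forall>\<^sub>F t in nhds z. f field_differentiable (at t)"
    unfolding eventually_nhds using holomorphic_on_imp_differentiable_at by blast
next
  assume "\<forall>\<^sub>F t in nhds z. f field_differentiable (at t)"
  then obtain S where "open S" "z \<in> S" "\<forall>t\<in>S. f field_differentiable (at t)" by (auto simp: eventually_nhds)
  then show "f analytic_on {z}"
    unfolding analytic_at holomorphic_on_def using field_differentiable_at_within by blast
qed

lemma tendsto_vec_at_analytic:
  fixes v :: "complex \<Rightarrow> complex^'N"
  assumes "\<And>i. (\<lambda>t. v t $ i) analytic_on {z}"
  shows "(v \<longlongrightarrow> v z) (nhds z)"
proof (rule vec_tendstoI)
  fix i
  have "isCont (\<lambda>t. v t $ i) z" using assms by (rule analytic_at_imp_isCont)
  then show "((\<lambda>t. v t $ i) \<longlongrightarrow> v z $ i) (nhds z)" by (simp add: isCont_def tendsto_nhds_iff)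
qed

lemma eventually_in_open_analytic:
  fixes v :: "complex \<Rightarrow> complex^'N"
  assumes "\<And>i. (\<lambda>t. v t $ i) analytic_on {z}" "open S" "v z \<in> S"
  shows "\<forall>\<^sub>F t in nhds z. v t \<in> S"
  using tendsto_vec_at_analytic[OF assms(1)] assms(2,3) by (rule topological_tendstoD)

lemma analytic_compose_vec:
  fixes v :: "complex \<Rightarrow> complex^'N" and f :: "complex^'N \<Rightarrow> complex"
  assumes "open S" "\<And>x. x \<in> S \<Longrightarrow> \<exists>D. (f has_derivative D) (at x) \<and> (\<forall>c u. D (c *s u) = c * D u)"
    and v: "\<And>i. (\<lambda>t. v t $ i) analytic_on {z}" "v z \<in> S"
  shows "(\<lambda>t. f (v t)) analytic_on {z}"
proof -
  have "\<forall>\<^sub>F t in nhds z. \<forall>i\<in>UNIV. (\<lambda>t. v t $ i) field_differentiable (at t)"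
    using v(1) by (intro eventually_ball_finite) (auto simp: analytic_at_iff_eventually_differentiable)
  moreover have "\<forall>\<^sub>F t in nhds z. v t \<in> S"
    by (rule eventually_in_open_analytic[OF v(1) assms(1) v(2)])
  ultimately have "\<forall>\<^sub>F t in nhds z. (\<lambda>t. f (v t)) field_differentiable (at t)"
  proof eventually_elim
    case (elim t)
    obtain D where D: "(f has_derivative D) (at (v t))" "\<And>c u. D (c *s u) = c * D u"
      using assms(2)[OF elim(2)] by blast
    have "((\<lambda>s. v s $ i) has_field_derivative (\<chi> i. deriv (\<lambda>s. v s $ i) t) $ i) (at t)" for i
      using elim(1) by (simp add: field_differentiable_derivI)
    from has_field_derivative_compose_vec[OF D this] show ?case
      unfolding field_differentiable_def by blast
  qed
  then show ?thesis by (simp add: analytic_at_iff_eventually_differentiable)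
qed

lemma higher_deriv_sum_at:
  assumes "finite A" "\<And>x. x \<in> A \<Longrightarrow> f x analytic_on {z}"
  shows "(deriv ^^ j) (\<lambda>t. \<Sum>x\<in>A. f x t) z = (\<Sum>x\<in>A. (deriv ^^ j) (f x) z)"
  using assms
proof (induction A rule: finite_induct)
  case (insert x A)
  then have "(deriv ^^ j) (\<lambda>t. f x t + (\<Sum>x\<in>A. f x t)) z = (deriv ^^ j) (f x) z + (deriv ^^ j) (\<lambda>t. \<Sum>x\<in>A. f x t) z"
    by (intro higher_deriv_add_at analytic_on_sum) auto
  with insert show ?case by simp
qed simp

text \<open>Germs of holomorphic curves in the affine cone without its vertex, as lifts of curves
  in the projective hypersurface.\<close>

definition cone_curves :: "(complex^'N \<Rightarrow> complex) \<Rightarrow> (complex \<Rightarrow> complex^'N) set" where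
  "cone_curves F = {v. (\<forall>i. (\<lambda>t. v t $ i) analytic_on {0}) \<and> v 0 \<noteq> 0 \<and> (\<forall>\<^sub>F t in nhds 0. F (v t) = 0)}"

locale smooth_cone =
  fixes F :: "complex^'N \<Rightarrow> complex" and d :: nat
  assumes form: "homogeneous_form d F" and degree: "d \<ge> 1"
    and smooth: "\<And>x. x \<noteq> 0 \<Longrightarrow> F x = 0 \<Longrightarrow> \<exists>i. partial_deriv i F x \<noteq> 0"
begin

lemma poly: "poly_fun F"
  using form by (rule homogeneous_form_poly_fun)

text \<open>Near any of its points other than the vertex, the cone is the graph of a holomorphic function
  \<open>W\<close> over a coordinate hyperplane, and a coordinate different from the dependent one does not
  vanish.\<close>

lemma local_graph:
  assumes "F x0 = 0" "x0 \<noteq> 0"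
  obtains i l S W where "i \<noteq> l" "open S" "x0 \<in> S"
    "\<And>x. x \<in> S \<Longrightarrow> x $ i \<noteq> 0"
    "\<And>x. x \<in> S \<Longrightarrow> F (set_coord l (W x) x) = 0"
    "\<And>x. x \<in> S \<Longrightarrow> partial_deriv l F (set_coord l (W x) x) \<noteq> 0"
    "\<And>x. x \<in> S \<Longrightarrow> (W has_derivative
        (\<lambda>u. - (\<Sum>i\<in>UNIV - {l}. partial_deriv i F (set_coord l (W x) x) * u $ i) / partial_deriv l F (set_coord l (W x) x))) (at x)"
    "\<And>x. x \<in> S \<Longrightarrow> F x = 0 \<Longrightarrow> W x = x $ l"
    "\<And>x a. W (set_coord l a x) = W x"
proof -
  obtain i l where il: "i \<noteq> l" "x0 $ i \<noteq> 0" "partial_deriv l F x0 \<noteq> 0"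
    using nonradial_partial_deriv[OF form degree assms smooth[OF assms(2,1)]] by blast
  obtain S W where SW: "open S" "x0 \<in> S"
    "\<And>x. x \<in> S \<Longrightarrow> F (set_coord l (W x) x) = 0"
    "\<And>x. x \<in> S \<Longrightarrow> partial_deriv l F (set_coord l (W x) x) \<noteq> 0"
    "\<And>x. x \<in> S \<Longrightarrow> (W has_derivative
        (\<lambda>u. - (\<Sum>i\<in>UNIV - {l}. partial_deriv i F (set_coord l (W x) x) * u $ i) / partial_deriv l F (set_coord l (W x) x))) (at x)"
    "\<And>x. x \<in> S \<Longrightarrow> F x = 0 \<Longrightarrow> W x = x $ l"
    "\<And>x a. W (set_coord l a x) = W x"
    by (rule implicit_coordinate[OF poly assms(1) il(3)]) (rule that)
  have "open {x::complex^'N. x $ i \<noteq> 0}" by (intro open_Collect_neq continuous_intros)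
  then show ?thesis
    using il SW by (intro that[of i l "S \<inter> {x. x $ i \<noteq> 0}" W]) auto
qed

text \<open>Smoothness of the cone, in the form of Hensel's lemma: a curve that satisfies the
  equation up to order \<open>k\<close> has the same \<open>k\<close>-jet as a curve inside the cone. The correction replaces
  the coordinate \<open>l\<close> by \<open>W\<close>; by the divided difference, it is \<open>F (p t)\<close> times an analytic
  function, and so of order greater than \<open>k\<close>.\<close>

lemma jet_correction:
  assumes p: "\<And>i. (\<lambda>t. p t $ i) analytic_on {0}" "p 0 \<noteq> 0"
    and jet: "\<And>j. j \<le> k \<Longrightarrow> (deriv ^^ j) (\<lambda>t. F (p t)) 0 = 0"
  obtains v where "v \<in> cone_curves F" "\<And>j. j \<le> k \<Longrightarrow> vjet v j = vjet p j"
proof -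
  have F0: "F (p 0) = 0" using jet[of 0] by simp
  obtain i l S W where S: "i \<noteq> l" "open S" "p 0 \<in> S" and "\<And>x. x \<in> S \<Longrightarrow> x $ i \<noteq> 0"
    and W: "\<And>x. x \<in> S \<Longrightarrow> F (set_coord l (W x) x) = 0"
    "\<And>x. x \<in> S \<Longrightarrow> partial_deriv l F (set_coord l (W x) x) \<noteq> 0"
    "\<And>x. x \<in> S \<Longrightarrow> (W has_derivative
        (\<lambda>u. - (\<Sum>i\<in>UNIV - {l}. partial_deriv i F (set_coord l (W x) x) * u $ i) / partial_deriv l F (set_coord l (W x) x))) (at x)"
    "\<And>x. x \<in> S \<Longrightarrow> F x = 0 \<Longrightarrow> W x = x $ l"
    "\<And>x a. W (set_coord l a x) = W x"
    by (rule local_graph[OF F0 p(2)]) (rule that)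
  have Wp: "(\<lambda>t. W (p t)) analytic_on {0}"
  proof (rule analytic_compose_vec[OF S(2) _ p(1) S(3)])
    show "\<exists>D. (W has_derivative D) (at x) \<and> (\<forall>c u. D (c *s u) = c * D u)" if "x \<in> S" for x
      by (intro exI conjI, rule W(3)[OF that]) (simp add: sum_distrib_left mult_ac)
  qed
  define \<delta> where "\<delta> = (\<lambda>t. W (p t) - p t $ l)"
  define v where "v = (\<lambda>t. p t + axis l (\<delta> t))"
  have \<delta>: "\<delta> analytic_on {0}" "\<delta> 0 = 0"
    using W(4)[OF S(3) F0] by (auto simp: \<delta>_def intro!: analytic_intros Wp p(1))
  have v_eq: "v t = set_coord l (W (p t)) (p t)" for t
    by (simp add: v_def \<delta>_def vec_eq_iff axis_def)
  obtain Q where Q: "Q analytic_on {0}" "Q 0 = partial_deriv l F (p 0)" "\<And>t. F (p t + axis l (\<delta> t)) = F (p t) + Q t * \<delta> t"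
    by (rule poly_fun_difference[OF poly p(1) \<delta>, of l]) (rule that)
  have Q0: "Q 0 \<noteq> 0" using W(2)[OF S(3)] W(4)[OF S(3) F0] Q(2) by simp
  have evS: "\<forall>\<^sub>F t in nhds 0. p t \<in> S"
    by (rule eventually_in_open_analytic[OF p(1) S(2,3)])
  then have Fv: "\<forall>\<^sub>F t in nhds 0. F (v t) = 0"
    by eventually_elim (simp add: v_eq W(1))
  with eventually_nonzero_analytic[OF Q(1) Q0]
  have "\<forall>\<^sub>F t in nhds 0. \<delta> t = F (p t) * (- 1 / Q t)"
    by eventually_elim (use Q(3) in \<open>simp add: v_def field_simps add_eq_0_iff\<close>)
  then have "(deriv ^^ j) \<delta> 0 = (deriv ^^ j) (\<lambda>t. F (p t) * (- 1 / Q t)) 0" for j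
    by (intro higher_deriv_cong_ev refl)
  also have "(deriv ^^ j) (\<lambda>t. F (p t) * (- 1 / Q t)) 0 = 0" if "j \<le> k" for j
    using jet that Q(1) Q0 by (intro higher_deriv_mult_eq_0[of _ _ k] analytic_intros poly_fun_analytic[OF poly] p(1)) auto
  finally have \<delta>j: "(deriv ^^ j) \<delta> 0 = 0" if "j \<le> k" for j using that by blast
  show ?thesis
  proof
    show "v \<in> cone_curves F"
      unfolding cone_curves_def
    proof (intro CollectI conjI allI Fv)
      show "(\<lambda>t. v t $ a) analytic_on {0}" for a
        unfolding v_eq by (cases "a = l") (auto intro: p(1) Wp)
      show "v 0 \<noteq> 0" using p(2) W(4)[OF S(3) F0] by (simp add: v_eq)
    qed
    show "vjet v j = vjet p j" if "j \<le> k" for j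
    proof -
      have "(deriv ^^ j) (\<lambda>t. v t $ a) 0 = (deriv ^^ j) (\<lambda>t. p t $ a) 0" for a
      proof (cases "a = l")
        case True
        then show ?thesis
          using \<delta>j[OF that] by (simp add: v_def higher_deriv_add_at p(1) \<delta>(1))
      qed (simp add: v_eq)
      then show ?thesis by (simp add: vjet_def)
    qed
  qed
qed

end

context smooth_cone begin

text \<open>The conditions on \<open>h\<close> are one linear equation for orthogonality to \<open>v 0\<close> and
  \<open>k + 1\<close> linear equations for tangency to the cone along \<open>v\<close> up to order \<open>k\<close>. A nonzero solution
  exists as soon as there are more than \<open>k + 2\<close> coordinates; this is where the bound on the order of
  the jets comes from.\<close>

lemma tangent_direction:
  assumes "k + 2 < CARD('N)" and v: "\<And>i. (\<lambda>t. v t $ i) analytic_on {0}"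
  obtains h where "h \<noteq> 0" "(\<Sum>i\<in>UNIV. cnj (v 0 $ i) * h $ i) = 0"
    "\<And>j. j \<le> k \<Longrightarrow> (deriv ^^ j) (\<lambda>t. \<Sum>i\<in>UNIV. partial_deriv i F (v t) * h $ i) 0 = 0"
proof -
  define a :: "nat \<Rightarrow> complex^'N" where
    "a = (\<lambda>j. if j = Suc k then \<chi> i. cnj (v 0 $ i) else \<chi> i. (deriv ^^ j) (\<lambda>t. partial_deriv i F (v t)) 0)"
  obtain h where h: "h \<noteq> 0" "\<And>j. j < k + 2 \<Longrightarrow> (\<Sum>i\<in>UNIV. a j $ i * h $ i) = 0"
    by (rule underdetermined_linear_system[OF assms(1), of a]) (rule that)
  show ?thesis
  proof
    show "h \<noteq> 0" by fact
    show "(\<Sum>i\<in>UNIV. cnj (v 0 $ i) * h $ i) = 0" using h(2)[of "Suc k"] by (simp add: a_def)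
    fix j assume j: "j \<le> k"
    have an: "(\<lambda>t. partial_deriv i F (v t)) analytic_on {0}" for i
      by (rule poly_fun_analytic[OF poly_fun_partial_deriv[OF poly] v])
    have "(deriv ^^ j) (\<lambda>t. \<Sum>i\<in>UNIV. partial_deriv i F (v t) * h $ i) 0
        = (\<Sum>i\<in>UNIV. (deriv ^^ j) (\<lambda>t. h $ i * partial_deriv i F (v t)) 0)"
      by (subst higher_deriv_sum_at) (auto intro!: analytic_intros an simp: mult.commute)
    also have "\<dots> = (\<Sum>i\<in>UNIV. a j $ i * h $ i)"
      using j by (intro sum.cong refl) (simp add: a_def higher_deriv_cmult' an)
    finally show "(deriv ^^ j) (\<lambda>t. \<Sum>i\<in>UNIV. partial_deriv i F (v t) * h $ i) 0 = 0"
      using h(2) j by simp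
  qed
qed

lemma holo_family_line:
  fixes g :: "complex \<Rightarrow> complex"
  assumes "g analytic_on {0}"
  shows "holo_family (\<lambda>s t. g t + s * c) (\<lambda>s t. c)"
proof -
  obtain r where r: "r > 0" "g holomorphic_on ball 0 r" using assms by (auto simp: analytic_on_def)
  have "continuous_on (ball 0 r \<times> ball 0 r) (\<lambda>p::complex\<times>complex. g (snd p))"
    by (rule continuous_on_compose2[OF holomorphic_on_imp_continuous_on[OF r(2)]])
      (auto intro!: continuous_intros)
  then have "continuous_on (ball 0 r \<times> ball 0 r) (\<lambda>(s, t). g t + s * c)"
    unfolding case_prod_unfold by (intro continuous_intros)
  then show ?thesis
    unfolding holo_family_def using r
    by (intro exI[of _ r]) (auto intro!: holomorphic_intros derivative_eq_intros continuous_intros)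
qed

text \<open>Push the curve \<open>v\<close> in the constant direction \<open>h\<close> and project it back to the cone along
  the coordinate \<open>l\<close>. Since \<open>h\<close> is tangent to the cone up to order \<open>k\<close> along \<open>v\<close>, the projection
  does not change the velocity of the \<open>k\<close>-jet at \<open>s = 0\<close>: the base point moves with velocity \<open>h\<close>, and the
  higher derivatives are stationary.\<close>

lemma tangent_disc:
  assumes v: "v \<in> cone_curves F"
    and h: "\<And>j. j \<le> k \<Longrightarrow> (deriv ^^ j) (\<lambda>t. \<Sum>i\<in>UNIV. partial_deriv i F (v t) * h $ i) 0 = 0"
  obtains f f' where "\<And>i. holo_family (\<lambda>s t. f s t $ i) (\<lambda>s t. f' s t $ i)"
    "\<forall>\<^sub>F s in nhds 0. f s \<in> cone_curves F"
    "\<And>j. vjet (f 0) j = vjet v j"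
    "\<And>i. ((\<lambda>s. vjet (f s) 0 $ i) has_field_derivative h $ i) (at 0)"
    "\<And>i j. 1 \<le> j \<Longrightarrow> j \<le> k \<Longrightarrow> ((\<lambda>s. vjet (f s) j $ i) has_field_derivative 0) (at 0)"
proof -
  have va: "\<And>a. (\<lambda>t. v t $ a) analytic_on {0}" and v0: "v 0 \<noteq> 0" and Fv: "\<forall>\<^sub>F t in nhds 0. F (v t) = 0"
    using v by (auto simp: cone_curves_def)
  have F0: "F (v 0) = 0" using eventually_nhds_x_imp_x[OF Fv] .
  obtain i l S W where S: "i \<noteq> l" "open S" "v 0 \<in> S" and nz: "\<And>x. x \<in> S \<Longrightarrow> x $ i \<noteq> 0"
    and W: "\<And>x. x \<in> S \<Longrightarrow> F (set_coord l (W x) x) = 0"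
    "\<And>x. x \<in> S \<Longrightarrow> partial_deriv l F (set_coord l (W x) x) \<noteq> 0"
    "\<And>x. x \<in> S \<Longrightarrow> (W has_derivative
        (\<lambda>u. - (\<Sum>i\<in>UNIV - {l}. partial_deriv i F (set_coord l (W x) x) * u $ i) / partial_deriv l F (set_coord l (W x) x))) (at x)"
    "\<And>x. x \<in> S \<Longrightarrow> F x = 0 \<Longrightarrow> W x = x $ l"
    "\<And>x a. W (set_coord l a x) = W x"
    by (rule local_graph[OF F0 v0]) (rule that)
  define p where "p = (\<lambda>s t. v t + s *s h)"
  define f where "f = (\<lambda>s t. set_coord l (W (p s t)) (p s t))"
  define E where "E = (\<lambda>x. - (\<Sum>i\<in>UNIV - {l}. partial_deriv i F x * h $ i) / partial_deriv l F x)"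
  define f' where "f' = (\<lambda>s t. set_coord l (E (f s t)) h)"
  have pa: "(\<lambda>t. p s t $ a) analytic_on {0}" for s a
    unfolding p_def by (auto intro!: analytic_intros va)
  have contW: "continuous_on S W"
    using W(3) by (intro continuous_at_imp_continuous_on) (blast intro: has_derivative_continuous)
  have contp: "continuous_on (B \<times> ball 0 r) (\<lambda>q. p (fst q) (snd q))" if "\<And>a. (\<lambda>t. v t $ a) holomorphic_on ball 0 r" for B r
  proof -
    have "continuous_on (B \<times> ball 0 r) (\<lambda>q::complex\<times>complex. v (snd q) $ a)" for a
      by (rule continuous_on_compose2[OF holomorphic_on_imp_continuous_on[OF that, of a]])
        (auto intro!: continuous_intros)
    then have "continuous_on (B \<times> ball 0 r) (\<lambda>q. \<chi> a. v (snd q) $ a + fst q * h $ a)"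
      by (intro continuous_on_vec_lambda continuous_on_add continuous_on_mult continuous_on_const
          continuous_on_fst continuous_on_id)
    moreover have "p (fst q) (snd q) = (\<chi> a. v (snd q) $ a + fst q * h $ a)" for q
      by (simp add: p_def vec_eq_iff)
    ultimately show ?thesis by simp
  qed
  have "\<forall>\<^sub>F t in nhds 0. \<forall>a\<in>UNIV. (\<lambda>t. v t $ a) field_differentiable (at t)"
    using va by (intro eventually_ball_finite) (auto simp: analytic_at_iff_eventually_differentiable)
  then obtain R where R: "R > 0" "\<And>t a. dist t 0 < R \<Longrightarrow> (\<lambda>t. v t $ a) field_differentiable (at t)"
    unfolding eventually_nhds_metric by (elim exE conjE) (rule that, auto)
  have Rhol: "(\<lambda>t. v t $ a) holomorphic_on ball 0 R" for a
    unfolding holomorphic_on_def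
    by (intro ballI, rule field_differentiable_at_within, rule R(2)) (simp add: dist_commute)
  have "open ((ball 0 R \<times> ball 0 R) \<inter> (\<lambda>q. p (fst q) (snd q)) -` S)"
    by (rule continuous_open_preimage[OF contp[OF Rhol] open_Times[OF open_ball open_ball] S(2)])
  moreover have "(0, 0) \<in> (ball 0 R \<times> ball 0 R) \<inter> (\<lambda>q. p (fst q) (snd q)) -` S"
    using R(1) S(3) by (simp add: p_def)
  ultimately obtain e where e: "e > 0" "ball (0, 0) e \<subseteq> (ball 0 R \<times> ball 0 R) \<inter> (\<lambda>q. p (fst q) (snd q)) -` S"
    unfolding open_contains_ball by blast
  define r where "r = min R (e / 2)"
  have r: "r > 0" "\<And>a. (\<lambda>t. v t $ a) holomorphic_on ball 0 r"
      "\<And>s t. s \<in> ball 0 r \<Longrightarrow> t \<in> ball 0 r \<Longrightarrow> p s t \<in> S"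
  proof -
    show "r > 0" using R(1) e(1) by (simp add: r_def)
    show "(\<lambda>t. v t $ a) holomorphic_on ball 0 r" for a
      by (rule holomorphic_on_subset[OF Rhol]) (simp add: r_def subset_ball)
    fix s t :: complex assume st: "s \<in> ball 0 r" "t \<in> ball 0 r"
    have "dist (0, 0) (s, t) \<le> dist 0 s + dist 0 t"
      unfolding dist_Pair_Pair by (rule sqrt_sum_squares_le_sum) auto
    also have "\<dots> < e" using st by (simp add: r_def)
    finally have "(s, t) \<in> ball (0, 0) e" by simp
    then show "p s t \<in> S" using e(2) by auto
  qed
  have fam: "holo_family (\<lambda>s t. f s t $ a) (\<lambda>s t. f' s t $ a)" for a
  proof (cases "a = l")
    case False
    then show ?thesis
      using holo_family_line[OF va, of a "h $ a"] by (simp add: f_def f'_def p_def)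
  next
    case True
    have cp: "continuous_on (ball 0 r \<times> ball 0 r) (\<lambda>q. p (fst q) (snd q))" by (rule contp) (rule r(2))
    have cW: "continuous_on (ball 0 r \<times> ball 0 r) (\<lambda>q. W (p (fst q) (snd q)))"
      by (rule continuous_on_compose2[OF contW cp]) (use r(3) in auto)
    have cf: "continuous_on (ball 0 r \<times> ball 0 r) (\<lambda>q. f (fst q) (snd q))"
      unfolding f_def by (intro continuous_on_set_coord cp cW)
    have cP: "continuous_on (ball 0 r \<times> ball 0 r) (\<lambda>q. partial_deriv b F (f (fst q) (snd q)))" for b
      by (rule continuous_on_compose2[OF poly_fun_continuous_on[OF poly_fun_partial_deriv[OF poly]] cf]) auto
    have cE: "continuous_on (ball 0 r \<times> ball 0 r) (\<lambda>q. E (f (fst q) (snd q)))"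
      unfolding E_def by (intro continuous_intros cP) (use W(2) r(3) in \<open>auto simp: f_def\<close>)
    have hol: "(\<lambda>t. W (p s t)) holomorphic_on ball 0 r" if s: "s \<in> ball 0 r" for s
      unfolding analytic_on_open[OF open_ball, symmetric]
    proof (subst analytic_on_analytic_at, rule ballI)
      fix t :: complex assume t: "t \<in> ball 0 r"
      show "(\<lambda>t. W (p s t)) analytic_on {t}"
      proof (rule analytic_compose_vec[OF S(2)])
        show "\<exists>D. (W has_derivative D) (at x) \<and> (\<forall>c u. D (c *s u) = c * D u)" if "x \<in> S" for x
          by (intro exI conjI, rule W(3)[OF that]) (simp add: sum_distrib_left mult_ac)
        show "(\<lambda>t. p s t $ a) analytic_on {t}" for a
        proof -
          have "(\<lambda>t. v t $ a) analytic_on {t}"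
            unfolding analytic_at by (intro exI[of _ "ball 0 r"] conjI open_ball t r(2))
          then show ?thesis unfolding p_def by (auto intro!: analytic_intros)
        qed
        show "p s t \<in> S" using r(3) s t by blast
      qed
    qed
    have der: "((\<lambda>s. W (p s t)) has_field_derivative E (f s t)) (at s)" if "s \<in> ball 0 r" "t \<in> ball 0 r" for s t
      unfolding E_def f_def
      by (rule has_field_derivative_compose_vec[OF W(3)])
        (use r(3) that in \<open>auto simp: p_def sum_distrib_left mult_ac intro!: derivative_eq_intros\<close>)
    have "holo_family (\<lambda>s t. W (p s t)) (\<lambda>s t. E (f s t))"
      unfolding holo_family_def case_prod_unfold
      by (intro exI[of _ r] conjI ballI r(1) hol der cW cE)
    then show ?thesis by (simp add: True f_def f'_def)
  qed
  have f0: "\<forall>\<^sub>F t in nhds 0. f 0 t = v t"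
    using eventually_in_open_analytic[OF va S(2,3)] Fv
  proof eventually_elim
    case (elim t)
    then have "W (v t) = v t $ l" using W(4) by blast
    then show ?case by (simp add: f_def p_def)
  qed
  have jet0: "vjet (f 0) j = vjet v j" for j
  proof -
    have "\<forall>\<^sub>F t in nhds 0. f 0 t $ a = v t $ a" for a
      using f0 by eventually_elim simp
    then have "(deriv ^^ j) (\<lambda>t. f 0 t $ a) 0 = (deriv ^^ j) (\<lambda>t. v t $ a) 0" for a
      by (rule higher_deriv_cong_ev) simp
    then show ?thesis by (simp add: vjet_def)
  qed
  have curves: "\<forall>\<^sub>F s in nhds 0. f s \<in> cone_curves F"
  proof -
    have "f s \<in> cone_curves F" if s: "s \<in> ball 0 r" for s
      unfolding cone_curves_def
    proof (intro CollectI conjI allI)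
      have 0: "p s 0 \<in> S" using r(1,3) s by simp
      have "(\<lambda>t. W (p s t)) analytic_on {0}"
      proof (rule analytic_compose_vec[OF S(2) _ pa 0])
        show "\<exists>D. (W has_derivative D) (at x) \<and> (\<forall>c u. D (c *s u) = c * D u)" if "x \<in> S" for x
          by (intro exI conjI, rule W(3)[OF that]) (simp add: sum_distrib_left mult_ac)
      qed
      then show "(\<lambda>t. f s t $ a) analytic_on {0}" for a
        unfolding f_def by (cases "a = l") (auto intro: pa)
      show "f s 0 \<noteq> 0" using nz[OF 0] S(1) by (auto simp: f_def vec_eq_iff)
      show "\<forall>\<^sub>F t in nhds 0. F (f s t) = 0"
        using eventually_in_open_analytic[OF pa S(2) 0] by eventually_elim (simp add: f_def W(1))
    qed
    moreover have "\<forall>\<^sub>F s in nhds 0. s \<in> ball 0 r"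
      using r(1) by (intro eventually_nhds_in_open) auto
    ultimately show ?thesis by (rule eventually_mono[rotated])
  qed
  \<comment> \<open>\<open>\<kappa>\<close> measures the failure of \<open>h\<close> to be tangent along \<open>v\<close>; it vanishes to order greater than \<open>k\<close>.\<close>
  define \<kappa> where "\<kappa> = (\<lambda>t. \<Sum>i\<in>UNIV. partial_deriv i F (v t) * h $ i)"
  have vS: "partial_deriv l F (v 0) \<noteq> 0" using W(2)[OF S(3)] W(4)[OF S(3) F0] by simp
  have pd: "(\<lambda>t. partial_deriv b F (v t)) analytic_on {0}" for b
    by (rule poly_fun_analytic[OF poly_fun_partial_deriv[OF poly] va])
  have \<kappa>: "\<kappa> analytic_on {0}" unfolding \<kappa>_def by (intro analytic_intros pd)
  \<comment> \<open>The velocity of the family at \<open>s = 0\<close>, as a germ in \<open>t\<close>, is \<open>h\<close> up to a multiple of \<open>\<kappa>\<close>.\<close>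
  have f'0: "\<forall>\<^sub>F t in nhds 0. f' 0 t $ a = h $ a + (if a = l then \<kappa> t * (- 1 / partial_deriv l F (v t)) else 0)" for a
    using f0 eventually_nonzero_analytic[OF pd vS]
  proof eventually_elim
    case (elim t)
    have "\<kappa> t = partial_deriv l F (v t) * h $ l + (\<Sum>i\<in>UNIV - {l}. partial_deriv i F (v t) * h $ i)"
      unfolding \<kappa>_def by (subst sum.remove[of _ l]) auto
    then show ?case using elim by (auto simp: f'_def E_def field_simps)
  qed
  have an: "(\<lambda>t. h $ a + (if a = l then \<kappa> t * (- 1 / partial_deriv l F (v t)) else 0)) analytic_on {0}" for a
    using vS by (cases "a = l") (auto intro!: analytic_intros \<kappa> pd)
  have f'an: "(\<lambda>t. f' 0 t $ a) analytic_on {0}" for a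
    using analytic_at_cong[OF f'0 refl] an by blast
  have f'jet: "(deriv ^^ j) (\<lambda>t. f' 0 t $ a) 0 = (if j = 0 then h $ a else 0)" if "j \<le> k" for j a
  proof -
    have "(deriv ^^ j) (\<lambda>t. f' 0 t $ a) 0 = (deriv ^^ j) (\<lambda>t. h $ a + (if a = l then \<kappa> t * (- 1 / partial_deriv l F (v t)) else 0)) 0"
      by (rule higher_deriv_cong_ev[OF f'0 refl])
    also have "\<dots> = (deriv ^^ j) (\<lambda>t. h $ a) 0 + (deriv ^^ j) (\<lambda>t. if a = l then \<kappa> t * (- 1 / partial_deriv l F (v t)) else 0) 0"
      using vS by (intro higher_deriv_add_at) (cases "a = l"; auto intro!: analytic_intros \<kappa> pd)+
    also have "(deriv ^^ j) (\<lambda>t. if a = l then \<kappa> t * (- 1 / partial_deriv l F (v t)) else 0) 0 = 0"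
    proof (cases "a = l")
      case True
      have "(deriv ^^ j) (\<lambda>t. \<kappa> t * (- 1 / partial_deriv l F (v t))) 0 = 0"
        using h that vS by (intro higher_deriv_mult_eq_0[of _ _ k] \<kappa> analytic_intros pd) (auto simp: \<kappa>_def)
      then show ?thesis using True by simp
    qed simp
    finally show ?thesis by simp
  qed
  show ?thesis
  proof (rule that[OF fam curves jet0])
    show "((\<lambda>s. vjet (f s) 0 $ a) has_field_derivative h $ a) (at 0)" for a
      using holo_family_jet_deriv[OF fam f'an, of 0 a] f'jet[of 0 a] unfolding vjet_def by simp
    show "((\<lambda>s. vjet (f s) j $ a) has_field_derivative 0) (at 0)" if "1 \<le> j" "j \<le> k" for a j
      using holo_family_jet_deriv[OF fam f'an, of j a] f'jet[of j a] that unfolding vjet_def by simp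
  qed
qed

end

section \<open>Extremal curves\<close>

lemma vjet_0 [simp]: "vjet v 0 = v 0"
  by (simp add: vjet_def)

lemma vjet_nth: "vjet v j $ i = (deriv ^^ j) (\<lambda>t. v t $ i) 0"
  by (simp add: vjet_def)

lemma norm_vec_sq: "(norm (x :: complex^'N))\<^sup>2 = (\<Sum>i\<in>UNIV. (norm (x $ i))\<^sup>2)"
  by (simp add: norm_vec_def L2_set_def sum_nonneg)

lemma norm_vector_smult: "norm (c *s (x :: complex^'N)) = norm c * norm x"
  by (simp add: norm_vec_def L2_set_def norm_mult power_mult_distrib sum_distrib_left[symmetric] real_sqrt_mult)

lemma common_convergent_subsequence:
  fixes f :: "nat \<Rightarrow> nat \<Rightarrow> 'a::metric_space"
  assumes "compact C" "\<And>n j. j \<le> k \<Longrightarrow> f n j \<in> C"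
  obtains r c where "strict_mono (r :: nat \<Rightarrow> nat)" "\<And>j. j \<le> k \<Longrightarrow> (\<lambda>n. f (r n) j) \<longlonglongrightarrow> c j"
proof -
  have "\<exists>r. strict_mono (r :: nat \<Rightarrow> nat) \<and> (\<forall>j\<le>k. \<exists>l. (\<lambda>n. f (r n) j) \<longlonglongrightarrow> l)"
    using assms(2)
  proof (induction k)
    case 0
    then have "\<forall>n. f n 0 \<in> C" by simp
    then have "\<exists>l\<in>C. \<exists>r. strict_mono (r :: nat \<Rightarrow> nat) \<and> ((\<lambda>n. f n 0) \<circ> r) \<longlonglongrightarrow> l"
      using assms(1)[unfolded compact_def, rule_format, of "\<lambda>n. f n 0"] by simp
    then show ?case by (auto simp: o_def)
  next
    case (Suc k)
    then obtain r where r: "strict_mono (r :: nat \<Rightarrow> nat)" "\<forall>j\<le>k. \<exists>l. (\<lambda>n. f (r n) j) \<longlonglongrightarrow> l" by auto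
    have "\<forall>n. f (r n) (Suc k) \<in> C" using Suc.prems by simp
    then have "\<exists>l\<in>C. \<exists>r'. strict_mono (r' :: nat \<Rightarrow> nat) \<and> ((\<lambda>n. f (r n) (Suc k)) \<circ> r') \<longlonglongrightarrow> l"
      using assms(1)[unfolded compact_def, rule_format, of "\<lambda>n. f (r n) (Suc k)"] by simp
    then obtain l r' where r': "strict_mono (r' :: nat \<Rightarrow> nat)" "((\<lambda>n. f (r n) (Suc k)) \<circ> r') \<longlonglongrightarrow> l"
      by blast
    have "\<exists>l. (\<lambda>n. f ((r \<circ> r') n) j) \<longlonglongrightarrow> l" if "j \<le> Suc k" for j
    proof (cases "j = Suc k")
      case True
      then show ?thesis using r'(2) by (auto simp: o_def)
    next
      case False
      then obtain l where "(\<lambda>n. f (r n) j) \<longlonglongrightarrow> l" using r(2) \<open>j \<le> Suc k\<close> le_Suc_eq by blast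
      from LIMSEQ_subseq_LIMSEQ[OF this r'(1)] show ?thesis by (auto simp: o_def)
    qed
    then show ?case using strict_mono_o[OF r(1) r'(1)] by blast
  qed
  then show ?thesis using that by metis
qed

text \<open>What a global section yields on the cone: a function of curves that depends continuously on
  their \<open>k\<close>-jets, is holomorphic along holomorphic families, descends to projective space and has
  weight \<open>m\<close> under linear reparametrisation.\<close>

locale curve_functional = smooth_cone F d for F :: "complex^'N \<Rightarrow> complex" and d +
  fixes q :: "(complex \<Rightarrow> complex^'N) \<Rightarrow> complex" and k m :: nat
  assumes m: "m \<ge> 1" and k_less: "k + 2 < CARD('N)"
    and q_continuous: "\<And>vs v. (\<And>n. vs n \<in> cone_curves F) \<Longrightarrow> v \<in> cone_curves F \<Longrightarrow>
      (\<And>j. j \<le> k \<Longrightarrow> (\<lambda>n. vjet (vs n) j) \<longlonglongrightarrow> vjet v j) \<Longrightarrow> (\<lambda>n. q (vs n)) \<longlonglongrightarrow> q v"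
    and q_holomorphic: "\<And>f f'. (\<And>i. holo_family (\<lambda>s t. f s t $ i) (\<lambda>s t. f' s t $ i)) \<Longrightarrow>
      (\<forall>\<^sub>F s in nhds 0. f s \<in> cone_curves F) \<Longrightarrow> (\<lambda>s. q (f s)) analytic_on {0}"
    and q_weight: "\<And>v l. v \<in> cone_curves F \<Longrightarrow> l \<noteq> 0 \<Longrightarrow> q (\<lambda>t. v (l * t)) = l ^ m * q v"
    and q_scale: "\<And>v c. v \<in> cone_curves F \<Longrightarrow> c \<noteq> 0 \<Longrightarrow> q (\<lambda>t. c *s v t) = q v"
begin

text \<open>The power to which the \<open>j\<close>-th derivative enters \<open>jet_size\<close>. It has to be an integer, so
  that these powers are holomorphic, and \<open>j * wexp j\<close> must not depend on \<open>j\<close>.\<close>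

definition wexp :: "nat \<Rightarrow> nat" where "wexp j = m * fact k div j"

lemma mult_wexp: "1 \<le> j \<Longrightarrow> j \<le> k \<Longrightarrow> j * wexp j = m * fact k"
  unfolding wexp_def by (intro dvd_mult_div_cancel dvd_mult dvd_fact)

lemma wexp_pos: "1 \<le> j \<Longrightarrow> j \<le> k \<Longrightarrow> wexp j \<ge> 1"
  using mult_wexp[of j] m by (cases "wexp j = 0") auto

text \<open>A gauge on jets that is invariant under \<open>v \<mapsto> c v\<close> and homogeneous under
  \<open>t \<mapsto> l t\<close> of the same degree as \<open>norm (q v) ^ (2 * fact k)\<close>. The
  numerators are squared moduli of holomorphic functions of the jet; the base point enters only through the norm in the denominator.\<close>

definition jet_size :: "(complex \<Rightarrow> complex^'N) \<Rightarrow> real" where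
  "jet_size v = (\<Sum>j=1..k. \<Sum>i\<in>UNIV. (norm (vjet v j $ i) / norm (v 0)) ^ (2 * wexp j))"

lemma jet_size_nonneg: "jet_size v \<ge> 0"
  by (auto simp: jet_size_def intro!: sum_nonneg)

lemma curve_rescale:
  assumes "v \<in> cone_curves F" "c \<noteq> 0" "l \<noteq> 0"
  shows "(\<lambda>t. c *s v (l * t)) \<in> cone_curves F"
    and "vjet (\<lambda>t. c *s v (l * t)) j = (c * l ^ j) *s vjet v j"
proof -
  have va: "\<And>a. (\<lambda>t. v t $ a) analytic_on {0}" and v0: "v 0 \<noteq> 0" and Fv: "\<forall>\<^sub>F t in nhds 0. F (v t) = 0"
    using assms(1) by (auto simp: cone_curves_def)
  have an: "(\<lambda>t. v (l * t) $ a) analytic_on {0}" for a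
  proof -
    have "((\<lambda>t. v t $ a) \<circ> (\<lambda>t. l * t)) analytic_on {0}"
      by (rule analytic_on_compose) (auto intro!: analytic_intros va)
    then show ?thesis by (simp add: o_def)
  qed
  have "filterlim (\<lambda>t. l * t) (nhds 0) (nhds 0)"
    using tendsto_mult[OF tendsto_const tendsto_ident_at, of l "0::complex" UNIV]
    by (auto simp: tendsto_nhds_iff)
  then have "\<forall>\<^sub>F t in nhds 0. F (v (l * t)) = 0"
    using Fv by (auto simp: filterlim_iff)
  then have "\<forall>\<^sub>F t in nhds 0. F (c *s v (l * t)) = 0"
    by eventually_elim (simp add: homogeneous_form_scale[OF form])
  then show "(\<lambda>t. c *s v (l * t)) \<in> cone_curves F"
    using an v0 assms(2) by (auto simp: cone_curves_def intro!: analytic_intros)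
  show "vjet (\<lambda>t. c *s v (l * t)) j = (c * l ^ j) *s vjet v j"
    by (simp add: vec_eq_iff vjet_nth higher_deriv_cmult'[OF an] higher_deriv_scale[OF va] mult.assoc)
qed

lemma jet_size_rescale:
  assumes "v \<in> cone_curves F" "c \<noteq> 0" "l \<noteq> 0"
  shows "jet_size (\<lambda>t. c *s v (l * t)) = norm l ^ (2 * (m * fact k)) * jet_size v"
proof -
  have "(norm (vjet (\<lambda>t. c *s v (l * t)) j $ i) / norm (c *s v (l * 0))) ^ (2 * wexp j)
      = norm l ^ (2 * (m * fact k)) * (norm (vjet v j $ i) / norm (v 0)) ^ (2 * wexp j)" if "j \<in> {1..k}" for i j
  proof -
    have "norm (vjet (\<lambda>t. c *s v (l * t)) j $ i) / norm (c *s v (l * 0)) = norm l ^ j * (norm (vjet v j $ i) / norm (v 0))"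
      using assms(2) by (simp add: curve_rescale(2)[OF assms] norm_vector_smult norm_mult norm_power)
    moreover have "(norm l ^ j) ^ (2 * wexp j) = norm l ^ (2 * (m * fact k))"
    proof -
      have "j * (2 * wexp j) = 2 * (m * fact k)" using mult_wexp[of j] that by simp
      then show ?thesis by (simp only: power_mult[symmetric])
    qed
    ultimately show ?thesis by (simp only: power_mult_distrib)
  qed
  then show ?thesis by (simp add: jet_size_def sum_distrib_left)
qed

lemma q_cong:
  assumes "v \<in> cone_curves F" "w \<in> cone_curves F" "\<And>j. j \<le> k \<Longrightarrow> vjet v j = vjet w j"
  shows "q v = q w"
  using q_continuous[of "\<lambda>n. v" w] assms by (simp add: LIMSEQ_const_iff)

text \<open>A curve with vanishing derivatives has the same jet as \<open>t \<mapsto> v (2 t)\<close>, so that the weight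
  gives \<open>q v = 2 ^ m * q v\<close>.\<close>

lemma jet_size_eq_0_imp:
  assumes v: "v \<in> cone_curves F" and R: "jet_size v = 0"
  shows "q v = 0"
proof -
  have v0: "v 0 \<noteq> 0" using v by (simp add: cone_curves_def)
  have "vjet v j = 0" if "j \<in> {1..k}" for j
  proof -
    have "(\<Sum>i\<in>UNIV. (norm (vjet v j $ i) / norm (v 0)) ^ (2 * wexp j)) = 0"
      using R that unfolding jet_size_def by (subst (asm) sum_nonneg_eq_0_iff) (auto intro!: sum_nonneg)
    then have "(norm (vjet v j $ i) / norm (v 0)) ^ (2 * wexp j) = 0" for i
      by (subst (asm) sum_nonneg_eq_0_iff) auto
    with v0 have "vjet v j $ i = 0" for i by simp
    then show ?thesis by (simp add: vec_eq_iff)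
  qed
  then have jets: "vjet (\<lambda>t. 1 *s v (2 * t)) j = vjet v j" if "j \<le> k" for j
  proof -
    have "vjet (\<lambda>t. 1 *s v (2 * t)) j = (1 * 2 ^ j) *s vjet v j"
      by (rule curve_rescale(2)[OF v]) auto
    also have "\<dots> = vjet v j"
      using that \<open>\<And>j. j \<in> {1..k} \<Longrightarrow> vjet v j = 0\<close>[of j] by (cases "j = 0") auto
    finally show ?thesis .
  qed
  have "q (\<lambda>t. 1 *s v (2 * t)) = q v"
    by (rule q_cong[OF curve_rescale(1)[OF v] v jets]) auto
  then have "q v = 2 ^ m * q v"
    using q_weight[OF v, of 2] by simp
  moreover have "(2::complex) ^ m \<noteq> 1"
  proof -
    have "1 < norm ((2::complex) ^ m)" using m by (simp add: norm_power)
    then show ?thesis by auto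
  qed
  ultimately show ?thesis by simp
qed

lemma normalise:
  assumes v: "v \<in> cone_curves F" and R: "jet_size v > 0"
  obtains w where "w \<in> cone_curves F" "norm (w 0) = 1" "jet_size w = 1"
    "norm (q v) ^ (2 * fact k) = norm (q w) ^ (2 * fact k) * jet_size v"
proof -
  define N where "N = 2 * (m * fact k)"
  have N: "N > 0" using m by (simp add: N_def)
  \<comment> \<open>Reparametrisation by \<open>\<rho>\<close> normalises \<open>jet_size\<close>, multiplication by \<open>c\<close> the base point.\<close>
  define \<rho> where "\<rho> = root N (1 / jet_size v)"
  have \<rho>: "\<rho> > 0" "\<rho> ^ N = 1 / jet_size v"
    using N R by (auto simp: \<rho>_def real_root_pow_pos)
  have v0: "norm (v 0) > 0" using v by (simp add: cone_curves_def)
  define c where "c = complex_of_real (1 / norm (v 0))"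
  define w where "w = (\<lambda>t. c *s v (of_real \<rho> * t))"
  have cl: "c \<noteq> 0" "complex_of_real \<rho> \<noteq> 0" using v0 \<rho> by (auto simp: c_def)
  show ?thesis
  proof
    show w: "w \<in> cone_curves F" unfolding w_def by (rule curve_rescale(1)[OF v cl])
    show "norm (w 0) = 1"
      using v0 by (simp add: w_def c_def norm_vector_smult norm_divide)
    have "jet_size w = norm (complex_of_real \<rho>) ^ N * jet_size v"
      unfolding w_def N_def by (rule jet_size_rescale[OF v cl])
    then show "jet_size w = 1" using \<rho> R by simp
    have w1: "(\<lambda>t. v (of_real \<rho> * t)) \<in> cone_curves F"
      using curve_rescale(1)[OF v _ cl(2), of 1] by simp
    have "q w = of_real \<rho> ^ m * q v"
      unfolding w_def using q_scale[OF w1 cl(1)] q_weight[OF v cl(2)] by simp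
    then have "norm (q w) ^ (2 * fact k) = (\<rho> ^ m) ^ (2 * fact k) * norm (q v) ^ (2 * fact k)"
      using \<rho>(1) by (simp add: norm_mult norm_power power_mult_distrib)
    also have "(\<rho> ^ m) ^ (2 * fact k) = 1 / jet_size v"
    proof -
      have "m * (2 * fact k) = N" by (simp add: N_def)
      then show ?thesis using \<rho>(2) by (simp only: power_mult[symmetric])
    qed
    finally show "norm (q v) ^ (2 * fact k) = norm (q w) ^ (2 * fact k) * jet_size v"
      using R by simp
  qed
qed

definition unit_curves :: "(complex \<Rightarrow> complex^'N) set" where
  "unit_curves = {v \<in> cone_curves F. norm (v 0) = 1 \<and> jet_size v = 1}"

text \<open>The jets of these curves are bounded. A limit of such jets satisfies the equation of the cone up
  to order \<open>k\<close>, and is therefore again the jet of a curve in the cone.\<close>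

lemma unit_curves_sequentially_compact:
  assumes vs: "\<And>n. vs n \<in> unit_curves"
  obtains r v where "strict_mono (r :: nat \<Rightarrow> nat)" "v \<in> unit_curves" "\<And>j. j \<le> k \<Longrightarrow> (\<lambda>n. vjet (vs (r n)) j) \<longlonglongrightarrow> vjet v j"
proof -
  have vs': "vs n \<in> cone_curves F" "norm (vs n 0) = 1" "jet_size (vs n) = 1" for n
    using vs by (auto simp: unit_curves_def)
  have bd: "vjet (vs n) j \<in> cball 0 (real CARD('N))" if "j \<le> k" for n j
  proof (cases "j = 0")
    case True
    then show ?thesis using vs'(2)[of n] by (simp add: Suc_leI)
  next
    case False
    have "norm (vjet (vs n) j $ i) \<le> 1" for i
    proof (rule ccontr)
      assume "\<not> ?thesis"
      then have "1 < norm (vjet (vs n) j $ i) ^ (2 * wexp j)"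
        using wexp_pos[of j] False that by (intro one_less_power) auto
      also have "\<dots> = (norm (vjet (vs n) j $ i) / norm (vs n 0)) ^ (2 * wexp j)" by (simp add: vs'(2))
      also have "\<dots> \<le> (\<Sum>i\<in>UNIV. (norm (vjet (vs n) j $ i) / norm (vs n 0)) ^ (2 * wexp j))"
        by (rule member_le_sum) auto
      also have "\<dots> \<le> jet_size (vs n)"
        unfolding jet_size_def using False that by (intro member_le_sum) (auto intro!: sum_nonneg)
      finally show False by (simp add: vs'(3))
    qed
    then have "(\<Sum>i\<in>UNIV. norm (vjet (vs n) j $ i)) \<le> (\<Sum>i\<in>(UNIV::'N set). 1)" by (intro sum_mono)
    moreover have "norm (vjet (vs n) j) \<le> (\<Sum>i\<in>UNIV. norm (vjet (vs n) j $ i))"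
      unfolding norm_vec_def by (rule L2_set_le_sum) auto
    ultimately show ?thesis by simp
  qed
  obtain r c where r: "strict_mono (r :: nat \<Rightarrow> nat)" "\<And>j. j \<le> k \<Longrightarrow> (\<lambda>n. vjet (vs (r n)) j) \<longlonglongrightarrow> c j"
    by (rule common_convergent_subsequence[of "cball 0 (real CARD('N))" k "\<lambda>n j. vjet (vs n) j"])
      (use bd in auto)
  \<comment> \<open>The limit of the jets is the jet of a polynomial curve \<open>p\<close>, which need not lie in the cone.\<close>
  have "\<forall>i. \<exists>f. f analytic_on {0} \<and> (\<forall>j\<le>k. (deriv ^^ j) f 0 = c j $ i)"
  proof
    fix i
    show "\<exists>f. f analytic_on {0} \<and> (\<forall>j\<le>k. (deriv ^^ j) f 0 = c j $ i)"
      by (rule exists_polynomial_with_jet[of k "\<lambda>j. c j $ i"]) auto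
  qed
  then obtain g where g: "\<And>i. g i analytic_on {0}" "\<And>i j. j \<le> k \<Longrightarrow> (deriv ^^ j) (g i) 0 = c j $ i" by metis
  define p where "p = (\<lambda>t. \<chi> i. g i t)"
  have p: "(\<lambda>t. p t $ i) analytic_on {0}" "j \<le> k \<Longrightarrow> vjet p j = c j" for i j
    using g by (auto simp: p_def vjet_def vec_eq_iff)
  have comp: "jets_tendsto k (\<lambda>n t. vs (r n) t $ i) (\<lambda>t. p t $ i)" for i
    unfolding jets_tendsto_def
  proof (intro conjI allI impI)
    show "\<forall>\<^sub>F n in sequentially. (\<lambda>t. vs (r n) t $ i) analytic_on {0}"
      using vs'(1) by (auto simp: cone_curves_def)
    show "(\<lambda>t. p t $ i) analytic_on {0}" by (rule p)
    show "(\<lambda>n. (deriv ^^ j) (\<lambda>t. vs (r n) t $ i) 0) \<longlonglongrightarrow> (deriv ^^ j) (\<lambda>t. p t $ i) 0" if "j \<le> k" for j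
      using tendsto_vec_nth[OF r(2)[OF that], of i] p(2)[OF that] by (simp add: vjet_nth[symmetric])
  qed
  have Fp: "(deriv ^^ j) (\<lambda>t. F (p t)) 0 = 0" if "j \<le> k" for j
  proof -
    have "(\<lambda>n. (deriv ^^ j) (\<lambda>t. F (vs (r n) t)) 0) \<longlonglongrightarrow> (deriv ^^ j) (\<lambda>t. F (p t)) 0"
      using poly_fun_jets_tendsto[OF poly comp] that by (simp add: jets_tendsto_def)
    moreover have "(deriv ^^ j) (\<lambda>t. F (vs n t)) 0 = 0" for n
    proof -
      have "(deriv ^^ j) (\<lambda>t. F (vs n t)) 0 = (deriv ^^ j) (\<lambda>t. 0) 0"
        using vs'(1)[of n] by (intro higher_deriv_cong_ev) (auto simp: cone_curves_def)
      then show ?thesis by simp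
    qed
    ultimately show ?thesis by (simp add: LIMSEQ_const_iff)
  qed
  have "(\<lambda>n. vs (r n) 0) \<longlonglongrightarrow> p 0"
    using r(2)[of 0] p(2)[of 0] by simp
  from tendsto_norm[OF this] have "norm (p 0) = 1"
    by (simp add: vs'(2) LIMSEQ_const_iff)
  then have "p 0 \<noteq> 0" by auto
  obtain v where v: "v \<in> cone_curves F" "\<And>j. j \<le> k \<Longrightarrow> vjet v j = vjet p j"
    by (rule jet_correction[where k = k, OF p(1) \<open>p 0 \<noteq> 0\<close> Fp]) (assumption, rule that)
  have lim: "(\<lambda>n. vjet (vs (r n)) j) \<longlonglongrightarrow> vjet v j" if "j \<le> k" for j
    using r(2)[OF that] p(2)[OF that] v(2)[OF that] by simp
  have v0: "norm (v 0) = 1" using v(2)[of 0] \<open>norm (p 0) = 1\<close> by simp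
  have "(\<lambda>n. jet_size (vs (r n))) \<longlonglongrightarrow> jet_size v"
    unfolding jet_size_def
    by (intro tendsto_sum tendsto_power tendsto_divide tendsto_norm tendsto_vec_nth lim)
      (use lim[of 0] v0 in auto)
  then have "jet_size v = 1" by (simp add: vs'(3) LIMSEQ_const_iff)
  then show ?thesis using that[OF r(1) _ lim] v(1) v0 by (simp add: unit_curves_def)
qed

text \<open>By homogeneity, a maximum of \<open>|q|\<close> on normalised curves is a maximum of the quotient of
  a power of \<open>|q|\<close> by \<open>jet_size\<close> on all curves.\<close>

lemma extremal_curve:
  assumes "u \<in> cone_curves F" "q u \<noteq> 0"
  obtains v where "v \<in> unit_curves" "q v \<noteq> 0"
    "\<And>w. w \<in> cone_curves F \<Longrightarrow> norm (q w) ^ (2 * fact k) \<le> norm (q v) ^ (2 * fact k) * jet_size w"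
proof -
  define A where "A = (\<lambda>v. norm (q v)) ` unit_curves"
  have Rpos: "jet_size w > 0" if "w \<in> cone_curves F" "q w \<noteq> 0" for w
    using jet_size_eq_0_imp[OF that(1)] that(2) jet_size_nonneg[of w] by (cases "jet_size w = 0") auto
  obtain u' where u': "u' \<in> unit_curves" "norm (q u) ^ (2 * fact k) = norm (q u') ^ (2 * fact k) * jet_size u"
    using normalise[OF assms(1) Rpos[OF assms]] unfolding unit_curves_def by blast
  have "compact A"
    unfolding compact_def
  proof (intro allI impI)
    fix a :: "nat \<Rightarrow> real"
    assume "\<forall>n. a n \<in> A"
    then have "\<forall>n. \<exists>w. w \<in> unit_curves \<and> a n = norm (q w)" by (auto simp: A_def)
    then obtain vs where vs: "\<And>n. vs n \<in> unit_curves" "\<And>n. a n = norm (q (vs n))" by metis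
    obtain r v where rv: "strict_mono (r :: nat \<Rightarrow> nat)" "v \<in> unit_curves" "\<And>j. j \<le> k \<Longrightarrow> (\<lambda>n. vjet (vs (r n)) j) \<longlonglongrightarrow> vjet v j"
      by (rule unit_curves_sequentially_compact[of vs, OF vs(1)]) (rule that)
    have "(\<lambda>n. q (vs (r n))) \<longlonglongrightarrow> q v"
      using vs(1) rv by (intro q_continuous) (auto simp: unit_curves_def)
    then have "(a \<circ> r) \<longlonglongrightarrow> norm (q v)"
      unfolding o_def vs(2) by (rule tendsto_norm)
    then show "\<exists>l\<in>A. \<exists>r. strict_mono r \<and> (a \<circ> r) \<longlonglongrightarrow> l"
      using rv(1,2) by (auto simp: A_def)
  qed
  moreover have "A \<noteq> {}" using u'(1) by (auto simp: A_def)
  ultimately obtain a where "a \<in> A" "\<forall>b\<in>A. b \<le> a" using compact_attains_sup by metis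
  then obtain v where v: "v \<in> unit_curves" "\<And>w. w \<in> unit_curves \<Longrightarrow> norm (q w) \<le> norm (q v)" by (auto simp: A_def)
  have le: "norm (q w) ^ (2 * fact k) \<le> norm (q v) ^ (2 * fact k) * jet_size w" if w: "w \<in> cone_curves F" for w
  proof (cases "q w = 0")
    case True
    then show ?thesis using jet_size_nonneg[of w] by (simp add: power_0_left)
  next
    case False
    obtain w' where "w' \<in> unit_curves" "norm (q w) ^ (2 * fact k) = norm (q w') ^ (2 * fact k) * jet_size w"
      using normalise[OF w Rpos[OF w False]] unfolding unit_curves_def by blast
    moreover have "norm (q w') ^ (2 * fact k) \<le> norm (q v) ^ (2 * fact k)"
      using v(2) calculation(1) by (intro power_mono) auto
    ultimately show ?thesis using jet_size_nonneg[of w] by (simp add: mult_right_mono)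
  qed
  moreover have "q v \<noteq> 0"
  proof
    assume "q v = 0"
    then have "norm (q u) ^ (2 * fact k) \<le> 0" using le[OF assms(1)] by (simp add: power_0_left)
    moreover have "norm (q u) ^ (2 * fact k) > 0" using assms(2) by simp
    ultimately show False by linarith
  qed
  ultimately show ?thesis using that[OF v(1)] by blast
qed

end

section \<open>Vanishing of functionals on curves\<close>

context curve_functional begin

text \<open>Deform an extremal curve \<open>v\<close> along the disc of \<open>tangent_disc\<close>, and divide by the component
  \<open>\<mu> s\<close> of the base point along \<open>v 0\<close>, which is stationary at 0. The base point then becomes
  \<open>v 0 + y s\<close> with \<open>y s\<close> orthogonal to \<open>v 0\<close> and of velocity \<open>h \<noteq> 0\<close>, so its squared norm is at least
  \<open>1 + c * |s|\<^sup>2\<close>; this makes \<open>jet_size\<close> decrease to second order, whereas the numerators of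
  \<open>jet_size\<close> are squared moduli of stationary holomorphic functions. As \<open>|q|\<close> is bounded in terms
  of \<open>jet_size\<close>, with equality at \<open>v\<close>, the maximum principle forces it to vanish.\<close>

theorem vanishing:
  assumes u: "u \<in> cone_curves F"
  shows "q u = 0"
proof (rule ccontr)
  assume qu: "q u \<noteq> 0"
  obtain v where v: "v \<in> unit_curves" "q v \<noteq> 0"
    and ext: "\<And>w. w \<in> cone_curves F \<Longrightarrow> norm (q w) ^ (2 * fact k) \<le> norm (q v) ^ (2 * fact k) * jet_size w"
    by (rule extremal_curve[OF u qu]) (rule that)
  have vc: "v \<in> cone_curves F" and nv: "norm (v 0) = 1" and Rv: "jet_size v = 1"
    using v(1) by (auto simp: unit_curves_def)
  have va: "\<And>a. (\<lambda>t. v t $ a) analytic_on {0}" using vc by (auto simp: cone_curves_def)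
  obtain h where h: "h \<noteq> 0" "(\<Sum>i\<in>UNIV. cnj (v 0 $ i) * h $ i) = 0"
    and hj: "\<And>j. j \<le> k \<Longrightarrow> (deriv ^^ j) (\<lambda>t. \<Sum>i\<in>UNIV. partial_deriv i F (v t) * h $ i) 0 = 0"
    by (rule tangent_direction[OF k_less va]) (rule that)
  obtain f f' where fam: "\<And>i. holo_family (\<lambda>s t. f s t $ i) (\<lambda>s t. f' s t $ i)"
    and fc: "\<forall>\<^sub>F s in nhds 0. f s \<in> cone_curves F" and fj: "\<And>j. vjet (f 0) j = vjet v j"
    and f0: "\<And>i. ((\<lambda>s. vjet (f s) 0 $ i) has_field_derivative h $ i) (at 0)"
    and fd: "\<And>i j. 1 \<le> j \<Longrightarrow> j \<le> k \<Longrightarrow> ((\<lambda>s. vjet (f s) j $ i) has_field_derivative 0) (at 0)"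
    by (rule tangent_disc[where k = k, OF vc hj]) (assumption, rule that)
  have f00: "f 0 0 = v 0" using fj[of 0] by simp
  have f0c: "f 0 \<in> cone_curves F" using eventually_nhds_x_imp_x[OF fc] .
  have fan: "(\<lambda>s. vjet (f s) j $ i) analytic_on {0}" for i j
    unfolding vjet_nth by (rule holo_family_jet_analytic[OF fam])
  have f0an: "(\<lambda>s. f s 0 $ i) analytic_on {0}" for i using fan[of 0 i] by simp
  have f0': "((\<lambda>s. f s 0 $ i) has_field_derivative h $ i) (at 0)" for i using f0[of i] by simp
  define \<mu> where "\<mu> = (\<lambda>s. \<Sum>i\<in>UNIV. cnj (v 0 $ i) * f s 0 $ i)"
  have \<mu>0: "\<mu> 0 = 1"
  proof -
    have "\<mu> 0 = (\<Sum>i\<in>UNIV. of_real ((norm (v 0 $ i))\<^sup>2))"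
      by (simp only: \<mu>_def f00 complex_norm_square mult.commute)
    also have "\<dots> = of_real ((norm (v 0))\<^sup>2)" by (simp only: norm_vec_sq of_real_sum)
    finally show ?thesis by (simp add: nv)
  qed
  have \<mu>an: "\<mu> analytic_on {0}" unfolding \<mu>_def by (intro analytic_intros f0an)
  have \<mu>': "(\<mu> has_field_derivative 0) (at 0)"
  proof -
    have "(\<mu> has_field_derivative (\<Sum>i\<in>UNIV. cnj (v 0 $ i) * h $ i)) (at 0)"
      unfolding \<mu>_def by (intro DERIV_sum DERIV_cmult f0')
    then show ?thesis by (simp add: h(2))
  qed
  define y where "y = (\<lambda>s. (1 / \<mu> s) *s f s 0 - v 0)"
  have y': "((\<lambda>s. y s $ i) has_field_derivative h $ i) (at 0)" for i
  proof -
    have "((\<lambda>s. f s 0 $ i / \<mu> s - v 0 $ i) has_field_derivative (h $ i * \<mu> 0 - f 0 0 $ i * 0) / (\<mu> 0 * \<mu> 0) - 0) (at 0)"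
      by (intro DERIV_diff DERIV_divide f0' \<mu>' DERIV_const) (simp add: \<mu>0)
    then show ?thesis by (simp add: y_def \<mu>0)
  qed
  have norm_split: "(norm ((1 / \<mu> s) *s f s 0))\<^sup>2 = 1 + (norm (y s))\<^sup>2" if "\<mu> s \<noteq> 0" for s
  proof -
    have "cnj (v 0 $ i) * y s $ i = cnj (v 0 $ i) * f s 0 $ i / \<mu> s - cnj (v 0 $ i) * f 0 0 $ i" for i
      by (simp add: y_def f00 right_diff_distrib)
    then have "(\<Sum>i\<in>UNIV. cnj (v 0 $ i) * y s $ i) = \<mu> s / \<mu> s - \<mu> 0"
      by (simp only: sum_subtractf sum_divide_distrib[symmetric]) (simp only: \<mu>_def)
    then have orth: "(\<Sum>i\<in>UNIV. cnj (v 0 $ i) * y s $ i) = 0" using that \<mu>0 by simp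
    have sq: "(norm (z + w))\<^sup>2 = (norm z)\<^sup>2 + (norm w)\<^sup>2 + 2 * Re (cnj z * w)" for z w :: complex
      unfolding cmod_power2 by (simp add: algebra_simps power2_eq_square)
    have "(1 / \<mu> s) *s f s 0 = v 0 + y s" by (simp add: y_def)
    then have "(norm ((1 / \<mu> s) *s f s 0))\<^sup>2 = (\<Sum>i\<in>UNIV. (norm (v 0 $ i))\<^sup>2 + (norm (y s $ i))\<^sup>2 + 2 * Re (cnj (v 0 $ i) * y s $ i))"
      unfolding norm_vec_sq by (simp add: sq)
    also have "\<dots> = (norm (v 0))\<^sup>2 + (norm (y s))\<^sup>2 + 2 * Re (\<Sum>i\<in>UNIV. cnj (v 0 $ i) * y s $ i)"
      by (simp only: sum.distrib norm_vec_sq sum_distrib_left Re_sum)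
    finally show ?thesis using orth nv by simp
  qed
  obtain a where a: "h $ a \<noteq> 0" using h(1) by (auto simp: vec_eq_iff)
  define c where "c = (norm (h $ a) / 2)\<^sup>2"
  have c: "c > 0" using a by (simp add: c_def)
  have y0: "y 0 = 0" by (simp add: y_def \<mu>0 f00)
  have ylow: "\<forall>\<^sub>F s in nhds 0. c * (norm s)\<^sup>2 \<le> (norm (y s))\<^sup>2"
  proof -
    have "((\<lambda>s. norm ((y s $ a - y 0 $ a) / (s - 0))) \<longlongrightarrow> norm (h $ a)) (at 0)"
      using y'[of a] by (intro tendsto_norm) (simp only: has_field_derivative_iff)
    then have "\<forall>\<^sub>F s in at 0. norm ((y s $ a - y 0 $ a) / (s - 0)) > norm (h $ a) / 2"
      using a by (intro order_tendstoD) auto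
    then have "\<forall>\<^sub>F s in at 0. c * (norm s)\<^sup>2 \<le> (norm (y s))\<^sup>2"
      using eventually_neq_at_within[of 0 0 UNIV]
    proof eventually_elim
      case (elim s)
      then have "norm (h $ a) / 2 * norm s \<le> norm (y s $ a)"
        by (simp add: y0 norm_divide field_simps)
      also have "\<dots> \<le> norm (y s)" by (rule Finite_Cartesian_Product.norm_nth_le)
      finally have "(norm (h $ a) / 2 * norm s)\<^sup>2 \<le> (norm (y s))\<^sup>2" by (rule power_mono) simp
      then show ?case by (simp only: c_def power_mult_distrib)
    qed
    then show ?thesis by (simp add: eventually_nhds_conv_at)
  qed
  define M where "M = norm (q v) ^ (2 * fact k)"
  have M: "M > 0" using v(2) by (simp add: M_def)
  \<comment> \<open>The sum of \<open>|b p s|\<^sup>2\<close> is \<open>M\<close> times the sum of the numerators of \<open>jet_size\<close> for the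
  normalised curve \<open>f s / \<mu> s\<close>.\<close>
  define b where "b = (\<lambda>p s. of_real (sqrt M) * (vjet (f s) (fst p) $ snd p / \<mu> s) ^ wexp (fst p))"
  define G where "G = (\<lambda>s. q (f s) ^ (2 * fact k))"
  let ?I = "{1..k} \<times> (UNIV :: 'N set)"
  have bn: "(norm (b p s))\<^sup>2 = M * norm (vjet (f s) (fst p) $ snd p / \<mu> s) ^ (2 * wexp (fst p))" for p s
    using M by (simp add: b_def norm_mult norm_power power_mult_distrib power_mult[symmetric] mult.commute)
  have q0: "q (f 0) = q v"
    by (rule q_cong[OF f0c vc fj])
  have "G 0 = 0"
  proof (rule sum_squares_touching_imp_zero[where I = ?I and b = b, OF _ _ _ _ c])
    show "finite ?I" by simp
    show "G analytic_on {0}"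
      unfolding G_def by (intro analytic_intros q_holomorphic[OF fam fc])
    show "b p analytic_on {0}" if "p \<in> ?I" for p
      unfolding b_def by (intro analytic_intros fan \<mu>an) (auto simp: \<mu>0)
    show "(b p has_field_derivative 0) (at 0)" if "p \<in> ?I" for p
    proof -
      have "((\<lambda>s. vjet (f s) (fst p) $ snd p / \<mu> s) has_field_derivative
          (0 * \<mu> 0 - vjet (f 0) (fst p) $ snd p * 0) / (\<mu> 0 * \<mu> 0)) (at 0)"
        using that by (intro DERIV_divide fd \<mu>') (auto simp: \<mu>0)
      from DERIV_cmult[OF DERIV_power[OF this, of "wexp (fst p)"], of "of_real (sqrt M)"]
      show ?thesis by (simp add: b_def)
    qed
    have "\<forall>\<^sub>F s in nhds 0. \<mu> s \<noteq> 0" by (rule eventually_nonzero_analytic[OF \<mu>an]) (simp add: \<mu>0)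
    then show "\<forall>\<^sub>F s in nhds 0. norm (G s) * (1 + c * (norm s)\<^sup>2) \<le> (\<Sum>p\<in>?I. (norm (b p s))\<^sup>2)"
      using fc ylow
    proof eventually_elim
      case (elim s)
      let ?z = "norm ((1 / \<mu> s) *s f s 0)"
      have z: "1 + c * (norm s)\<^sup>2 \<le> ?z\<^sup>2" "1 \<le> ?z\<^sup>2"
        using norm_split[OF elim(1)] elim(3) by auto
      have "jet_size (f s) * (1 + c * (norm s)\<^sup>2) \<le> (\<Sum>j=1..k. \<Sum>i\<in>UNIV. norm (vjet (f s) j $ i / \<mu> s) ^ (2 * wexp j))"
        unfolding jet_size_def sum_distrib_right
      proof (intro sum_mono)
        fix j i assume j: "j \<in> {1..k}"
        have "?z\<^sup>2 \<le> (?z\<^sup>2) ^ wexp j"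
          using z(2) wexp_pos[of j] j self_le_power[of "?z\<^sup>2" "wexp j"] by simp
        then have "1 + c * (norm s)\<^sup>2 \<le> ?z ^ (2 * wexp j)"
          using z(1) by (simp add: power_mult)
        moreover have "norm (vjet (f s) j $ i / \<mu> s) = norm (vjet (f s) j $ i) / norm (f s 0) * ?z"
          using elim(1,2) by (simp add: norm_vector_smult norm_divide cone_curves_def)
        ultimately show "(norm (vjet (f s) j $ i) / norm (f s 0)) ^ (2 * wexp j) * (1 + c * (norm s)\<^sup>2)
            \<le> norm (vjet (f s) j $ i / \<mu> s) ^ (2 * wexp j)"
          by (simp only: power_mult_distrib) (intro mult_left_mono, auto)
      qed
      then have "M * (jet_size (f s) * (1 + c * (norm s)\<^sup>2)) \<le> (\<Sum>p\<in>?I. (norm (b p s))\<^sup>2)"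
        using M unfolding bn sum_distrib_left[symmetric]
        by (simp add: sum.cartesian_product' [symmetric] sum.cartesian_product case_prod_unfold)
      moreover have "norm (G s) * (1 + c * (norm s)\<^sup>2) \<le> M * jet_size (f s) * (1 + c * (norm s)\<^sup>2)"
        using ext[OF elim(2)] c by (intro mult_right_mono) (auto simp: G_def M_def norm_power)
      ultimately show ?case by (simp add: mult.assoc)
    qed
    show "norm (G 0) = (\<Sum>p\<in>?I. (norm (b p 0))\<^sup>2)"
    proof -
      have "jet_size v = (\<Sum>p\<in>?I. norm (vjet v (fst p) $ snd p) ^ (2 * wexp (fst p)))"
        by (simp add: jet_size_def nv sum.cartesian_product case_prod_unfold)
      then have "M = M * (\<Sum>p\<in>?I. norm (vjet v (fst p) $ snd p) ^ (2 * wexp (fst p)))"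
        using Rv by simp
      also have "\<dots> = (\<Sum>p\<in>?I. (norm (b p 0))\<^sup>2)"
        unfolding bn by (simp add: fj \<mu>0 sum_distrib_left)
      finally show ?thesis by (simp add: G_def M_def q0 norm_power)
    qed
  qed
  then show False using v(2) q0 by (simp add: G_def)
qed

end

section \<open>Projective points and standard charts\<close>

lemma proj_point_eq: "proj_point v = range (\<lambda>c. c *s v)"
  by (simp add: proj_point_def vec.span_singleton)

lemma proj_point_smult [simp]: "c \<noteq> 0 \<Longrightarrow> proj_point (c *s v) = proj_point v"
  unfolding proj_point_eq
proof (intro set_eqI iffI)
  fix x assume "c \<noteq> 0" "x \<in> range (\<lambda>a. a *s v)"
  then obtain a where "x = a *s v" by blast
  with \<open>c \<noteq> 0\<close> have "x = (a / c) *s (c *s v)" by simp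
  then show "x \<in> range (\<lambda>a. a *s (c *s v))" by blast
qed auto

lemma proj_point_eqD:
  assumes "proj_point v = proj_point w" "w \<noteq> 0"
  obtains c where "c \<noteq> 0" "w = c *s v"
proof -
  have "w = 1 *s w" by simp
  then have "w \<in> proj_point w" unfolding proj_point_eq by blast
  then have "w \<in> proj_point v" using assms by simp
  then obtain c where "w = c *s v" by (auto simp: proj_point_eq)
  with assms(2) show ?thesis by (intro that[of c]) auto
qed

text \<open>Open cones are saturated for the projection to projective space.\<close>

lemma openin_proj_cone:
  assumes "open C" "0 \<notin> C" "\<And>c x. c \<noteq> 0 \<Longrightarrow> x \<in> C \<Longrightarrow> c *s x \<in> C"
  shows "openin proj_topology (proj_point ` C)"
proof -
  have "{v. v \<noteq> 0 \<and> proj_point v \<in> proj_point ` C} = C"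
  proof (intro set_eqI iffI)
    fix v assume "v \<in> {v. v \<noteq> 0 \<and> proj_point v \<in> proj_point ` C}"
    then obtain x where "x \<in> C" "proj_point x = proj_point v" "v \<noteq> 0" by auto
    then show "v \<in> C" using assms(3) by (metis proj_point_eqD)
  qed (use assms(2) in auto)
  moreover have "proj_point ` C \<subseteq> proj_space" using assms(2) by (auto simp: proj_space_def)
  ultimately show ?thesis using assms(1) by (simp add: openin_proj_topology)
qed

text \<open>Inhomogeneous coordinates with denominator \<open>i\<close>, restricted to the coordinates \<open>\<beta> a\<close>. They
  are computed from an arbitrary vector on the line.\<close>

definition affine_coords :: "'N \<Rightarrow> ('n \<Rightarrow> 'N) \<Rightarrow> (complex^'N) set \<Rightarrow> complex^'n" where
  "affine_coords i \<beta> L = (let x = (SOME x. x \<in> L \<and> x $ i \<noteq> 0) in \<chi> a. x $ \<beta> a / x $ i)"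

lemma affine_coords_proj_point:
  assumes "v $ i \<noteq> 0"
  shows "affine_coords i \<beta> (proj_point v) = (\<chi> a. v $ \<beta> a / v $ i)"
proof -
  define x where "x = (SOME x. x \<in> proj_point v \<and> x $ i \<noteq> 0)"
  have "v = 1 *s v" by simp
  then have "v \<in> proj_point v" unfolding proj_point_eq by blast
  then have "x \<in> proj_point v \<and> x $ i \<noteq> 0"
    unfolding x_def using assms by (intro someI[of "\<lambda>x. x \<in> proj_point v \<and> x $ i \<noteq> 0" v] conjI)
  then obtain c where c: "x = c *s v" "x $ i \<noteq> 0" unfolding proj_point_eq by blast
  then have "c \<noteq> 0" by auto
  then show ?thesis
    unfolding affine_coords_def Let_def x_def[symmetric] using c by (simp add: vec_eq_iff)
qed

context smooth_cone begin

definition hypersurface :: "(complex^'N) set set" where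
  "hypersurface = proj_point ` {v. v \<noteq> 0 \<and> F v = 0}"

lemma F_smult_eq_0: "c \<noteq> 0 \<Longrightarrow> F (c *s v) = 0 \<longleftrightarrow> F v = 0"
  by (simp add: homogeneous_form_scale[OF form])

lemma proj_point_in_hypersurface: "v \<noteq> 0 \<Longrightarrow> proj_point v \<in> hypersurface \<longleftrightarrow> F v = 0"
  unfolding hypersurface_def using F_smult_eq_0 by (auto elim!: proj_point_eqD)

lemma hypersurface_subset: "hypersurface \<subseteq> proj_space"
  by (auto simp: hypersurface_def proj_space_def)

text \<open>With \<open>i\<close>, \<open>l\<close> and \<open>W\<close> from \<open>local_graph\<close>, the coordinates other than \<open>i\<close> and \<open>l\<close>,
  divided by the coordinate \<open>i\<close>, form a chart. The inverse \<open>\<Psi>\<close> of the chart is the graph of \<open>W\<close> over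
  the affine slice on which the coordinate \<open>i\<close> has the same value \<open>\<kappa>\<close> as at \<open>x0\<close>. The open cone \<open>C\<close>
  contains the vectors whose rescaling to this slice lies in the domain of \<open>W\<close>.\<close>

lemma standard_chart:
  assumes card: "CARD('N) = CARD('n) + 2" and x0: "F x0 = 0" "x0 \<noteq> 0"
  obtains i and \<beta> :: "'n::finite \<Rightarrow> 'N" and U C where
    "(U, affine_coords i \<beta>) \<in> submanifold_charts hypersurface"
    "open C" "x0 \<in> C" "\<And>x. x \<in> C \<Longrightarrow> x $ i \<noteq> 0" "\<And>x. x \<in> C \<Longrightarrow> F x = 0 \<Longrightarrow> proj_point x \<in> U"
proof -
  obtain i l S W where il: "i \<noteq> l" and S: "open S" "x0 \<in> S"
    and nz: "\<And>x. x \<in> S \<Longrightarrow> x $ i \<noteq> 0"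
    and FW: "\<And>x. x \<in> S \<Longrightarrow> F (set_coord l (W x) x) = 0"
    and pW: "\<And>x. x \<in> S \<Longrightarrow> partial_deriv l F (set_coord l (W x) x) \<noteq> 0"
    and W': "\<And>x. x \<in> S \<Longrightarrow> (W has_derivative
        (\<lambda>u. - (\<Sum>i\<in>UNIV - {l}. partial_deriv i F (set_coord l (W x) x) * u $ i) / partial_deriv l F (set_coord l (W x) x))) (at x)"
    and Wuniq: "\<And>x. x \<in> S \<Longrightarrow> F x = 0 \<Longrightarrow> W x = x $ l"
    and Wl: "\<And>x a. W (set_coord l a x) = W x"
    by (rule local_graph[OF x0]) (rule that)
  define DW where "DW = (\<lambda>x u. - (\<Sum>i\<in>UNIV - {l}. partial_deriv i F (set_coord l (W x) x) * u $ i) / partial_deriv l F (set_coord l (W x) x))"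
  have DW: "(W has_derivative DW x) (at x)" if "x \<in> S" for x
    unfolding DW_def by (rule W'[OF that])
  have DW_lin: "DW x (c *s u) = c * DW x u" for x c u
    by (simp add: DW_def sum_distrib_left mult_ac)
  have "card (UNIV - {i, l}) = CARD('n)"
    using card il by (simp add: card_Diff_subset)
  then obtain \<beta> :: "'n \<Rightarrow> 'N" where \<beta>: "bij_betw \<beta> UNIV (UNIV - {i, l})"
    using finite_same_card_bij[of "UNIV :: 'n set" "UNIV - {i, l}"] by auto
  then have \<beta>_ne: "\<beta> a \<noteq> i" "\<beta> a \<noteq> l" and \<beta>_inj: "inj \<beta>" for a
    by (auto simp: bij_betw_def)
  have \<beta>_cases: "b = i \<or> b = l \<or> (\<exists>a. b = \<beta> a)" for b
    using \<beta> unfolding bij_betw_def by blast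
  define \<kappa> where "\<kappa> = x0 $ i"
  have \<kappa>: "\<kappa> \<noteq> 0" using nz[OF S(2)] by (simp add: \<kappa>_def)
  define lin :: "complex^'n \<Rightarrow> complex^'N" where
    "lin = (\<lambda>u. \<chi> b. if b = i \<or> b = l then 0 else \<kappa> * u $ inv \<beta> b)"
  define emb :: "complex^'n \<Rightarrow> complex^'N" where
    "emb = (\<lambda>z. \<chi> b. if b = i then \<kappa> else if b = l then x0 $ l else \<kappa> * z $ inv \<beta> b)"
  define \<Psi> where "\<Psi> = (\<lambda>z. set_coord l (W (emb z)) (emb z))"
  define B where "B = {z. emb z \<in> S \<and> \<Psi> z \<in> S}"
  \<comment> \<open>\<open>nrm\<close> rescales a vector to the slice.\<close>
  define nrm where "nrm = (\<lambda>x::complex^'N. (\<kappa> / x $ i) *s x)"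
  define C where "C = {x. x $ i \<noteq> 0 \<and> nrm x \<in> S \<and> set_coord l (x0 $ l) (nrm x) \<in> S}"
  define U where "U = (\<lambda>z. proj_point (\<Psi> z)) ` B"
  define \<phi> where "\<phi> = (affine_coords i \<beta> :: _ \<Rightarrow> complex^'n)"
  define aff where "aff = (\<lambda>x::complex^'N. (\<chi> a. x $ \<beta> a / x $ i) :: complex^'n)"
  have \<phi>_aff: "\<phi> (proj_point x) = aff x" if "x $ i \<noteq> 0" for x
    unfolding \<phi>_def aff_def using that by (rule affine_coords_proj_point)
  have emb_aff: "emb (aff x) = set_coord l (x0 $ l) (nrm x)" if "x $ i \<noteq> 0" for x
    unfolding vec_eq_iff
  proof
    fix b
    consider "b = i" | "b = l" | a where "b = \<beta> a" using \<beta>_cases by blast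
    then show "emb (aff x) $ b = set_coord l (x0 $ l) (nrm x) $ b"
      by cases (use il \<beta>_ne that in \<open>auto simp: emb_def aff_def nrm_def inv_f_f[OF \<beta>_inj]\<close>)
  qed
  have nrm_smult: "nrm (c *s x) = nrm x" if "c \<noteq> 0" for c x
    using that by (simp add: nrm_def vec_eq_iff)
  have \<Psi>_coord: "\<Psi> z $ i = \<kappa>" "\<Psi> z $ \<beta> a = \<kappa> * z $ a" for z a
    using il \<beta>_ne by (auto simp: \<Psi>_def emb_def inv_f_f[OF \<beta>_inj])
  have aff_\<Psi>: "aff (\<Psi> z) = z" and nrm_\<Psi>: "nrm (\<Psi> z) = \<Psi> z" for z
    using \<kappa> by (simp_all add: aff_def nrm_def \<Psi>_coord)
  have \<Psi>_nz: "\<Psi> z \<noteq> 0" for z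
    using \<kappa> \<Psi>_coord(1)[of z] by auto
  have \<Psi>_emb: "set_coord l (x0 $ l) (\<Psi> z) = emb z" for z
    using il by (simp add: \<Psi>_def vec_eq_iff emb_def)
  have F\<Psi>: "F (\<Psi> z) = 0" if "z \<in> B" for z
    using that FW by (simp add: B_def \<Psi>_def)
  have \<Psi>_aff: "\<Psi> (aff x) = nrm x" "aff x \<in> B" if "x \<in> C" "F x = 0" for x
  proof -
    have x: "x $ i \<noteq> 0" "nrm x \<in> S" "set_coord l (x0 $ l) (nrm x) \<in> S" using that by (auto simp: C_def)
    have "F (nrm x) = 0" using that(2) x(1) \<kappa> by (simp add: nrm_def F_smult_eq_0)
    then have "W (nrm x) = nrm x $ l" using Wuniq x by blast
    then show *: "\<Psi> (aff x) = nrm x"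
      by (simp add: \<Psi>_def emb_aff[OF x(1)] Wl)
    show "aff x \<in> B" using x by (simp add: B_def * emb_aff)
  qed
  have proj_nrm: "proj_point (nrm x) = proj_point x" if "x $ i \<noteq> 0" for x
    using that \<kappa> by (simp add: nrm_def)
  have U_eq: "U = proj_point ` C \<inter> hypersurface"
  proof (intro set_eqI iffI)
    fix L assume "L \<in> U"
    then obtain z where z: "z \<in> B" "L = proj_point (\<Psi> z)" by (auto simp: U_def)
    then have "\<Psi> z \<in> C" using \<Psi>_coord(1)[of z] \<kappa> by (simp add: C_def nrm_\<Psi> \<Psi>_emb B_def)
    with z show "L \<in> proj_point ` C \<inter> hypersurface" using F\<Psi>[of z] \<Psi>_nz by (simp add: proj_point_in_hypersurface)
  next
    fix L assume "L \<in> proj_point ` C \<inter> hypersurface"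
    then obtain x where x: "x \<in> C" "L = proj_point x" "L \<in> hypersurface" by blast
    then have "x \<noteq> 0" "x $ i \<noteq> 0" by (auto simp: C_def)
    then have "F x = 0" using x proj_point_in_hypersurface by blast
    then have "L = proj_point (\<Psi> (aff x))" "aff x \<in> B" using \<Psi>_aff[OF x(1)] x(2) proj_nrm \<open>x $ i \<noteq> 0\<close> by auto
    then show "L \<in> U" by (auto simp: U_def)
  qed
  have lin_smult: "lin (c *s u) = c *s lin u" for c u
    by (simp add: lin_def vec_eq_iff)
  have emb_lin: "emb = (\<lambda>z. emb 0 + lin z)" using il by (auto simp: emb_def lin_def vec_eq_iff)
  have "bounded_linear lin"
    unfolding linear_conv_bounded_linear[symmetric]
  proof (rule linearI)
    show "lin (r *\<^sub>R u) = r *\<^sub>R lin u" for r u by (simp add: lin_def vec_eq_iff)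
  qed (auto simp: lin_def vec_eq_iff ring_distribs)
  then have "((\<lambda>z. emb 0 + lin z) has_derivative (\<lambda>u. 0 + lin u)) (at z)" for z
    by (intro has_derivative_add has_derivative_const bounded_linear_imp_has_derivative)
  then have emb': "(emb has_derivative lin) (at z)" for z
    by (subst emb_lin) simp
  define D\<Psi> where "D\<Psi> = (\<lambda>z u. set_coord l (DW (emb z) (lin u)) (lin u))"
  have \<Psi>': "(\<Psi> has_derivative D\<Psi> z) (at z)" if "emb z \<in> S" for z
    unfolding \<Psi>_def D\<Psi>_def
  proof (rule has_derivative_vecI)
    fix b
    have "((\<lambda>z. emb z $ b) has_derivative (\<lambda>u. lin u $ b)) (at z)"
      by (rule bounded_linear.has_derivative[OF bounded_linear_vec_nth emb'])
    moreover have "((\<lambda>z. W (emb z)) has_derivative (\<lambda>u. DW (emb z) (lin u))) (at z)"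
      using has_derivative_compose[OF emb' DW[OF that]] .
    ultimately show "((\<lambda>x. set_coord l (W (emb x)) (emb x) $ b) has_derivative
        (\<lambda>h. set_coord l (DW (emb z) (lin h)) (lin h) $ b)) (at z)"
      by (cases "b = l") auto
  qed
  have emb_cont: "continuous_on A emb" for A
    using emb' has_derivative_continuous continuous_at_imp_continuous_on by blast
  have \<Psi>_cont: "continuous_on A \<Psi>" if "A \<subseteq> {z. emb z \<in> S}" for A
    using \<Psi>' has_derivative_continuous that by (intro continuous_at_imp_continuous_on) blast
  have openE: "open {z. emb z \<in> S}"
    using open_vimage[OF S(1) emb_cont[of UNIV]] by (simp add: vimage_def)
  have "open ({z. emb z \<in> S} \<inter> \<Psi> -` S)"
    by (rule continuous_open_preimage[OF \<Psi>_cont openE S(1)]) simp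
  then have "open B" by (simp add: B_def vimage_def Collect_conj_eq)
  have openi: "open {x::complex^'N. x $ i \<noteq> 0}" by (intro open_Collect_neq continuous_intros)
  have nrm_cont: "continuous_on {x. x $ i \<noteq> 0} nrm"
  proof -
    have "continuous_on {x. x $ i \<noteq> 0} (\<lambda>x. \<chi> b. \<kappa> / x $ i * x $ b)"
      by (intro continuous_on_vec_lambda continuous_intros) auto
    moreover have "nrm = (\<lambda>x. \<chi> b. \<kappa> / x $ i * x $ b)" by (simp add: nrm_def fun_eq_iff vec_eq_iff)
    ultimately show ?thesis by simp
  qed
  have aff_cont: "continuous_on {x. x $ i \<noteq> 0} aff"
    unfolding aff_def by (intro continuous_on_vec_lambda continuous_intros) auto
  have "open (({x. x $ i \<noteq> 0} \<inter> nrm -` S) \<inter> ({x. x $ i \<noteq> 0} \<inter> (\<lambda>x. set_coord l (x0 $ l) (nrm x)) -` S))"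
    by (intro open_Int continuous_open_preimage[OF _ openi S(1)] nrm_cont continuous_on_set_coord continuous_on_const)
  moreover have "({x. x $ i \<noteq> 0} \<inter> nrm -` S) \<inter> ({x. x $ i \<noteq> 0} \<inter> (\<lambda>x. set_coord l (x0 $ l) (nrm x)) -` S) = C"
    by (auto simp: C_def)
  ultimately have "open C" by simp
  have C_cone: "c *s x \<in> C" if "c \<noteq> 0" "x \<in> C" for c x
    using that by (simp add: C_def nrm_smult)
  have C0: "0 \<notin> C" by (simp add: C_def)
  have UX: "U \<subseteq> hypersurface" using U_eq by blast
  have topU: "topspace (subtopology proj_topology U) = U"
    using UX hypersurface_subset by (auto simp: topspace_subtopology topspace_proj_topology)
  have \<phi>\<Psi>: "\<phi> (proj_point (\<Psi> z)) = z" for z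
    using \<phi>_aff[of "\<Psi> z"] aff_\<Psi> \<Psi>_coord(1)[of z] \<kappa> by simp
  have \<phi>U: "\<phi> ` U = B" by (auto simp: U_def \<phi>\<Psi> image_image)
  have "openin (subtopology proj_topology hypersurface) U"
    unfolding openin_subtopology using openin_proj_cone[OF \<open>open C\<close> C0 C_cone] U_eq by blast
  moreover have "open (\<phi> ` U)" using \<phi>U \<open>open B\<close> by simp
  moreover have "homeomorphic_map (subtopology proj_topology U) (top_of_set (\<phi> ` U)) \<phi>"
    unfolding homeomorphic_map_maps homeomorphic_maps_def \<phi>U
  proof (intro exI[of _ "\<lambda>z. proj_point (\<Psi> z)"] conjI ballI)
    have "continuous_map (subtopology proj_topology U) euclidean \<phi>"
      unfolding continuous_map_def topU
    proof (intro conjI allI impI)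
      fix V :: "(complex^'n) set"
      assume "openin euclidean V"
      then have "open ({x. x $ i \<noteq> 0} \<inter> aff -` V)"
        by (intro continuous_open_preimage aff_cont openi) simp
      then have oV: "open (C \<inter> ({x. x $ i \<noteq> 0} \<inter> aff -` V))" using \<open>open C\<close> by blast
      have "openin proj_topology (proj_point ` (C \<inter> ({x. x $ i \<noteq> 0} \<inter> aff -` V)))"
      proof (rule openin_proj_cone[OF oV])
        fix c :: complex and x assume c: "c \<noteq> 0" and x: "x \<in> C \<inter> ({x. x $ i \<noteq> 0} \<inter> aff -` V)"
        have "aff (c *s x) = aff x" using c by (simp add: aff_def)
        then show "c *s x \<in> C \<inter> ({x. x $ i \<noteq> 0} \<inter> aff -` V)" using c x C_cone by simp
      qed (use C0 in auto)
      moreover have "{L \<in> U. \<phi> L \<in> V} = proj_point ` (C \<inter> ({x. x $ i \<noteq> 0} \<inter> aff -` V)) \<inter> U"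
      proof (intro set_eqI iffI)
        fix L assume L: "L \<in> {L \<in> U. \<phi> L \<in> V}"
        then obtain x where x: "x \<in> C" "L = proj_point x" using U_eq by blast
        then have "x $ i \<noteq> 0" by (simp add: C_def)
        then have "aff x \<in> V" using L x \<phi>_aff by auto
        then show "L \<in> proj_point ` (C \<inter> ({x. x $ i \<noteq> 0} \<inter> aff -` V)) \<inter> U"
          using x L \<open>x $ i \<noteq> 0\<close> by auto
      next
        fix L assume "L \<in> proj_point ` (C \<inter> ({x. x $ i \<noteq> 0} \<inter> aff -` V)) \<inter> U"
        then show "L \<in> {L \<in> U. \<phi> L \<in> V}" using \<phi>_aff by auto
      qed
      ultimately show "openin (subtopology proj_topology U) {L \<in> U. \<phi> L \<in> V}"
        unfolding openin_subtopology by blast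
    qed simp
    then show "continuous_map (subtopology proj_topology U) (top_of_set B) \<phi>"
      unfolding continuous_map_in_subtopology topU using \<phi>U by auto
    have "continuous_map (top_of_set (- {0})) proj_topology (proj_point :: complex^'N \<Rightarrow> _)"
      unfolding continuous_map_def
    proof (intro conjI allI impI)
      show "proj_point \<in> topspace (top_of_set (- {0})) \<rightarrow> topspace (proj_topology :: (complex^'N) set topology)"
        by (auto simp: topspace_proj_topology proj_space_def)
      fix V :: "(complex^'N) set set" assume "openin proj_topology V"
      then have "open {v. v \<noteq> 0 \<and> proj_point v \<in> V}" by (simp add: openin_proj_topology)
      moreover have "{x \<in> topspace (top_of_set (- {0})). proj_point x \<in> V} = - {0} \<inter> {v. v \<noteq> 0 \<and> proj_point v \<in> V}" by auto
      ultimately show "openin (top_of_set (- {0})) {x \<in> topspace (top_of_set (- {0})). proj_point x \<in> V}"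
        by (simp only: openin_open_Int)
    qed
    moreover have "continuous_map (top_of_set B) (top_of_set (- {0})) \<Psi>"
      unfolding continuous_map_in_subtopology using \<Psi>_cont[of B] \<Psi>_nz by (auto simp: B_def)
    ultimately have "continuous_map (top_of_set B) proj_topology (proj_point \<circ> \<Psi>)"
      by (rule continuous_map_compose[rotated])
    then show "continuous_map (top_of_set B) (subtopology proj_topology U) (\<lambda>z. proj_point (\<Psi> z))"
      unfolding continuous_map_in_subtopology by (auto simp: U_def o_def)
    show "proj_point (\<Psi> (\<phi> L)) = L" if "L \<in> topspace (subtopology proj_topology U)" for L
      using that unfolding topU U_def by (auto simp: \<phi>\<Psi>)
  qed (use \<phi>\<Psi> in auto)
  moreover have "proj_immersion_at (inv_into U \<phi>) z" if "z \<in> \<phi> ` U" for z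
    unfolding proj_immersion_at_def
  proof (rule exI[of _ B], rule exI[of _ \<Psi>], rule exI[of _ "D\<Psi> z"], intro conjI ballI allI)
    have z: "z \<in> B" using that \<phi>U by simp
    show "open B" "z \<in> B" by fact+
    show "\<Psi> w \<noteq> 0" for w by (rule \<Psi>_nz)
    have "inj_on \<phi> U" by (auto simp: U_def inj_on_def \<phi>\<Psi>)
    then show "inv_into U \<phi> w = proj_point (\<Psi> w)" if "w \<in> B" for w
      using inv_into_f_f[of \<phi> U "proj_point (\<Psi> w)"] that by (simp add: \<phi>\<Psi> U_def)
    show "(\<Psi> has_derivative D\<Psi> z) (at z)" using z by (intro \<Psi>') (simp add: B_def)
    show "holomorphic_several_on (\<lambda>w. \<Psi> w $ b) B" for b
      unfolding holomorphic_several_on_def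
    proof
      fix w assume "w \<in> B"
      then have "((\<lambda>w. \<Psi> w $ b) has_derivative (\<lambda>u. D\<Psi> w u $ b)) (at w)"
        by (intro bounded_linear.has_derivative[OF bounded_linear_vec_nth] \<Psi>') (simp add: B_def)
      moreover have "D\<Psi> w (c *s u) $ b = c * D\<Psi> w u $ b" for c u
        by (simp add: D\<Psi>_def lin_smult DW_lin)
      ultimately show "\<exists>D. ((\<lambda>w. \<Psi> w $ b) has_derivative D) (at w) \<and> (\<forall>c u. D (c *s u) = c * D u)" by blast
    qed
    show "D\<Psi> z u \<in> proj_point (\<Psi> z) \<longrightarrow> u = 0" for u
    proof
      assume "D\<Psi> z u \<in> proj_point (\<Psi> z)"
      then obtain c where c: "D\<Psi> z u = c *s \<Psi> z" by (auto simp: proj_point_eq)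
      have "D\<Psi> z u $ i = 0" using il by (simp add: D\<Psi>_def lin_def)
      then have "c = 0" using c \<Psi>_coord(1)[of z] \<kappa> by simp
      then have "D\<Psi> z u $ \<beta> a = 0" for a using c by simp
      then show "u = 0" using \<beta>_ne \<kappa> by (simp add: D\<Psi>_def lin_def inv_f_f[OF \<beta>_inj] vec_eq_iff)
    qed
  qed
  ultimately have "(U, \<phi>) \<in> submanifold_charts hypersurface"
    unfolding submanifold_charts_def by blast
  then show ?thesis
  proof (rule that[of U i \<beta> C, folded \<phi>_def])
    show "open C" by fact
    have "nrm x0 = x0" using \<kappa> by (simp add: nrm_def \<kappa>_def)
    then show "x0 \<in> C" using S(2) \<kappa> by (simp add: C_def \<kappa>_def)
    show "x $ i \<noteq> 0" if "x \<in> C" for x using that by (simp add: C_def)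
    show "proj_point x \<in> U" if "x \<in> C" "F x = 0" for x
    proof -
      have "x \<noteq> 0" using that C0 by auto
      then show ?thesis using that by (simp add: U_eq proj_point_in_hypersurface)
    qed
  qed
qed

end

section \<open>From sections to functionals on curves\<close>

lemma weighted_polynomial_0: "weighted_polynomial k m (\<lambda>\<xi>. 0)"
  unfolding weighted_polynomial_def by (auto intro!: exI[of _ "{}"])

lemma zero_section: "(\<lambda>x J. 0) \<in> invariant_jet_differentials X A k m"
  unfolding invariant_jet_differentials_def invariant_fibre_def GG_fibre_def holomorphic_jet_section_def
  by (auto intro!: exI[of _ "\<lambda>\<xi>. 0"] weighted_polynomial_0 exI[of _ "{}"])

lemma biholomorphism_germ_scale:
  assumes "l \<noteq> 0"
  shows "biholomorphism_germ (\<lambda>t. l * t)"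
  unfolding biholomorphism_germ_def
proof (intro conjI exI[of _ UNIV] exI[of _ "\<lambda>t. t / l"])
  show "homeomorphism UNIV UNIV ((*) l) (\<lambda>t. t / l)"
    using assms by (intro homeomorphismI continuous_intros) auto
qed (use assms in \<open>auto intro!: holomorphic_intros\<close>)

context smooth_cone begin

abbreviation charts :: "((complex^'N) set, 'n::finite) chart set" where
  "charts \<equiv> submanifold_charts hypersurface"

text \<open>A chart of a submanifold of projective space comes with a local holomorphic lift of its inverse
  to nonzero vectors. Composing it with the curve in this chart gives a lift of the curve.\<close>

lemma curve_lift:
  assumes f: "f \<in> curves_at (charts :: ((complex^'N) set, 'n::finite) chart set) x"
  obtains v where "v \<in> cone_curves F" "\<forall>\<^sub>F t in nhds 0. f t = proj_point (v t)"
proof -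
  obtain U and \<phi> :: "(complex^'N) set \<Rightarrow> complex^'n" and r where U: "(U, \<phi>) \<in> charts"
    and r: "r > 0" "f ` ball 0 r \<subseteq> U" "\<And>i. (\<lambda>t. \<phi> (f t) $ i) holomorphic_on ball 0 r"
    using f unfolding curves_at_def by blast
  have UX: "U \<subseteq> hypersurface"
    using U unfolding submanifold_charts_def by (auto simp: openin_subtopology)
  have homeo: "homeomorphic_map (subtopology proj_topology U) (top_of_set (\<phi> ` U)) \<phi>"
    and imm: "\<And>z. z \<in> \<phi> ` U \<Longrightarrow> proj_immersion_at (inv_into U \<phi>) z"
    using U by (auto simp: submanifold_charts_def)
  have "topspace (subtopology proj_topology U) = U"
    using UX hypersurface_subset by (auto simp: topspace_subtopology topspace_proj_topology)
  then have inj: "inj_on \<phi> U" using homeomorphic_imp_injective_map[OF homeo] by simp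
  have f0: "f 0 \<in> U" using r by auto
  obtain W \<Psi> where W: "open W" "\<phi> (f 0) \<in> W" "\<And>i. holomorphic_several_on (\<lambda>w. \<Psi> w $ i) W"
    "\<And>w. w \<in> W \<Longrightarrow> \<Psi> w \<noteq> 0 \<and> inv_into U \<phi> w = proj_point (\<Psi> w)"
    using imm[of "\<phi> (f 0)"] f0 unfolding proj_immersion_at_def by blast
  define v where "v = (\<lambda>t. \<Psi> (\<phi> (f t)))"
  have an: "(\<lambda>t. \<phi> (f t) $ i) analytic_on {0}" for i
    using r(1,3) by (auto simp: analytic_on_def)
  have "\<forall>\<^sub>F t in nhds 0. t \<in> ball 0 r" using r(1) by (intro eventually_nhds_in_open) auto
  then have ev: "\<forall>\<^sub>F t in nhds 0. f t = proj_point (v t) \<and> v t \<noteq> 0 \<and> F (v t) = 0"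
    using eventually_in_open_analytic[where v = "\<lambda>t. \<phi> (f t)", OF an W(1,2)]
  proof eventually_elim
    case (elim t)
    have ft: "f t \<in> U" using r(2) elim(1) by auto
    then have "inv_into U \<phi> (\<phi> (f t)) = f t" using inj by (simp add: inv_into_f_f)
    then have 1: "f t = proj_point (v t)" "v t \<noteq> 0" using W(4)[OF elim(2)] by (auto simp: v_def)
    then have "F (v t) = 0" using ft UX proj_point_in_hypersurface[of "v t"] by auto
    with 1 show ?case by blast
  qed
  have "v \<in> cone_curves F"
    unfolding cone_curves_def
  proof (intro CollectI conjI allI)
    show "(\<lambda>t. v t $ i) analytic_on {0}" for i
      unfolding v_def
    proof (rule analytic_compose_vec[where v = "\<lambda>t. \<phi> (f t)", OF W(1) _ an W(2)])
      show "\<exists>D. ((\<lambda>w. \<Psi> w $ i) has_derivative D) (at x) \<and> (\<forall>c u. D (c *s u) = c * D u)" if "x \<in> W" for x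
        using W(3)[of i] that by (simp add: holomorphic_several_on_def)
    qed
    show "v 0 \<noteq> 0" using eventually_nhds_x_imp_x[OF ev] by blast
    show "\<forall>\<^sub>F t in nhds 0. F (v t) = 0" using ev by eventually_elim blast
  qed
  moreover have "\<forall>\<^sub>F t in nhds 0. f t = proj_point (v t)" using ev by eventually_elim blast
  ultimately show ?thesis by (rule that)
qed

text \<open>The jet in the affine chart \<open>affine_coords i \<beta>\<close> of the curve with lift \<open>v\<close>.\<close>

definition ratio_jet :: "'N \<Rightarrow> ('n \<Rightarrow> 'N) \<Rightarrow> (complex \<Rightarrow> complex^'N) \<Rightarrow> nat \<Rightarrow> complex^'n" where
  "ratio_jet i \<beta> v j = (\<chi> a. (deriv ^^ j) (\<lambda>t. v t $ \<beta> a / v t $ i) 0)"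

lemma coord_deriv_affine:
  assumes v: "v \<in> cone_curves F" and nz: "v 0 $ i \<noteq> 0" and f: "\<forall>\<^sub>F t in nhds 0. f t = proj_point (v t)"
  shows "coord_deriv (affine_coords i \<beta>) f j = ratio_jet i \<beta> v j"
proof -
  have va: "(\<lambda>t. v t $ i) analytic_on {0}" using v by (simp add: cone_curves_def)
  have "\<forall>\<^sub>F t in nhds 0. affine_coords i \<beta> (f t) = (\<chi> a. v t $ \<beta> a / v t $ i)"
    using f eventually_nonzero_analytic[OF va nz]
    by eventually_elim (simp add: affine_coords_proj_point)
  then have ev: "\<forall>\<^sub>F t in nhds 0. affine_coords i \<beta> (f t) $ a = v t $ \<beta> a / v t $ i" for a
    by eventually_elim simp
  show ?thesis
    unfolding coord_deriv_def ratio_jet_def vec_eq_iff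
    using higher_deriv_cong_ev[OF ev refl] by simp
qed

lemma cone_curve_projects:
  assumes v: "v \<in> cone_curves F" and chart: "(U, affine_coords i \<beta>) \<in> (charts :: ((complex^'N) set, 'n::finite) chart set)"
    and C: "open C" "v 0 \<in> C" "\<And>x. x \<in> C \<Longrightarrow> x $ i \<noteq> 0" "\<And>x. x \<in> C \<Longrightarrow> F x = 0 \<Longrightarrow> proj_point x \<in> U"
  shows "(\<lambda>t. proj_point (v t)) \<in> curves_at (charts :: ((complex^'N) set, 'n) chart set) (proj_point (v 0))"
proof -
  have va: "\<And>i. (\<lambda>t. v t $ i) analytic_on {0}" and Fv: "\<forall>\<^sub>F t in nhds 0. F (v t) = 0"
    using v by (auto simp: cone_curves_def)
  have vC: "\<forall>\<^sub>F t in nhds 0. v t \<in> C" by (rule eventually_in_open_analytic[OF va C(1,2)])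
  have an: "(\<lambda>t. v t $ \<beta> a / v t $ i) analytic_on {0}" for a
    by (intro analytic_intros va) (use C in auto)
  have "(\<lambda>t. affine_coords i \<beta> (proj_point (v t)) $ a) analytic_on {0}" for a
  proof -
    have ev: "\<forall>\<^sub>F t in nhds 0. v t $ \<beta> a / v t $ i = affine_coords i \<beta> (proj_point (v t)) $ a"
      using vC by eventually_elim (simp add: affine_coords_proj_point C(3))
    show ?thesis by (rule iffD1[OF analytic_at_cong[OF ev refl] an])
  qed
  then have "\<forall>\<^sub>F t in nhds 0. \<forall>a\<in>UNIV. (\<lambda>t. affine_coords i \<beta> (proj_point (v t)) $ a) field_differentiable (at t)"
    by (intro eventually_ball_finite) (auto simp: analytic_at_iff_eventually_differentiable)
  with vC Fv have "\<forall>\<^sub>F t in nhds 0. proj_point (v t) \<in> U \<and> (\<forall>a. (\<lambda>t. affine_coords i \<beta> (proj_point (v t)) $ a) field_differentiable (at t))"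
    by eventually_elim (auto intro: C(4))
  then obtain r where r: "r > 0" "\<And>t. dist t 0 < r \<Longrightarrow> proj_point (v t) \<in> U \<and> (\<forall>a. (\<lambda>t. affine_coords i \<beta> (proj_point (v t)) $ a) field_differentiable (at t))"
    unfolding eventually_nhds_metric by (elim exE conjE) (rule that, auto)
  have "(\<lambda>t. proj_point (v t)) ` ball 0 r \<subseteq> U" using r(2) by (auto simp: dist_commute)
  moreover have "(\<lambda>t. affine_coords i \<beta> (proj_point (v t)) $ a) holomorphic_on ball 0 r" for a
    unfolding holomorphic_on_def
  proof
    fix t :: complex assume "t \<in> ball 0 r"
    then have "(\<lambda>t. affine_coords i \<beta> (proj_point (v t)) $ a) field_differentiable (at t)"
      using r(2)[of t] by (simp add: dist_commute)
    then show "(\<lambda>t. affine_coords i \<beta> (proj_point (v t)) $ a) field_differentiable (at t within ball 0 r)"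
      by (rule field_differentiable_at_within)
  qed
  ultimately show ?thesis
    unfolding curves_at_def using r(1) chart by blast
qed

end

locale jet_section = smooth_cone F d for F :: "complex^'N \<Rightarrow> complex" and d +
  fixes A :: "((complex^'N) set, 'n::finite) chart set"
    and \<sigma> :: "(complex^'N) set \<Rightarrow> (complex \<Rightarrow> (complex^'N) set) set \<Rightarrow> complex" and k m :: nat
  assumes card: "CARD('N) = CARD('n) + 2"
    and A_def: "A = submanifold_charts hypersurface"
    and \<sigma>: "\<sigma> \<in> invariant_jet_differentials hypersurface A k m"
begin

definition cone_fun :: "(complex \<Rightarrow> complex^'N) \<Rightarrow> complex" where
  "cone_fun v = \<sigma> (proj_point (v 0)) (jet A k (\<lambda>t. proj_point (v t)))"

lemma local_formula:
  assumes "F x0 = 0" "x0 \<noteq> 0"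
  obtains i and \<beta> :: "'n \<Rightarrow> 'N" and C B S and a where
    "open C" "x0 \<in> C" "\<And>x. x \<in> C \<Longrightarrow> x $ i \<noteq> 0"
    "finite S" "open B" "\<And>x. x \<in> C \<Longrightarrow> F x = 0 \<Longrightarrow> (\<chi> b. x $ \<beta> b / x $ i) \<in> B"
    "\<And>\<alpha>. \<alpha> \<in> S \<Longrightarrow> holomorphic_several_on (a \<alpha>) B"
    "\<And>v f. v \<in> cone_curves F \<Longrightarrow> v 0 \<in> C \<Longrightarrow> f \<in> curves_at A (proj_point (v 0)) \<Longrightarrow>
       (\<forall>\<^sub>F t in nhds 0. f t = proj_point (v t)) \<Longrightarrow>
       \<sigma> (proj_point (v 0)) (jet A k f) = (\<Sum>\<alpha>\<in>S. a \<alpha> (ratio_jet i \<beta> v 0) * jet_monomial k \<alpha> (ratio_jet i \<beta> v))"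
proof -
  obtain i and \<beta> :: "'n \<Rightarrow> 'N" and U C where chart: "(U, affine_coords i \<beta>) \<in> submanifold_charts hypersurface"
    and C: "open C" "x0 \<in> C" "\<And>x. x \<in> C \<Longrightarrow> x $ i \<noteq> 0" "\<And>x. x \<in> C \<Longrightarrow> F x = 0 \<Longrightarrow> proj_point x \<in> U"
    by (rule standard_chart[OF card assms]) (rule that)
  let ?\<phi> = "affine_coords i \<beta>"
  have "holomorphic_jet_section A k \<sigma>" using \<sigma> by (simp add: invariant_jet_differentials_def)
  from bspec[OF this[unfolded holomorphic_jet_section_def] chart[folded A_def]]
  have "\<exists>S a. finite S \<and> (\<forall>\<alpha>\<in>S. holomorphic_several_on (a \<alpha>) (?\<phi> ` U))
      \<and> (\<forall>x\<in>U. \<forall>f\<in>curves_at A x.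
           \<sigma> x (jet A k f) = (\<Sum>\<alpha>\<in>S. a \<alpha> (?\<phi> x) * jet_monomial k \<alpha> (coord_deriv ?\<phi> f)))"
    by (simp only: case_prod_conv)
  then obtain S a where S: "finite S" "\<forall>\<alpha>\<in>S. holomorphic_several_on (a \<alpha>) (?\<phi> ` U)"
    and form: "\<forall>x\<in>U. \<forall>f\<in>curves_at A x.
      \<sigma> x (jet A k f) = (\<Sum>\<alpha>\<in>S. a \<alpha> (?\<phi> x) * jet_monomial k \<alpha> (coord_deriv ?\<phi> f))"
    by (elim exE conjE) (rule that)
  have coords: "?\<phi> (proj_point x) = (\<chi> b. x $ \<beta> b / x $ i)" if "x \<in> C" for x
    by (rule affine_coords_proj_point[OF C(3)[OF that]])
  show ?thesis
  proof (rule that[of C i S "?\<phi> ` U" \<beta> a, OF C(1,2,3) S(1)])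
    show "holomorphic_several_on (a \<alpha>) (?\<phi> ` U)" if "\<alpha> \<in> S" for \<alpha>
      using S(2) that by blast
    show "open (?\<phi> ` U)" using chart by (simp add: submanifold_charts_def)
    show "(\<chi> b. x $ \<beta> b / x $ i) \<in> ?\<phi> ` U" if "x \<in> C" "F x = 0" for x
      using coords[OF that(1)] C(4)[OF that] by force
    show "\<sigma> (proj_point (v 0)) (jet A k f) = (\<Sum>\<alpha>\<in>S. a \<alpha> (ratio_jet i \<beta> v 0) * jet_monomial k \<alpha> (ratio_jet i \<beta> v))"
      if v: "v \<in> cone_curves F" "v 0 \<in> C" and f: "f \<in> curves_at A (proj_point (v 0))"
        "\<forall>\<^sub>F t in nhds 0. f t = proj_point (v t)" for v f
    proof -
      have "F (v 0) = 0" using v(1) by (auto simp: cone_curves_def dest: eventually_nhds_x_imp_x)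
      then have "proj_point (v 0) \<in> U" using C(4) v(2) by blast
      from form[rule_format, OF this f(1)]
      have "\<sigma> (proj_point (v 0)) (jet A k f) = (\<Sum>\<alpha>\<in>S. a \<alpha> (?\<phi> (proj_point (v 0))) * jet_monomial k \<alpha> (coord_deriv ?\<phi> f))" .
      moreover have "coord_deriv ?\<phi> f = ratio_jet i \<beta> v"
        by (rule ext) (rule coord_deriv_affine[OF v(1) C(3)[OF v(2)] f(2)])
      moreover have "?\<phi> (proj_point (v 0)) = ratio_jet i \<beta> v 0"
        by (simp add: coords[OF v(2)] ratio_jet_def)
      ultimately show ?thesis by simp
    qed
  qed (assumption | rule refl)+
qed

lemma cone_curve_base:
  assumes "v \<in> cone_curves F"
  shows "F (v 0) = 0" "v 0 \<noteq> 0" "proj_point (v 0) \<in> hypersurface"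
    "(\<lambda>t. proj_point (v t)) \<in> curves_at A (proj_point (v 0))"
proof -
  show v0: "F (v 0) = 0" "v 0 \<noteq> 0" using assms by (auto simp: cone_curves_def dest: eventually_nhds_x_imp_x)
  then show "proj_point (v 0) \<in> hypersurface" by (simp add: proj_point_in_hypersurface)
  show "(\<lambda>t. proj_point (v t)) \<in> curves_at A (proj_point (v 0))"
    unfolding A_def
    by (rule standard_chart[OF card v0], rule cone_curve_projects[OF assms])
qed

text \<open>Continuity and holomorphy hold because, in a standard chart, the section is a finite sum of
  holomorphic coefficients times monomials in the derivatives of ratios of coordinates of the lift.
  The weight is the invariance under the reparametrisation \<open>t \<mapsto> l t\<close>.\<close>

lemma curve_functional_cone_fun:
  assumes "m \<ge> 1" "k + 2 < CARD('N)"
  shows "curve_functional F d cone_fun k m"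
proof unfold_locales
  show "1 \<le> m" "k + 2 < CARD('N)" by fact+
next
  fix vs v
  assume vs: "\<And>n. vs n \<in> cone_curves F" and v: "v \<in> cone_curves F"
    and lim: "\<And>j. j \<le> k \<Longrightarrow> (\<lambda>n. vjet (vs n) j) \<longlonglongrightarrow> vjet v j"
  obtain i and \<beta> :: "'n \<Rightarrow> 'N" and C B S and a where
    C: "open C" "v 0 \<in> C" "\<And>x. x \<in> C \<Longrightarrow> x $ i \<noteq> 0"
    and S: "finite S" "open B" "\<And>x. x \<in> C \<Longrightarrow> F x = 0 \<Longrightarrow> (\<chi> b. x $ \<beta> b / x $ i) \<in> B"
    "\<And>\<alpha>. \<alpha> \<in> S \<Longrightarrow> holomorphic_several_on (a \<alpha>) B"
    and form: "\<And>v f. v \<in> cone_curves F \<Longrightarrow> v 0 \<in> C \<Longrightarrow> f \<in> curves_at A (proj_point (v 0)) \<Longrightarrow>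
       (\<forall>\<^sub>F t in nhds 0. f t = proj_point (v t)) \<Longrightarrow>
       \<sigma> (proj_point (v 0)) (jet A k f) = (\<Sum>\<alpha>\<in>S. a \<alpha> (ratio_jet i \<beta> v 0) * jet_monomial k \<alpha> (ratio_jet i \<beta> v))"
    by (rule local_formula[OF cone_curve_base(1,2)[OF v]]) (rule that)
  have form': "cone_fun w = (\<Sum>\<alpha>\<in>S. a \<alpha> (ratio_jet i \<beta> w 0) * jet_monomial k \<alpha> (ratio_jet i \<beta> w))"
    if "w \<in> cone_curves F" "w 0 \<in> C" for w
    unfolding cone_fun_def by (rule form[OF that cone_curve_base(4)[OF that(1)]]) simp
  have comp: "jets_tendsto k (\<lambda>n t. vs n t $ b) (\<lambda>t. v t $ b)" for b
    using vs v tendsto_vec_nth[OF lim, of _ b] by (auto simp: jets_tendsto_def cone_curves_def vjet_nth)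
  have ratio: "(\<lambda>n. ratio_jet i \<beta> (vs n) j) \<longlonglongrightarrow> ratio_jet i \<beta> v j" if "j \<le> k" for j
  proof (rule vec_tendstoI)
    show "(\<lambda>n. ratio_jet i \<beta> (vs n) j $ b) \<longlonglongrightarrow> ratio_jet i \<beta> v j $ b" for b
      using jets_tendsto_divide[OF comp[of "\<beta> b"] comp[of i] C(3)[OF C(2)]] that
      by (simp add: jets_tendsto_def ratio_jet_def)
  qed
  have "ratio_jet i \<beta> v 0 \<in> B"
    using S(3)[OF C(2) cone_curve_base(1)[OF v]] by (simp add: ratio_jet_def)
  then have "isCont (a \<alpha>) (ratio_jet i \<beta> v 0)" if "\<alpha> \<in> S" for \<alpha>
    using S(4)[OF that] unfolding holomorphic_several_on_def by (blast intro: has_derivative_continuous)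
  then have "(\<lambda>n. a \<alpha> (ratio_jet i \<beta> (vs n) 0)) \<longlonglongrightarrow> a \<alpha> (ratio_jet i \<beta> v 0)" if "\<alpha> \<in> S" for \<alpha>
    using that ratio[of 0] by (intro isCont_tendsto_compose[of _ "a \<alpha>"]) auto
  then have "(\<lambda>n. \<Sum>\<alpha>\<in>S. a \<alpha> (ratio_jet i \<beta> (vs n) 0) * jet_monomial k \<alpha> (ratio_jet i \<beta> (vs n)))
      \<longlonglongrightarrow> (\<Sum>\<alpha>\<in>S. a \<alpha> (ratio_jet i \<beta> v 0) * jet_monomial k \<alpha> (ratio_jet i \<beta> v))"
    unfolding jet_monomial_def
    by (intro tendsto_sum tendsto_mult tendsto_prod tendsto_power tendsto_vec_nth ratio) auto
  moreover have "(\<lambda>n. vs n 0) \<longlonglongrightarrow> v 0" using lim[of 0] by simp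
  then have "\<forall>\<^sub>F n in sequentially. vs n 0 \<in> C" using C(1,2) by (rule topological_tendstoD)
  then have "\<forall>\<^sub>F n in sequentially. (\<Sum>\<alpha>\<in>S. a \<alpha> (ratio_jet i \<beta> (vs n) 0) * jet_monomial k \<alpha> (ratio_jet i \<beta> (vs n))) = cone_fun (vs n)"
    by eventually_elim (simp add: form' vs)
  ultimately show "(\<lambda>n. cone_fun (vs n)) \<longlonglongrightarrow> cone_fun v"
    unfolding form'[OF v C(2)] by (rule Lim_transform_eventually)
next
  fix f f' :: "complex \<Rightarrow> complex \<Rightarrow> complex^'N"
  assume fam: "\<And>i. holo_family (\<lambda>s t. f s t $ i) (\<lambda>s t. f' s t $ i)"
    and fc: "\<forall>\<^sub>F s in nhds 0. f s \<in> cone_curves F"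
  have f0: "f 0 \<in> cone_curves F" using eventually_nhds_x_imp_x[OF fc] .
  obtain i and \<beta> :: "'n \<Rightarrow> 'N" and C B S and a where
    C: "open C" "f 0 0 \<in> C" "\<And>x. x \<in> C \<Longrightarrow> x $ i \<noteq> 0"
    and S: "finite S" "open B" "\<And>x. x \<in> C \<Longrightarrow> F x = 0 \<Longrightarrow> (\<chi> b. x $ \<beta> b / x $ i) \<in> B"
    "\<And>\<alpha>. \<alpha> \<in> S \<Longrightarrow> holomorphic_several_on (a \<alpha>) B"
    and form: "\<And>v f. v \<in> cone_curves F \<Longrightarrow> v 0 \<in> C \<Longrightarrow> f \<in> curves_at A (proj_point (v 0)) \<Longrightarrow>
       (\<forall>\<^sub>F t in nhds 0. f t = proj_point (v t)) \<Longrightarrow>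
       \<sigma> (proj_point (v 0)) (jet A k f) = (\<Sum>\<alpha>\<in>S. a \<alpha> (ratio_jet i \<beta> v 0) * jet_monomial k \<alpha> (ratio_jet i \<beta> v))"
    by (rule local_formula[OF cone_curve_base(1,2)[OF f0]]) (rule that)
  have form': "cone_fun w = (\<Sum>\<alpha>\<in>S. a \<alpha> (ratio_jet i \<beta> w 0) * jet_monomial k \<alpha> (ratio_jet i \<beta> w))"
    if "w \<in> cone_curves F" "w 0 \<in> C" for w
    unfolding cone_fun_def by (rule form[OF that cone_curve_base(4)[OF that(1)]]) simp
  have an: "(\<lambda>s. ratio_jet i \<beta> (f s) j $ b) analytic_on {0}" for j b
    unfolding ratio_jet_def
    using holo_family_jet_analytic[OF holo_family_divide[OF fam[of "\<beta> b"] fam[of i] C(3)[OF C(2)]], of j] by simp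
  have B0: "ratio_jet i \<beta> (f 0) 0 \<in> B"
    using S(3)[OF C(2) cone_curve_base(1)[OF f0]] by (simp add: ratio_jet_def)
  have "(\<lambda>s. a \<alpha> (ratio_jet i \<beta> (f s) 0)) analytic_on {0}" if "\<alpha> \<in> S" for \<alpha>
    by (rule analytic_compose_vec[OF S(2) _ an B0])
      (use S(4)[OF that] in \<open>simp add: holomorphic_several_on_def\<close>)
  then have sum_an: "(\<lambda>s. \<Sum>\<alpha>\<in>S. a \<alpha> (ratio_jet i \<beta> (f s) 0) * jet_monomial k \<alpha> (ratio_jet i \<beta> (f s))) analytic_on {0}"
    unfolding jet_monomial_def
    by (intro analytic_on_sum analytic_on_mult analytic_on_prod analytic_on_power an) auto
  have "(\<lambda>s. f s 0 $ b) analytic_on {0}" for b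
    using holo_family_jet_analytic[OF fam[of b], of 0] by simp
  then have "\<forall>\<^sub>F s in nhds 0. f s 0 \<in> C"
    by (rule eventually_in_open_analytic[where v = "\<lambda>s. f s 0", OF _ C(1,2)])
  with fc have ev: "\<forall>\<^sub>F s in nhds 0. (\<Sum>\<alpha>\<in>S. a \<alpha> (ratio_jet i \<beta> (f s) 0) * jet_monomial k \<alpha> (ratio_jet i \<beta> (f s))) = cone_fun (f s)"
    by eventually_elim (simp add: form')
  show "(\<lambda>s. cone_fun (f s)) analytic_on {0}"
    by (rule iffD1[OF analytic_at_cong[OF ev refl] sum_an])
next
  fix v and l :: complex
  assume v: "v \<in> cone_curves F" and l: "l \<noteq> 0"
  have "\<sigma> (proj_point (v 0)) \<in> invariant_fibre A k m (proj_point (v 0))"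
    using \<sigma> cone_curve_base(3)[OF v] by (simp add: invariant_jet_differentials_def)
  then have "\<sigma> (proj_point (v 0)) (jet A k ((\<lambda>t. proj_point (v t)) \<circ> (\<lambda>t. l * t)))
      = deriv (\<lambda>t. l * t) 0 ^ m * \<sigma> (proj_point (v 0)) (jet A k (\<lambda>t. proj_point (v t)))"
    using cone_curve_base(4)[OF v] biholomorphism_germ_scale[OF l] unfolding invariant_fibre_def by blast
  then show "cone_fun (\<lambda>t. v (l * t)) = l ^ m * cone_fun v"
    by (simp add: cone_fun_def o_def)
next
  show "cone_fun (\<lambda>t. c *s v t) = cone_fun v" if "c \<noteq> 0" for v c
    using that by (simp add: cone_fun_def)
qed

text \<open>Every jet on the hypersurface is the jet of a curve that lifts to the cone, where
  \<open>vanishing\<close> applies.\<close>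

lemma section_eq_0:
  assumes "m \<ge> 1" "k + 2 < CARD('N)"
  shows "\<sigma> = (\<lambda>x J. 0)"
proof (intro ext)
  fix x J
  consider "x \<notin> hypersurface" | "x \<in> hypersurface" "J \<notin> jet_fibre A k x"
    | f where "x \<in> hypersurface" "J = jet A k f" "f \<in> curves_at A x"
    unfolding jet_fibre_def by blast
  then show "\<sigma> x J = 0"
  proof cases
    case 1
    then show ?thesis using \<sigma> by (simp add: invariant_jet_differentials_def)
  next
    case 2
    then show ?thesis using \<sigma> unfolding invariant_jet_differentials_def invariant_fibre_def GG_fibre_def by blast
  next
    case 3
    obtain v where v: "v \<in> cone_curves F" "\<forall>\<^sub>F t in nhds 0. f t = proj_point (v t)"
      by (rule curve_lift[OF 3(3)[unfolded A_def]]) (rule that)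
    have x: "x = proj_point (v 0)"
      using eventually_nhds_x_imp_x[OF v(2)] 3(3) by (simp add: curves_at_def)
    obtain i and \<beta> :: "'n \<Rightarrow> 'N" and C B S and a where
      C: "open C" "v 0 \<in> C" "\<And>x. x \<in> C \<Longrightarrow> x $ i \<noteq> 0"
      and "finite S" "open B" "\<And>x. x \<in> C \<Longrightarrow> F x = 0 \<Longrightarrow> (\<chi> b. x $ \<beta> b / x $ i) \<in> B"
      "\<And>\<alpha>. \<alpha> \<in> S \<Longrightarrow> holomorphic_several_on (a \<alpha>) B"
      and form: "\<And>v f. v \<in> cone_curves F \<Longrightarrow> v 0 \<in> C \<Longrightarrow> f \<in> curves_at A (proj_point (v 0)) \<Longrightarrow>
         (\<forall>\<^sub>F t in nhds 0. f t = proj_point (v t)) \<Longrightarrow>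
         \<sigma> (proj_point (v 0)) (jet A k f) = (\<Sum>\<alpha>\<in>S. a \<alpha> (ratio_jet i \<beta> v 0) * jet_monomial k \<alpha> (ratio_jet i \<beta> v))"
      by (rule local_formula[OF cone_curve_base(1,2)[OF v(1)]]) (rule that)
    have "\<sigma> x J = cone_fun v"
      using form[OF v(1) C(2) _ v(2)] form[OF v(1) C(2) cone_curve_base(4)[OF v(1)]] 3 x
      by (simp add: cone_fun_def)
    also have "\<dots> = 0"
      by (rule curve_functional.vanishing[OF curve_functional_cone_fun[OF assms] v(1)])
    finally show ?thesis .
  qed
qed

end

theorem theorem1:
  fixes X :: "(complex^'N) set set" and k m :: nat
  assumes "CARD('N) = CARD('n::finite) + 2"
    and "smooth_hypersurface X"
    and "m \<ge> 1" and "1 \<le> k" and "k \<le> CARD('n) - 1"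
  shows "invariant_jet_differentials X
           (submanifold_charts X :: ((complex^'N) set, 'n) chart set) k m = {\<lambda>x J. 0}"
proof -
  obtain d F where F: "d \<ge> 1" "homogeneous_form d F" "X = proj_point ` {v. v \<noteq> 0 \<and> F v = 0}"
    "\<forall>v. v \<noteq> 0 \<and> F v = 0 \<longrightarrow> (\<exists>i. partial_deriv i F v \<noteq> 0)"
    using assms(2) unfolding smooth_hypersurface_def by blast
  interpret smooth_cone F d using F by unfold_locales auto
  have X: "X = hypersurface" by (simp add: F(3) hypersurface_def)
  have k: "k + 2 < CARD('N)" using assms by simp
  show ?thesis
  proof (intro set_eqI iffI)
    fix \<sigma> assume "\<sigma> \<in> invariant_jet_differentials X (submanifold_charts X :: ((complex^'N) set, 'n) chart set) k m"
    then interpret jet_section F d "submanifold_charts X :: ((complex^'N) set, 'n) chart set" \<sigma> k m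
      using assms(1) by unfold_locales (simp_all add: X)
    show "\<sigma> \<in> {\<lambda>x J. 0}" using section_eq_0[OF assms(3) k] by simp
  qed (simp add: zero_section)
qed

end
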